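(* Fix $j_1,j_2\in\mathbb{N}$ with $j_1<j_2$, put $m=j_2-j_1+1$, and suppose that the wavelet conditions $(W1)$–$(W4)$ and the conditions $(A1)$–$(A5)$ listed in the context hold for the octaves $j=j_1,\ldots,j_2$. Let $w_{j_1},\ldots,w_{j_2}\in\mathbb{R}$ be weights satisfying $\sum_{j=j_1}^{j_2}w_j=0$ and $\sum_{j=j_1}^{j_2}j\,w_j=1$, and define, with $p=p(n)$, $$\widehat h_q:=\frac12\Big(\sum_{j=j_1}^{j_2}w_j\log_2\lambda_{p-r+q}\big(\mathbf{W}(a(n)2^j)\big)-1\Big),\qquad q=1,\ldots,r.$$ Suppose further that one of the following holds: (i) either $-1/2<h_1<\cdots<h_r<\infty$; (ii) or $h_1=\cdots=h_r$ and the functions $\xi_q$ (defined in the context) satisfy $\xi_{q_1}(1)\ne\xi_{q_2}(1)$ whenever $q_1\neq q_2$. Then, as $n\to\infty$, $$\sqrt{\frac n{a(n)}}\,\big(\widehat h_q-h_q\big)_{q=1,\ldots,r}\xrightarrow{\ d\ }\mathcal N(0,M\Sigma_\lambda M^* ),$$ where $\Sigma_\lambda\in\mathcal S_{\ge0}(mr,\mathbb{R})$ is the limiting covariance matrix of the wavelet log-eigenvalues defined in the context, and $M\in M(r,mr,\mathbb{R})$ is the weight matrix $$M=\frac1{2\log2}\Big(2^{j_1/2}w_{j_1}I_r,\ 2^{(j_1+1)/2}w_{j_1+1}I_r,\ \ldots,\ 2^{j_2/2}w_{j_2}I_r\Big),$$ with $I_r$ the $r\times r$ identity matrix.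
   Context: **Notation.** $M(m_1,m_2,\mathbb{R})$ is the space of real $m_1\times m_2$ matrices, $GL(r,\mathbb{R})$ the invertible $r\times r$ ones; $\mathcal S_{\ge0}(m,\mathbb{R})$, $\mathcal S_{>0}(m,\mathbb{R})$ are the symmetric positive semidefinite, resp. positive definite, $m\times m$ matrices. $^*$ is transposition, $I$ the identity, $\|\cdot\|$ the operator norm. For a symmetric $p\times p$ matrix $S$, $\lambda_1(S)\le\cdots\le\lambda_p(S)$ are its ordered eigenvalues. $\mathrm{vec}_{\mathcal S}(S)$ stacks the entries of $S$ on and below the diagonal, column by column. $O_{\mathbb P}(1)$ means bounded in probability (in operator norm). For a square matrix $H$ and $c>0$, $c^H=\exp(\log(c)H)$. **Model.** $r\in\mathbb{N}$ is fixed and $p=p(n)$ may depend on $n$. The observations are $Y(t)=P(n)X(t)+Z(t)$, $t\in\mathbb{Z}$, where $X$ is an $\mathbb{R}^r$-valued process, $Z$ is an $\mathbb{R}^{p}$-valued process independent of $X$ (all with finite variance, possibly non-Gaussian), and $P(n)=(\mathbf p_1(n),\ldots,\mathbf p_r(n))\in M(p,r,\mathbb{R})$ is deterministic with unit-norm columns. The scaling matrix is $H=P_H\,\mathrm{diag}(h_1,\ldots,h_r)P_H^{-1}$ with $P_H\in GL(r,\mathbb{R})$ and $-1/2<h_1\le\cdots\le h_r<\infty$. **Wavelet coefficients.** Let $\phi,\psi$ be the scaling and wavelet functions of a multiresolution analysis of $L^2(\mathbb{R})$. The wavelet coefficients of $Y$ are $D(2^j,k)=\sum_{\ell\in\mathbb{Z}}Y(\ell)h_{j,2^jk-\ell}$,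 $h_{j,\ell}=2^{-j/2}\int_{\mathbb{R}}\phi(t+\ell)\psi(2^{-j}t)\,dt$; $D_X$, $D_Z$ are defined in the same way from $X$ and $Z$. Let $\{a(n)\}$ be a sequence of powers of $2$, and $n_{a,j}=n/(a(n)2^j)$ (treated as an integer). Put $$\mathbf W(a(n)2^j)=\frac1{n_{a,j}}\sum_{k=1}^{n_{a,j}}D(a(n)2^j,k)D(a(n)2^j,k)^*,$$ and define $\mathbf W_X$, $\mathbf W_Z$, $\mathbf W_{X,Z}$ by replacing $DD^*$ with $D_XD_X^*$, $D_ZD_Z^*$, $D_XD_Z^*$, respectively. Let $$\widehat{\mathbf B}_a(2^j)=P_H^{-1}a(n)^{-H-\frac12I}\,\mathbf W_X(a(n)2^j)\,a(n)^{-H^*-\frac12I}(P_H^* )^{-1},\qquad \mathbf B_a(2^j)=\mathbb{E}\widehat{\mathbf B}_a(2^j).$$ **Wavelet conditions.** $(W1)$ $\psi\in L^2(\mathbb{R})$, $\int\psi^2=1$, $\int t^m\psi(t)dt=0$ for $m=0,\ldots,N_\psi-1$ and $\int t^{N_\psi}\psi(t)dt\ne0$, for some integer $N_\psi\ge1$. $(W2)$ $\phi,\psi\in L^1(\mathbb{R})$ are compactly supported and $\widehat\phi(0)=1$. $(W3)$ There is $\alpha>1$ with $\sup_{x\in\mathbb{R}}|\widehat\psi(x)|(1+|x|)^\alpha<\infty$. $(W4)$ $\sum_{k\in\mathbb{Z}}k^m\phi(\cdot-k)$ is a polynomial of degree $m$ for all $m=0,\ldots,N_\psi-1$. **Conditions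 $(A1)$–$(A5)$**, for octaves $j=j_1,\ldots,j_2$. $(A1)$ $\mathbf W(a(n)2^j)=P(n)\mathbf W_XP^*(n)+\mathbf W_Z+P(n)\mathbf W_{X,Z}+\mathbf W_{X,Z}^*P^*(n)$ (all at scale $a(n)2^j$) is well defined a.s. $(A2)$ $\max\{\|\mathbb{E}\mathbf W_Z(a(n)2^j)\|,\ \|\mathbf W_Z(a(n)2^j)\|,\ \|a(n)^{-H-\frac12I}\mathbf W_{X,Z}(a(n)2^j)\|\}=O_{\mathbb P}(1)$. $(A3)$ As $n\to\infty$, $\big(\sqrt{n_{a,j}}(\mathrm{vec}_{\mathcal S}\widehat{\mathbf B}_a(2^j)-\mathrm{vec}_{\mathcal S}\mathbf B_a(2^j))\big)_{j=j_1,\ldots,j_2}\xrightarrow{d}\mathcal N(0,\Sigma_B)$ for some positive semidefinite $\Sigma_B$; and for some $\beta>0$ and some $\mathbf B(2^j)\in\mathcal S_{>0}(r,\mathbb{R})$, $\|\mathbf B_a(2^j)-\mathbf B(2^j)\|=O(a(n)^{-\beta})$ for each $j$. $(A4)$ $a(n)\le n/2^{j_2}$, $\ \frac{a(n)}n+\frac n{a(n)^{2\varpi+1}}\to0$, $\ \frac{p(n)}{n/a(n)}\to c\in[0,\infty)$, where $$\varpi=\min\Big\{\min_{2\le i\le r:\ h_i-h_{i-1}>0}(h_i-h_{i-1}),\ \beta,\ \tfrac{h_1}2+\tfrac14\Big\}$$ (a minimum over the empty set is omitted). $(A5)$ Let $P(n)P_H=Q(n)R(n)$ be the QR decomposition,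 with $Q(n)\in M(p,r,\mathbb{R})$ having orthonormal columns and $R(n)\in GL(r,\mathbb{R})$ upper triangular. There is a deterministic $A\in\mathcal S_{>0}(r,\mathbb{R})$ with Cholesky decomposition $A=R^*R$ such that $\|R(n)-R\|=O(a(n)^{-\varpi})$. **The functions $\xi_q$.** Under $(W1)$–$(W4)$ and $(A1)$–$(A5)$ it is known (Abry, Boniece, Didier, Wendt 2022) that the limits in probability $$\xi_q(2^j):=\lim_{n\to\infty}\frac{\lambda_{p-r+q}(\mathbf W(a(n)2^j))}{a(n)^{2h_q+1}}>0,\qquad q=1,\ldots,r,$$ exist, are deterministic, and satisfy $\xi_q(2^j)=2^{j(2h_q+1)}\xi_q(1)$ (which defines $\xi_q(1)$). **The matrix $\Sigma_\lambda$.** Under the hypotheses of the claim, it is known (same reference) that there is $\Sigma_\lambda\in\mathcal S_{\ge0}(mr,\mathbb{R})$ such that, as $n\to\infty$, $$\Big(\sqrt{n_{a,j}}\big(\log\lambda_{p-r+q}(\mathbf W(a(n)2^j))-\log\lambda_{p-r+q}(\mathbb{E}\mathbf W(a(n)2^j))\big)_{q=1,\ldots,r}\Big)_{j=j_1,\ldots,j_2}\xrightarrow{d}\mathcal N(0,\Sigma_\lambda).$$ *)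

theory Defs
  imports
    "HOL-Probability.Probability"
    "HOL-Library.Landau_Symbols"
    "Jordan_Normal_Form.Char_Poly"
    "Jordan_Normal_Form.Gauss_Jordan_Elimination"
begin

no_notation vec_nth (infixl "$" 90)
unbundle no inner_syntax

section \<open>Matrices\<close>

text \<open>
  The observation dimension depends on the sample size, so all vectors and matrices are the
  dimension-carrying ones of \<open>Jordan_Normal_Form.Matrix\<close>. Their entries are indexed from 0;
  eigenvalues and scaling exponents are indexed from 1.
\<close>

type_synonym rvec = "real Matrix.vec"
type_synonym rmat = "real Matrix.mat"

definition vnorm :: "rvec \<Rightarrow> real" where
  "vnorm v = sqrt (scalar_prod v v)"

definition op_norm :: "rmat \<Rightarrow> real" where
  "op_norm A = Sup {vnorm (A *\<^sub>v v) | v. v \<in> carrier_vec (dim_col A) \<and> vnorm v \<le> 1}"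

definition minv :: "rmat \<Rightarrow> rmat" where
  "minv A = the (mat_inverse A)"

definition mat_exp :: "rmat \<Rightarrow> rmat" where
  "mat_exp A = Matrix.mat (dim_row A) (dim_row A) (\<lambda>ij. \<Sum>k. (A ^\<^sub>m k) $$ ij / fact k)"

definition mat_powr :: "real \<Rightarrow> rmat \<Rightarrow> rmat" where
  "mat_powr c H = mat_exp (ln c \<cdot>\<^sub>m H)"

definition pos_semidef :: "nat \<Rightarrow> rmat \<Rightarrow> bool" where
  "pos_semidef d A \<longleftrightarrow> A \<in> carrier_mat d d \<and> transpose_mat A = A \<and>
     (\<forall>v\<in>carrier_vec d. scalar_prod v (A *\<^sub>v v) \<ge> 0)"

definition pos_def :: "nat \<Rightarrow> rmat \<Rightarrow> bool" where
  "pos_def d A \<longleftrightarrow> A \<in> carrier_mat d d \<and> transpose_mat A = A \<and>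
     (\<forall>v\<in>carrier_vec d. v \<noteq> 0\<^sub>v d \<longrightarrow> scalar_prod v (A *\<^sub>v v) > 0)"

text \<open>
  The \<open>k\<close>-th smallest eigenvalue, \<open>k = 1, \<dots>, p\<close>, counted with multiplicity. For a real
  symmetric \<open>p \<times> p\<close> matrix the list of real roots of the characteristic polynomial has
  length \<open>p\<close>.
\<close>

definition ord_eigenvalue :: "nat \<Rightarrow> rmat \<Rightarrow> real" where
  "ord_eigenvalue k S = sorted_list_of_multiset (proots (char_poly S)) ! (k - 1)"

definition vec_sym_list :: "rmat \<Rightarrow> real list" where
  "vec_sym_list S = concat (map (\<lambda>j. map (\<lambda>i. S $$ (i, j)) [j..<dim_row S]) [0..<dim_col S])"

section \<open>Random vectors, convergence and Gaussian limits\<close>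

definition random_vec :: "'a measure \<Rightarrow> nat \<Rightarrow> ('a \<Rightarrow> rvec) \<Rightarrow> bool" where
  "random_vec M d V \<longleftrightarrow> (\<forall>\<omega>\<in>space M. V \<omega> \<in> carrier_vec d) \<and>
     (\<forall>i<d. (\<lambda>\<omega>. V \<omega> $ i) \<in> borel_measurable M)"

definition finite_variance_vec :: "'a measure \<Rightarrow> nat \<Rightarrow> ('a \<Rightarrow> rvec) \<Rightarrow> bool" where
  "finite_variance_vec M d V \<longleftrightarrow> random_vec M d V \<and>
     (\<forall>i<d. integrable M (\<lambda>\<omega>. (V \<omega> $ i)\<^sup>2))"

definition mat_expectation :: "'a measure \<Rightarrow> nat \<Rightarrow> nat \<Rightarrow> ('a \<Rightarrow> rmat) \<Rightarrow> rmat" where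
  "mat_expectation M d1 d2 V = Matrix.mat d1 d2 (\<lambda>ij. LINT \<omega>|M. V \<omega> $$ ij)"

definition bounded_in_prob :: "'a measure \<Rightarrow> (nat \<Rightarrow> 'a \<Rightarrow> real) \<Rightarrow> bool" where
  "bounded_in_prob M V \<longleftrightarrow> (\<forall>\<^sub>F n in sequentially. V n \<in> borel_measurable M) \<and>
     (\<forall>\<epsilon>>0. \<exists>K. \<forall>\<^sub>F n in sequentially. measure M {\<omega>\<in>space M. \<bar>V n \<omega>\<bar> > K} \<le> \<epsilon>)"

definition tendsto_in_prob :: "'a measure \<Rightarrow> (nat \<Rightarrow> 'a \<Rightarrow> real) \<Rightarrow> real \<Rightarrow> bool" where
  "tendsto_in_prob M V l \<longleftrightarrow> (\<forall>\<^sub>F n in sequentially. V n \<in> borel_measurable M) \<and>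
     (\<forall>\<epsilon>>0. (\<lambda>n. measure M {\<omega>\<in>space M. \<bar>V n \<omega> - l\<bar> > \<epsilon>}) \<longlonglongrightarrow> 0)"

text \<open>
  \<open>\<real>\<^sup>d\<close> as a topological and measurable space is the finite product of \<open>d\<close> copies of the reals:
  \<open>powertop_real {..<d}\<close> and \<open>PiM {..<d} (\<lambda>_. borel)\<close>, whose points are the functions
  on \<open>{..<d}\<close>.
\<close>

definition coords :: "nat \<Rightarrow> rvec \<Rightarrow> nat \<Rightarrow> real" where
  "coords d v = restrict (\<lambda>i. v $ i) {..<d}"

definition weak_conv_vec ::
  "nat \<Rightarrow> 'a measure \<Rightarrow> (nat \<Rightarrow> 'a \<Rightarrow> rvec) \<Rightarrow> (nat \<Rightarrow> real) measure \<Rightarrow> bool" where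
  "weak_conv_vec d M V \<mu> \<longleftrightarrow>
     (\<forall>\<^sub>F n in sequentially. random_vec M d (V n)) \<and>
     (\<forall>f. continuous_map (powertop_real {..<d}) euclideanreal f \<and>
          bounded (f ` topspace (powertop_real {..<d})) \<longrightarrow>
        (\<lambda>n. LINT \<omega>|M. f (coords d (V n \<omega>))) \<longlonglongrightarrow> (LINT x|\<mu>. f x))"

text \<open>
  The possibly degenerate law \<open>N(0, \<Sigma>)\<close> on \<open>\<real>\<^sup>d\<close>, given by its characteristic function.
\<close>

definition centered_normal :: "nat \<Rightarrow> rmat \<Rightarrow> (nat \<Rightarrow> real) measure \<Rightarrow> bool" where
  "centered_normal d \<Sigma> \<mu> \<longleftrightarrow> prob_space \<mu> \<and> sets \<mu> = sets (PiM {..<d} (\<lambda>_. borel)) \<and>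
     (\<forall>t\<in>carrier_vec d. (LINT x|\<mu>. iexp (\<Sum>i<d. t $ i * x i)) =
        complex_of_real (exp (- scalar_prod t (\<Sigma> *\<^sub>v t) / 2)))"

definition conv_dist_normal ::
  "nat \<Rightarrow> 'a measure \<Rightarrow> (nat \<Rightarrow> 'a \<Rightarrow> rvec) \<Rightarrow> rmat \<Rightarrow> bool" where
  "conv_dist_normal d M V \<Sigma> \<longleftrightarrow> (\<exists>\<mu>. centered_normal d \<Sigma> \<mu> \<and> weak_conv_vec d M V \<mu>)"

section \<open>Wavelets\<close>

definition L2_fun :: "(real \<Rightarrow> real) set" where
  "L2_fun = {f. f \<in> borel_measurable lborel \<and> integrable lborel (\<lambda>t. (f t)\<^sup>2)}"

definition L2_inner :: "(real \<Rightarrow> real) \<Rightarrow> (real \<Rightarrow> real) \<Rightarrow> real" where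
  "L2_inner f g = (LINT t|lborel. f t * g t)"

definition L2_dist :: "(real \<Rightarrow> real) \<Rightarrow> (real \<Rightarrow> real) \<Rightarrow> real" where
  "L2_dist f g = sqrt (LINT t|lborel. (f t - g t)\<^sup>2)"

definition closed_L2_subspace :: "(real \<Rightarrow> real) set \<Rightarrow> bool" where
  "closed_L2_subspace V \<longleftrightarrow> V \<subseteq> L2_fun \<and> (\<lambda>t. 0) \<in> V \<and>
     (\<forall>f\<in>V. \<forall>g\<in>V. \<forall>b c. (\<lambda>t. b * f t + c * g t) \<in> V) \<and>
     (\<forall>f\<in>L2_fun. (\<forall>\<epsilon>>0. \<exists>g\<in>V. L2_dist f g < \<epsilon>) \<longrightarrow> f \<in> V)"

definition L2_orthonormal_basis :: "(int \<Rightarrow> real \<Rightarrow> real) \<Rightarrow> (real \<Rightarrow> real) set \<Rightarrow> bool" where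
  "L2_orthonormal_basis e V \<longleftrightarrow> (\<forall>k. e k \<in> V) \<and>
     (\<forall>k l. L2_inner (e k) (e l) = (if k = l then 1 else 0)) \<and>
     (\<forall>f\<in>V. \<forall>\<epsilon>>0. \<exists>K c. finite K \<and> L2_dist f (\<lambda>t. \<Sum>k\<in>K. c k * e k t) < \<epsilon>)"

definition dyadic :: "(real \<Rightarrow> real) \<Rightarrow> int \<Rightarrow> int \<Rightarrow> real \<Rightarrow> real" where
  "dyadic f j k t = 2 powr (- real_of_int j / 2) * f (2 powr (- real_of_int j) * t - real_of_int k)"

text \<open>
  \<open>\<phi>\<close> and \<open>\<psi>\<close> are the scaling and wavelet functions of an (orthonormal) multiresolution
  analysis \<open>(V j)\<close>, larger \<open>j\<close> being coarser; the detail space at scale \<open>2\<^sup>j\<close> is the orthogonal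
  complement of \<open>V j\<close> in \<open>V (j - 1)\<close>.
\<close>

definition multiresolution :: "(real \<Rightarrow> real) \<Rightarrow> (real \<Rightarrow> real) \<Rightarrow> bool" where
  "multiresolution \<phi> \<psi> \<longleftrightarrow> (\<exists>V :: int \<Rightarrow> (real \<Rightarrow> real) set.
     (\<forall>j. closed_L2_subspace (V j)) \<and>
     (\<forall>j. V (j + 1) \<subseteq> V j) \<and>
     (\<forall>j f. f \<in> V j \<longleftrightarrow> (\<lambda>t. f (t / 2)) \<in> V (j + 1)) \<and>
     (\<forall>f\<in>(\<Inter>j. V j). AE t in lborel. f t = 0) \<and>
     (\<forall>f\<in>L2_fun. \<forall>\<epsilon>>0. \<exists>g\<in>(\<Union>j. V j). L2_dist f g < \<epsilon>) \<and>
     (\<forall>j. L2_orthonormal_basis (dyadic \<phi> j) (V j)) \<and>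
     (\<forall>j. L2_orthonormal_basis (dyadic \<psi> j) {f \<in> V (j - 1). \<forall>g\<in>V j. L2_inner f g = 0}))"

definition fourier :: "(real \<Rightarrow> real) \<Rightarrow> real \<Rightarrow> complex" where
  "fourier f x = (LINT t|lborel. iexp (- (x * t)) * complex_of_real (f t))"

text \<open>
  \<open>\<phi>\<close> and \<open>\<psi>\<close> are representatives of their almost-everywhere classes, so pointwise requirements
  on them are stated almost everywhere.
\<close>

definition compactly_supported :: "(real \<Rightarrow> real) \<Rightarrow> bool" where
  "compactly_supported f \<longleftrightarrow> (\<exists>K. compact K \<and> (AE t in lborel. t \<notin> K \<longrightarrow> f t = 0))"

definition cond_W1 :: "(real \<Rightarrow> real) \<Rightarrow> nat \<Rightarrow> bool" where
  "cond_W1 \<psi> N \<longleftrightarrow> N \<ge> 1 \<and> \<psi> \<in> L2_fun \<and> (LINT t|lborel. (\<psi> t)\<^sup>2) = 1 \<and>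
     (\<forall>m<N. (LINT t|lborel. t ^ m * \<psi> t) = 0) \<and> (LINT t|lborel. t ^ N * \<psi> t) \<noteq> 0"

definition cond_W2 :: "(real \<Rightarrow> real) \<Rightarrow> (real \<Rightarrow> real) \<Rightarrow> bool" where
  "cond_W2 \<phi> \<psi> \<longleftrightarrow> integrable lborel \<phi> \<and> integrable lborel \<psi> \<and>
     compactly_supported \<phi> \<and> compactly_supported \<psi> \<and> fourier \<phi> 0 = 1"

definition cond_W3 :: "(real \<Rightarrow> real) \<Rightarrow> bool" where
  "cond_W3 \<psi> \<longleftrightarrow> (\<exists>\<alpha>>1. bdd_above (range (\<lambda>x. cmod (fourier \<psi> x) * (1 + \<bar>x\<bar>) powr \<alpha>)))"

definition cond_W4 :: "(real \<Rightarrow> real) \<Rightarrow> nat \<Rightarrow> bool" where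
  "cond_W4 \<phi> N \<longleftrightarrow> (\<forall>m<N. \<exists>q :: real poly. degree q = m \<and>
     (AE x in lborel. (\<Sum>\<^sub>\<infinity>k. real_of_int k ^ m * \<phi> (x - real_of_int k)) = poly q x))"

text \<open>
  Filters and coefficients are parametrized by the scale \<open>s = 2\<^sup>j\<close> in place of the octave \<open>j\<close>.
\<close>

definition wav_filter :: "(real \<Rightarrow> real) \<Rightarrow> (real \<Rightarrow> real) \<Rightarrow> nat \<Rightarrow> int \<Rightarrow> real" where
  "wav_filter \<phi> \<psi> s l =
     real s powr (- 1 / 2) * (LINT t|lborel. \<phi> (t + real_of_int l) * \<psi> (t / real s))"

definition wav_coef ::
  "(real \<Rightarrow> real) \<Rightarrow> (real \<Rightarrow> real) \<Rightarrow> nat \<Rightarrow> (int \<Rightarrow> 'a \<Rightarrow> rvec) \<Rightarrow> nat \<Rightarrow> nat \<Rightarrow> 'a \<Rightarrow> rvec" where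
  "wav_coef \<phi> \<psi> d U s k \<omega> =
     Matrix.vec d (\<lambda>i. \<Sum>\<^sub>\<infinity>l. U l \<omega> $ i * wav_filter \<phi> \<psi> s (int (s * k) - l))"

definition wav_coef_defined ::
  "(real \<Rightarrow> real) \<Rightarrow> (real \<Rightarrow> real) \<Rightarrow> nat \<Rightarrow> (int \<Rightarrow> 'a \<Rightarrow> rvec) \<Rightarrow> nat \<Rightarrow> nat \<Rightarrow> 'a \<Rightarrow> bool" where
  "wav_coef_defined \<phi> \<psi> d U s k \<omega> \<longleftrightarrow>
     (\<forall>i<d. (\<lambda>l. U l \<omega> $ i * wav_filter \<phi> \<psi> s (int (s * k) - l)) summable_on UNIV)"

text \<open>\<open>(1/K) \<Sum>\<^bsub>k\<le>K\<^esub> D\<^sub>1(s,k) D\<^sub>2(s,k)\<^sup>*\<close> for two families of coefficients of dimensions \<open>d1\<close>, \<open>d2\<close>.\<close>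

definition sample_cross ::
  "nat \<Rightarrow> nat \<Rightarrow> nat \<Rightarrow> (nat \<Rightarrow> 'a \<Rightarrow> rvec) \<Rightarrow> (nat \<Rightarrow> 'a \<Rightarrow> rvec) \<Rightarrow> 'a \<Rightarrow> rmat" where
  "sample_cross K d1 d2 D1 D2 \<omega> =
     Matrix.mat d1 d2 (\<lambda>(i, i'). 1 / real K * (\<Sum>k=1..K. D1 k \<omega> $ i * D2 k \<omega> $ i'))"

section \<open>The model\<close>

text \<open>
  \<open>hexp\<close> is indexed from 1: the scaling exponents are \<open>hexp 1, \<dots>, hexp r\<close>. The noise is a
  triangular array, its dimension being \<open>pdim n\<close>.
\<close>

record 'a wav_model =
  prb :: "'a measure"
  phi :: "real \<Rightarrow> real"
  psi :: "real \<Rightarrow> real"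
  rdim :: nat
  pdim :: "nat \<Rightarrow> nat"
  Pmat :: "nat \<Rightarrow> rmat"
  Xproc :: "int \<Rightarrow> 'a \<Rightarrow> rvec"
  Zproc :: "nat \<Rightarrow> int \<Rightarrow> 'a \<Rightarrow> rvec"
  PH :: rmat
  hexp :: "nat \<Rightarrow> real"
  ascale :: "nat \<Rightarrow> nat"

definition Yproc :: "'a wav_model \<Rightarrow> nat \<Rightarrow> int \<Rightarrow> 'a \<Rightarrow> rvec" where
  "Yproc S n t \<omega> = Pmat S n *\<^sub>v Xproc S t \<omega> + Zproc S n t \<omega>"

definition Hmat :: "'a wav_model \<Rightarrow> rmat" where
  "Hmat S = PH S * mat_diag (rdim S) (\<lambda>i. hexp S (i + 1)) * minv (PH S)"

definition proc_family :: "nat \<Rightarrow> (int \<Rightarrow> 'a \<Rightarrow> rvec) \<Rightarrow> 'a \<Rightarrow> int \<times> nat \<Rightarrow> real" where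
  "proc_family d U \<omega> = restrict (\<lambda>(t, i). U t \<omega> $ i) (UNIV \<times> {..<d})"

definition factor_model :: "'a wav_model \<Rightarrow> bool" where
  "factor_model S \<longleftrightarrow>
     prob_space (prb S) \<and> rdim S \<ge> 1 \<and>
     (\<forall>t. finite_variance_vec (prb S) (rdim S) (Xproc S t)) \<and>
     (\<forall>n\<ge>1. \<forall>t. finite_variance_vec (prb S) (pdim S n) (Zproc S n t)) \<and>
     (\<forall>n\<ge>1. prob_space.indep_var (prb S)
        (PiM (UNIV \<times> {..<rdim S}) (\<lambda>_. borel)) (proc_family (rdim S) (Xproc S))
        (PiM (UNIV \<times> {..<pdim S n}) (\<lambda>_. borel)) (proc_family (pdim S n) (Zproc S n))) \<and>
     (\<forall>n\<ge>1. Pmat S n \<in> carrier_mat (pdim S n) (rdim S) \<and>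
        (\<forall>i<rdim S. vnorm (col (Pmat S n) i) = 1)) \<and>
     PH S \<in> carrier_mat (rdim S) (rdim S) \<and> invertible_mat (PH S) \<and>
     - 1 / 2 < hexp S 1 \<and> mono_on {1..rdim S} (hexp S) \<and>
     (\<forall>n. \<exists>k. ascale S n = 2 ^ k)"

text \<open>\<open>n / (a(n) 2\<^sup>j)\<close>, rounded down to an integer.\<close>

definition neff :: "'a wav_model \<Rightarrow> nat \<Rightarrow> nat \<Rightarrow> nat" where
  "neff S j n = n div (ascale S n * 2 ^ j)"

definition coefY where
  "coefY S j n = wav_coef (phi S) (psi S) (pdim S n) (Yproc S n) (ascale S n * 2 ^ j)"

definition coefX where
  "coefX S j n = wav_coef (phi S) (psi S) (rdim S) (Xproc S) (ascale S n * 2 ^ j)"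

definition coefZ where
  "coefZ S j n = wav_coef (phi S) (psi S) (pdim S n) (Zproc S n) (ascale S n * 2 ^ j)"

definition Wmat :: "'a wav_model \<Rightarrow> nat \<Rightarrow> nat \<Rightarrow> 'a \<Rightarrow> rmat" where
  "Wmat S j n = sample_cross (neff S j n) (pdim S n) (pdim S n) (coefY S j n) (coefY S j n)"

definition WX :: "'a wav_model \<Rightarrow> nat \<Rightarrow> nat \<Rightarrow> 'a \<Rightarrow> rmat" where
  "WX S j n = sample_cross (neff S j n) (rdim S) (rdim S) (coefX S j n) (coefX S j n)"

definition WZ :: "'a wav_model \<Rightarrow> nat \<Rightarrow> nat \<Rightarrow> 'a \<Rightarrow> rmat" where
  "WZ S j n = sample_cross (neff S j n) (pdim S n) (pdim S n) (coefZ S j n) (coefZ S j n)"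

definition WXZ :: "'a wav_model \<Rightarrow> nat \<Rightarrow> nat \<Rightarrow> 'a \<Rightarrow> rmat" where
  "WXZ S j n = sample_cross (neff S j n) (rdim S) (pdim S n) (coefX S j n) (coefZ S j n)"

definition EW :: "'a wav_model \<Rightarrow> nat \<Rightarrow> nat \<Rightarrow> rmat" where
  "EW S j n = mat_expectation (prb S) (pdim S n) (pdim S n) (Wmat S j n)"

definition Bhat :: "'a wav_model \<Rightarrow> nat \<Rightarrow> nat \<Rightarrow> 'a \<Rightarrow> rmat" where
  "Bhat S j n \<omega> =
     minv (PH S)
     * mat_powr (real (ascale S n)) (- Hmat S - (1 / 2) \<cdot>\<^sub>m 1\<^sub>m (rdim S))
     * WX S j n \<omega>
     * mat_powr (real (ascale S n)) (- transpose_mat (Hmat S) - (1 / 2) \<cdot>\<^sub>m 1\<^sub>m (rdim S))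
     * minv (transpose_mat (PH S))"

definition Bdet :: "'a wav_model \<Rightarrow> nat \<Rightarrow> nat \<Rightarrow> rmat" where
  "Bdet S j n = mat_expectation (prb S) (rdim S) (rdim S) (Bhat S j n)"

section \<open>Standing conditions\<close>

definition cond_A1 :: "'a wav_model \<Rightarrow> nat \<Rightarrow> nat \<Rightarrow> bool" where
  "cond_A1 S j1 j2 \<longleftrightarrow> (\<forall>j\<in>{j1..j2}. \<forall>n\<ge>1. AE \<omega> in prb S.
     (\<forall>k\<in>{1..neff S j n}.
        wav_coef_defined (phi S) (psi S) (pdim S n) (Yproc S n) (ascale S n * 2 ^ j) k \<omega> \<and>
        wav_coef_defined (phi S) (psi S) (rdim S) (Xproc S) (ascale S n * 2 ^ j) k \<omega> \<and>
        wav_coef_defined (phi S) (psi S) (pdim S n) (Zproc S n) (ascale S n * 2 ^ j) k \<omega>) \<and>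
     Wmat S j n \<omega> = Pmat S n * WX S j n \<omega> * transpose_mat (Pmat S n) + WZ S j n \<omega>
        + Pmat S n * WXZ S j n \<omega> + transpose_mat (WXZ S j n \<omega>) * transpose_mat (Pmat S n))"

definition cond_A2 :: "'a wav_model \<Rightarrow> nat \<Rightarrow> nat \<Rightarrow> bool" where
  "cond_A2 S j1 j2 \<longleftrightarrow> (\<forall>j\<in>{j1..j2}. bounded_in_prob (prb S) (\<lambda>n \<omega>.
     Max {op_norm (mat_expectation (prb S) (pdim S n) (pdim S n) (WZ S j n)),
          op_norm (WZ S j n \<omega>),
          op_norm (mat_powr (real (ascale S n)) (- Hmat S - (1 / 2) \<cdot>\<^sub>m 1\<^sub>m (rdim S))
                     * WXZ S j n \<omega>)}))"

definition B_fluct :: "'a wav_model \<Rightarrow> nat \<Rightarrow> nat \<Rightarrow> nat \<Rightarrow> 'a \<Rightarrow> rvec" where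
  "B_fluct S j1 j2 n \<omega> = vec_of_list (concat (map
     (\<lambda>j. map2 (\<lambda>x y. sqrt (real (neff S j n)) * (x - y))
            (vec_sym_list (Bhat S j n \<omega>)) (vec_sym_list (Bdet S j n)))
     [j1..<j2 + 1]))"

text \<open>\<open>\<beta>\<close> and the limits \<open>B j\<close> are parameters because \<open>\<beta>\<close> also enters the exponent \<open>varpi\<close>.\<close>

definition cond_A3 :: "'a wav_model \<Rightarrow> nat \<Rightarrow> nat \<Rightarrow> real \<Rightarrow> (nat \<Rightarrow> rmat) \<Rightarrow> bool" where
  "cond_A3 S j1 j2 \<beta> B \<longleftrightarrow>
     (let d = (j2 - j1 + 1) * (rdim S * (rdim S + 1) div 2) in
        \<exists>\<Sigma>\<^sub>B. pos_semidef d \<Sigma>\<^sub>B \<and> conv_dist_normal d (prb S) (B_fluct S j1 j2) \<Sigma>\<^sub>B) \<and>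
     \<beta> > 0 \<and>
     (\<forall>j\<in>{j1..j2}. pos_def (rdim S) (B j) \<and>
        (\<lambda>n. op_norm (Bdet S j n - B j)) \<in> O[sequentially](\<lambda>n. real (ascale S n) powr (- \<beta>)))"

definition varpi :: "'a wav_model \<Rightarrow> real \<Rightarrow> real" where
  "varpi S \<beta> = Min ({hexp S i - hexp S (i - 1) | i. i \<in> {2..rdim S} \<and> hexp S i - hexp S (i - 1) > 0}
                    \<union> {\<beta>, hexp S 1 / 2 + 1 / 4})"

definition cond_A4 :: "'a wav_model \<Rightarrow> nat \<Rightarrow> real \<Rightarrow> bool" where
  "cond_A4 S j2 \<beta> \<longleftrightarrow>
     (\<forall>\<^sub>F n in sequentially. real (ascale S n) \<le> real n / 2 ^ j2) \<and>
     (\<lambda>n. real (ascale S n) / real n + real n / real (ascale S n) powr (2 * varpi S \<beta> + 1))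
       \<longlonglongrightarrow> 0 \<and>
     (\<exists>c\<ge>0. (\<lambda>n. real (pdim S n) / (real n / real (ascale S n))) \<longlonglongrightarrow> c)"

definition cond_A5 :: "'a wav_model \<Rightarrow> real \<Rightarrow> bool" where
  "cond_A5 S \<beta> \<longleftrightarrow> (\<exists>Q R A L.
     (\<forall>n\<ge>1. Q n \<in> carrier_mat (pdim S n) (rdim S) \<and>
        transpose_mat (Q n) * Q n = 1\<^sub>m (rdim S) \<and>
        R n \<in> carrier_mat (rdim S) (rdim S) \<and> invertible_mat (R n) \<and> upper_triangular (R n) \<and>
        Pmat S n * PH S = Q n * R n) \<and>
     pos_def (rdim S) A \<and>
     L \<in> carrier_mat (rdim S) (rdim S) \<and> upper_triangular L \<and> (\<forall>i<rdim S. L $$ (i, i) > 0) \<and>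
     A = transpose_mat L * L \<and>
     (\<lambda>n. op_norm (R n - L)) \<in> O[sequentially](\<lambda>n. real (ascale S n) powr (- varpi S \<beta>)))"

section \<open>Limits of eigenvalues and the estimator\<close>

text \<open>The eigenvalue \<open>\<lambda>\<^bsub>p-r+q\<^esub>\<close>, \<open>q = 1, \<dots>, r\<close>, of a \<open>p(n) \<times> p(n)\<close> matrix.\<close>

definition top_eig :: "'a wav_model \<Rightarrow> nat \<Rightarrow> nat \<Rightarrow> rmat \<Rightarrow> real" where
  "top_eig S n q A = ord_eigenvalue (pdim S n - rdim S + q) A"

text \<open>
  \<open>\<xi> q s\<close> is the limit function at scale \<open>s\<close>; its value at scale 1 is fixed by the scaling
  relation.
\<close>

definition is_eig_limit :: "'a wav_model \<Rightarrow> nat \<Rightarrow> nat \<Rightarrow> (nat \<Rightarrow> nat \<Rightarrow> real) \<Rightarrow> bool" where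
  "is_eig_limit S j1 j2 \<xi> \<longleftrightarrow> (\<forall>q\<in>{1..rdim S}. \<forall>j\<in>{j1..j2}.
     tendsto_in_prob (prb S)
       (\<lambda>n \<omega>. top_eig S n q (Wmat S j n \<omega>) / real (ascale S n) powr (2 * hexp S q + 1)) (\<xi> q (2 ^ j)) \<and>
     \<xi> q (2 ^ j) > 0 \<and>
     \<xi> q (2 ^ j) = 2 powr (real j * (2 * hexp S q + 1)) * \<xi> q 1)"

definition log_eig_fluct :: "'a wav_model \<Rightarrow> nat \<Rightarrow> nat \<Rightarrow> nat \<Rightarrow> 'a \<Rightarrow> rvec" where
  "log_eig_fluct S j1 j2 n \<omega> = vec_of_list (concat (map
     (\<lambda>j. map (\<lambda>q. sqrt (real (neff S j n)) *
              (ln (top_eig S n q (Wmat S j n \<omega>)) - ln (top_eig S n q (EW S j n))))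
            [1..<rdim S + 1])
     [j1..<j2 + 1]))"

definition is_log_eig_cov :: "'a wav_model \<Rightarrow> nat \<Rightarrow> nat \<Rightarrow> rmat \<Rightarrow> bool" where
  "is_log_eig_cov S j1 j2 \<Sigma> \<longleftrightarrow>
     pos_semidef ((j2 - j1 + 1) * rdim S) \<Sigma> \<and>
     conv_dist_normal ((j2 - j1 + 1) * rdim S) (prb S) (log_eig_fluct S j1 j2) \<Sigma>"

definition hhat :: "'a wav_model \<Rightarrow> nat \<Rightarrow> nat \<Rightarrow> (nat \<Rightarrow> real) \<Rightarrow> nat \<Rightarrow> nat \<Rightarrow> 'a \<Rightarrow> real" where
  "hhat S j1 j2 w n q \<omega> = 1 / 2 * ((\<Sum>j=j1..j2. w j * log 2 (top_eig S n q (Wmat S j n \<omega>))) - 1)"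

text \<open>Column \<open>c\<close> belongs to the block of octave \<open>j1 + c div r\<close>.\<close>

definition weight_mat :: "nat \<Rightarrow> nat \<Rightarrow> nat \<Rightarrow> (nat \<Rightarrow> real) \<Rightarrow> rmat" where
  "weight_mat r j1 j2 w = (1 / (2 * ln 2)) \<cdot>\<^sub>m Matrix.mat r ((j2 - j1 + 1) * r)
     (\<lambda>(i, c). let j = j1 + c div r in 2 powr (real j / 2) * w j * 1\<^sub>m r $$ (i, c mod r))"

end

theory Submission
  imports Defs
begin

text \<open>
  Put \<open>\<lambda>\<^sub>q(A)\<close> for the eigenvalue \<open>\<lambda>\<^bsub>p-r+q\<^esub>(A)\<close> and \<open>a = a(n)\<close>. Because \<open>\<Sum> w\<^sub>j = 0\<close> and
  \<open>\<Sum> j w\<^sub>j = 1\<close>, the estimator splits into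
  \<open>\<surd>(n/a) (hhat\<^sub>q - h\<^sub>q) = \<Sum>\<^sub>j \<surd>(n/a) / \<surd>(n\<^sub>a\<^sub>,\<^sub>j) \<cdot> w\<^sub>j / (2 log 2) \<cdot> V\<^sub>j\<^sub>,\<^sub>q + bias\<close>, where
  \<open>V\<^sub>j\<^sub>,\<^sub>q = \<surd>(n\<^sub>a\<^sub>,\<^sub>j) (log \<lambda>\<^sub>q(W) - log \<lambda>\<^sub>q(E W))\<close> is the fluctuation whose Gaussian limit is given. The
  deterministic coefficients converge to the entries of the weight matrix, so a Slutsky argument
  (\<open>conv_dist_normal_affine\<close>) yields the theorem as soon as the bias vanishes. The bias is
  \<open>\<surd>(n/a)\<close> times a linear combination of the errors \<open>log (\<lambda>\<^sub>q(E W) / a\<^bsup>2 h\<^sub>q + 1\<^esup>) - log \<xi>\<^sub>q(2\<^sup>j)\<close>,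
  and \<open>\<surd>(n/a) a\<^bsup>-\<varpi>\<^esup> \<rightarrow> 0\<close>; the substance is therefore the rate
  \<open>\<lambda>\<^sub>q(E W) / a\<^bsup>2 h\<^sub>q + 1\<^esup> = \<xi>\<^sub>q(2\<^sup>j) + O(a\<^bsup>-\<varpi>\<^esup>)\<close> (\<open>EW_eigenvalue_rate\<close> and
  \<open>eigenvalue_limits_agree\<close>).

  The rate is obtained by comparing quadratic forms.

  \<^item> Since \<open>(\<alpha> + \<beta>)\<^sup>2\<close> lies between \<open>(1 - \<epsilon>) \<alpha>\<^sup>2 - \<beta>\<^sup>2 / \<epsilon>\<close> and \<open>(1 + \<epsilon>) \<alpha>\<^sup>2 + (1 + 1/\<epsilon>) \<beta>\<^sup>2\<close>, the
    form of \<open>E W\<close> is squeezed between multiples of the form of \<open>P E W\<^sub>X P\<^sup>*\<close>, up to a multiple of the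
    bounded form of \<open>E W\<^sub>Z\<close> (\<open>EW_form_bounds\<close>). The choice \<open>\<epsilon> = a\<^bsup>-\<varpi>\<^esup>\<close> makes both errors
    admissible because \<open>2 \<varpi> \<le> h\<^sub>1 + 1/2\<close>. This takes care of the cross terms as well.

  \<^item> With \<open>P P\<^sub>H = Q R(n)\<close> and \<open>D = diag(a\<^bsup>h\<^sub>i + 1/2\<^esup>)\<close> the signal part is the form of
    \<open>R(n) D B\<^sub>a D R(n)\<^sup>*\<close> at \<open>Q\<^sup>* v\<close>. For separated exponents, write \<open>B = M\<^sup>* M\<close> and \<open>A = K\<^sup>* K\<close> with
    lower triangular factors. Moving \<open>D\<close> across a lower triangular matrix multiplies the entry
    below the diagonal by a ratio \<open>d\<^sub>i / d\<^sub>k\<close> with \<open>i < k\<close>, which is \<open>O(a\<^bsup>-\<varpi>\<^esup>)\<close>. Hence after an almost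
    isometric change of variables the form is diagonal up to a relative error \<open>O(a\<^bsup>-\<varpi>\<^esup>)\<close>, with
    weights \<open>(M\<^sub>i\<^sub>i K\<^sub>i\<^sub>i d\<^sub>i)\<^sup>2\<close> (\<open>graded_form_separated_scales\<close>). For equal exponents an
    eigenbasis of the limit matrix does the same (\<open>graded_form_equal_scales\<close>).

  \<^item> A min-max argument turns the comparison of forms into a comparison of the top \<open>r\<close> eigenvalues
    (\<open>top_eigenvalue_asymptotics\<close>).

  The limit found in this way equals \<open>\<xi>\<^sub>q(2\<^sup>j)\<close>: the fluctuations are tight and \<open>n\<^sub>a\<^sub>,\<^sub>j \<rightarrow> \<infinity>\<close>, so
  \<open>log \<lambda>\<^sub>q(W) - log \<lambda>\<^sub>q(E W) \<rightarrow> 0\<close> in probability.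
\<close>

section \<open>Eigenvalues of real symmetric matrices\<close>

text \<open>
  Padding the system with zero rows makes it square and singular.
\<close>

lemma underdetermined_system:
  fixes f :: "nat \<Rightarrow> rvec"
  assumes f: "\<And>i. i < m \<Longrightarrow> f i \<in> carrier_vec d" and md: "m < d"
  shows "\<exists>v\<in>carrier_vec d. v \<noteq> 0\<^sub>v d \<and> (\<forall>i<m. f i \<bullet> v = 0)"
proof -
  define A where "A = Matrix.mat d d (\<lambda>(i, k). if i < m then f i $ k else 0)"
  have A: "A \<in> carrier_mat d d" by (simp add: A_def)
  have "transpose_mat A *\<^sub>v unit_vec d m = 0\<^sub>v d"
    using md by (intro eq_vecI) (auto simp: A_def scalar_prod_def unit_vec_def intro!: sum.neutral)
  moreover have "unit_vec d m \<noteq> (0\<^sub>v d :: rvec)"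
    using md by (metis index_unit_vec(2) index_zero_vec(1) zero_neq_one)
  ultimately have "det (transpose_mat A) = 0"
    using A det_0_iff_vec_prod_zero_field[of "transpose_mat A" d] by (metis transpose_carrier_mat unit_vec_carrier)
  then have "det A = 0" using det_transpose[OF A] by simp
  then obtain v where v: "v \<in> carrier_vec d" "v \<noteq> 0\<^sub>v d" "A *\<^sub>v v = 0\<^sub>v d"
    using det_0_iff_vec_prod_zero_field[OF A] by auto
  have "f i \<bullet> v = 0" if i: "i < m" for i
  proof -
    have "(A *\<^sub>v v) $ i = row A i \<bullet> v" using i md A by simp
    moreover have "row A i = f i" using i md f[OF i] by (intro eq_vecI) (auto simp: A_def)
    ultimately show ?thesis using v(3) i md by simp
  qed
  with v show ?thesis by blast
qed

lemma scalar_prod_self_nonneg: "0 \<le> (v::rvec) \<bullet> v"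
  by (simp add: scalar_prod_def sum_nonneg)

lemma scalar_prod_self_pos:
  fixes v :: rvec assumes "v \<in> carrier_vec d" "v \<noteq> 0\<^sub>v d"
  shows "0 < v \<bullet> v"
proof (rule ccontr)
  assume "\<not> ?thesis"
  then have "v \<bullet> v = 0" using scalar_prod_self_nonneg[of v] by linarith
  then have "\<forall>i\<in>{0..<dim_vec v}. v $ i * v $ i = 0"
    unfolding scalar_prod_def by (subst (asm) sum_nonneg_eq_0_iff) auto
  then have "v = 0\<^sub>v d" using assms(1) by (intro eq_vecI) auto
  with assms(2) show False by simp
qed

lemma form_symmetric:
  fixes S :: rmat
  assumes S: "S \<in> carrier_mat d d" "transpose_mat S = S"
    and v: "v \<in> carrier_vec d" "w \<in> carrier_vec d"
  shows "v \<bullet> (S *\<^sub>v w) = w \<bullet> (S *\<^sub>v v)"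
proof -
  have "v \<bullet> (S *\<^sub>v w) = (transpose_mat S *\<^sub>v v) \<bullet> w"
    using transpose_vec_mult_scalar[OF S(1) v(2) v(1)] by simp
  then show ?thesis using S v by (metis comm_scalar_prod mult_mat_vec_carrier)
qed

lemma form_add_smult:
  fixes S :: rmat
  assumes S: "S \<in> carrier_mat d d" "transpose_mat S = S"
    and v: "v \<in> carrier_vec d" "w \<in> carrier_vec d"
  shows "(v + t \<cdot>\<^sub>v w) \<bullet> (S *\<^sub>v (v + t \<cdot>\<^sub>v w)) =
    v \<bullet> (S *\<^sub>v v) + 2 * t * (w \<bullet> (S *\<^sub>v v)) + t\<^sup>2 * (w \<bullet> (S *\<^sub>v w))"
proof -
  have c: "S *\<^sub>v v \<in> carrier_vec d" "S *\<^sub>v w \<in> carrier_vec d" using S v by auto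
  have "S *\<^sub>v (v + t \<cdot>\<^sub>v w) = S *\<^sub>v v + t \<cdot>\<^sub>v (S *\<^sub>v w)"
    using S v by (simp add: mult_add_distrib_mat_vec mult_mat_vec)
  then have "(v + t \<cdot>\<^sub>v w) \<bullet> (S *\<^sub>v (v + t \<cdot>\<^sub>v w)) =
     v \<bullet> (S *\<^sub>v v) + t * (v \<bullet> (S *\<^sub>v w)) + t * (w \<bullet> (S *\<^sub>v v)) + t * t * (w \<bullet> (S *\<^sub>v w))"
    using S v c by (simp add: scalar_prod_add_distrib[where n=d] add_scalar_prod_distrib[where n=d]
        algebra_simps)
  then show ?thesis using form_symmetric[OF S v] by (simp add: power2_eq_square)
qed

text \<open>
  The unit sphere of the orthogonal complement of \<open>e\<^sub>0, \<dots>, e\<^sub>k\<^sub>-\<^sub>1\<close> is compact. Compactness is available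
  for functions \<open>nat \<Rightarrow> real\<close> by Tychonoff, so vectors are extended by zero.
\<close>

lemma form_attains_max_on_sphere:
  fixes S :: rmat and e :: "nat \<Rightarrow> rvec"
  assumes S: "S \<in> carrier_mat d d"
    and e: "\<And>i. i < k \<Longrightarrow> e i \<in> carrier_vec d" and kd: "k < d"
  obtains v where "v \<in> carrier_vec d" "v \<bullet> v = 1" "\<And>i. i < k \<Longrightarrow> e i \<bullet> v = 0"
    "\<And>u. u \<in> carrier_vec d \<Longrightarrow> \<forall>i<k. e i \<bullet> u = 0 \<Longrightarrow> u \<bullet> (S *\<^sub>v u) \<le> (v \<bullet> (S *\<^sub>v v)) * (u \<bullet> u)"
proof -
  define C :: "(nat \<Rightarrow> real) set" where "C = {x. (\<Sum>i<d. x i * x i) = 1} \<inter> (\<Inter>i<k. {x. (\<Sum>l<d. e i $ l * x l) = 0})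
     \<inter> PiE UNIV (\<lambda>i. if i < d then {-1..1} else {0})"
  define F :: "(nat \<Rightarrow> real) \<Rightarrow> real" where "F x = (\<Sum>i<d. x i * (\<Sum>l<d. S $$ (i,l) * x l))" for x
  have [continuous_intros]: "continuous_on A (\<lambda>x::nat\<Rightarrow>real. x i)" for i A
    by (rule continuous_on_subset[OF continuous_on_product_coordinates]) auto
  have "compact (PiE UNIV (\<lambda>i::nat. if i < d then {-1..1} else {0::real}))"
    using compactin_PiE[of "\<lambda>_. euclidean" UNIV "\<lambda>i::nat. if i < d then {-1..1} else {0::real}"]
    by (auto simp: euclidean_product_topology)
  moreover have "closed ({x. (\<Sum>i<d. x i * x i) = 1} \<inter> (\<Inter>i<k. {x. (\<Sum>l<d. e i $ l * (x l ::real)) = 0}))"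
    by (intro closed_Int closed_Collect_eq closed_INT ballI) (auto intro!: continuous_intros)
  ultimately have C: "compact C" unfolding C_def by (rule closed_Int_compact[rotated])
  have ex: "(\<lambda>i. if i < d then u $ i else 0) \<in> C"
    if u: "u \<in> carrier_vec d" "u \<bullet> u = 1" "\<forall>i<k. e i \<bullet> u = 0" for u
  proof -
    have s: "(\<Sum>i<d. u $ i * u $ i) = 1" using u by (simp add: scalar_prod_def atLeast0LessThan)
    have "\<bar>u $ i\<bar> \<le> 1" if "i < d" for i
    proof -
      have "u $ i * u $ i \<le> 1" unfolding s[symmetric] using that by (intro member_le_sum) auto
      then show ?thesis by (metis abs_square_le_1 power2_eq_square)
    qed
    then show ?thesis using u s e unfolding C_def
      by (auto simp: scalar_prod_def atLeast0LessThan PiE_def Pi_def abs_le_iff)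
  qed
  obtain u0 where u0: "u0 \<in> carrier_vec d" "u0 \<noteq> 0\<^sub>v d" "\<forall>i<k. e i \<bullet> u0 = 0"
    using underdetermined_system[of k e d] e kd by blast
  have norm1: "\<exists>s>0. (s \<cdot>\<^sub>v u) \<bullet> (s \<cdot>\<^sub>v u) = 1 \<and> s * s * (u \<bullet> u) = 1"
    if "u \<in> carrier_vec d" "u \<noteq> 0\<^sub>v d" for u :: rvec
    using scalar_prod_self_pos[OF that] that
    by (intro exI[of _ "1 / sqrt (u \<bullet> u)"]) (auto simp: field_simps)
  have orth: "\<forall>i<k. e i \<bullet> (s \<cdot>\<^sub>v u) = 0" if "u \<in> carrier_vec d" "\<forall>i<k. e i \<bullet> u = 0" for u s
    using that e by auto
  have Cne: "C \<noteq> {}" using norm1[OF u0(1,2)] ex orth[OF u0(1,3)] u0(1) by (metis empty_iff smult_carrier_vec)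
  have cF: "continuous_on C F" unfolding F_def by (intro continuous_intros)
  obtain x where x: "x \<in> C" "\<And>y. y \<in> C \<Longrightarrow> F y \<le> F x"
    using continuous_attains_sup[OF C Cne cF] by blast
  define v where "v = Matrix.vec d x"
  have v: "v \<in> carrier_vec d" by (simp add: v_def)
  have F: "F (\<lambda>i. if i < d then u $ i else 0) = u \<bullet> (S *\<^sub>v u)" if "u \<in> carrier_vec d" for u
    using that S unfolding F_def by (auto simp: scalar_prod_def atLeast0LessThan intro!: sum.cong)
  have xv: "(\<lambda>i. if i < d then v $ i else 0) = x"
    using x(1) unfolding C_def v_def by (force simp: PiE_def Pi_def fun_eq_iff split: if_splits)
  have v1: "v \<bullet> v = 1" "\<forall>i<k. e i \<bullet> v = 0"
    using x(1) e unfolding C_def v_def by (auto simp: scalar_prod_def atLeast0LessThan)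
  have "u \<bullet> (S *\<^sub>v u) \<le> (v \<bullet> (S *\<^sub>v v)) * (u \<bullet> u)"
    if u: "u \<in> carrier_vec d" "\<forall>i<k. e i \<bullet> u = 0" for u
  proof (cases "u = 0\<^sub>v d")
    case True then show ?thesis using S by (simp add: scalar_prod_def)
  next
    case False
    then obtain s where s: "s > 0" "(s \<cdot>\<^sub>v u) \<bullet> (s \<cdot>\<^sub>v u) = 1" "s * s * (u \<bullet> u) = 1" using norm1 u by blast
    have "(s \<cdot>\<^sub>v u) \<bullet> (S *\<^sub>v (s \<cdot>\<^sub>v u)) \<le> v \<bullet> (S *\<^sub>v v)"
      using x(2)[OF ex[OF _ s(2) orth[OF u]]] u(1) F[of "s \<cdot>\<^sub>v u"] F[OF v] xv by simp
    then have "s * s * (u \<bullet> (S *\<^sub>v u)) \<le> (v \<bullet> (S *\<^sub>v v)) * (s * s * (u \<bullet> u))"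
      using u(1) S s(3) by (simp add: mult_mat_vec mult.assoc)
    then have "(s * s) * (u \<bullet> (S *\<^sub>v u)) \<le> (s * s) * ((v \<bullet> (S *\<^sub>v v)) * (u \<bullet> u))" by (simp add: mult_ac)
    then show ?thesis using s(1) by (metis mult_le_cancel_left_pos mult_pos_pos)
  qed
  with v v1 show ?thesis by (intro that[of v]) simp_all
qed

text \<open>
  The last clause makes the family extendable in decreasing order: whatever is orthogonal to it
  has Rayleigh quotient below all eigenvalues chosen so far.
\<close>

definition top_eigenvectors :: "rmat \<Rightarrow> nat \<Rightarrow> nat \<Rightarrow> (nat \<Rightarrow> rvec) \<Rightarrow> (nat \<Rightarrow> real) \<Rightarrow> bool" where
  "top_eigenvectors S d k e lam \<longleftrightarrow>
    (\<forall>i<k. e i \<in> carrier_vec d \<and> S *\<^sub>v e i = lam i \<cdot>\<^sub>v e i) \<and>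
    (\<forall>i<k. \<forall>l<k. e i \<bullet> e l = (if i = l then 1 else 0)) \<and>
    (\<forall>i<k. \<forall>l<i. lam i \<le> lam l) \<and>
    (\<forall>u\<in>carrier_vec d. (\<forall>i<k. e i \<bullet> u = 0) \<longrightarrow> (\<forall>i<k. u \<bullet> (S *\<^sub>v u) \<le> lam i * (u \<bullet> u)))"

text \<open>
  A maximiser \<open>v\<close> of the Rayleigh quotient on the complement of the previous eigenvectors is itself
  an eigenvector: by the first-order condition \<open>S v\<close> is orthogonal to every \<open>w\<close> of the complement
  with \<open>w \<bottom> v\<close>, in particular to \<open>w = S v - \<mu> v\<close>.
\<close>

lemma greedy_eigenvectors:
  fixes S :: rmat
  assumes S: "S \<in> carrier_mat d d" "transpose_mat S = S" and "k \<le> d"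
  shows "\<exists>e lam. top_eigenvectors S d k e lam"
  using \<open>k \<le> d\<close>
proof (induction k)
  case 0 show ?case by (simp add: top_eigenvectors_def)
next
  case (Suc k)
  then obtain e lam where E: "top_eigenvectors S d k e lam" using Suc_leD by blast
  have e: "\<And>i. i < k \<Longrightarrow> e i \<in> carrier_vec d" "\<And>i. i < k \<Longrightarrow> S *\<^sub>v e i = lam i \<cdot>\<^sub>v e i"
    and o: "\<And>i l. i < k \<Longrightarrow> l < k \<Longrightarrow> e i \<bullet> e l = (if i = l then 1 else 0)"
    and mono: "\<And>i l. i < k \<Longrightarrow> l < i \<Longrightarrow> lam i \<le> lam l"
    and bound: "\<And>u i. u \<in> carrier_vec d \<Longrightarrow> \<forall>i<k. e i \<bullet> u = 0 \<Longrightarrow> i < k \<Longrightarrow> u \<bullet> (S *\<^sub>v u) \<le> lam i * (u \<bullet> u)"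
    using E unfolding top_eigenvectors_def by blast+
  obtain v where v: "v \<in> carrier_vec d" "v \<bullet> v = 1" "\<And>i. i < k \<Longrightarrow> e i \<bullet> v = 0"
    and max: "\<And>u. u \<in> carrier_vec d \<Longrightarrow> \<forall>i<k. e i \<bullet> u = 0 \<Longrightarrow> u \<bullet> (S *\<^sub>v u) \<le> (v \<bullet> (S *\<^sub>v v)) * (u \<bullet> u)"
  proof (rule form_attains_max_on_sphere[OF S(1)])
    show "e i \<in> carrier_vec d" if "i < k" for i using e(1) that .
    show "k < d" using Suc.prems by simp
  qed (rule that)
  define \<mu> where "\<mu> = v \<bullet> (S *\<^sub>v v)"
  have crit: "w \<bullet> (S *\<^sub>v v) = 0" if w: "w \<in> carrier_vec d" "\<And>i. i < k \<Longrightarrow> e i \<bullet> w = 0" "w \<bullet> v = 0" for w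
  proof -
    define b where "b = w \<bullet> (S *\<^sub>v v)"
    define c where "c = \<mu> * (w \<bullet> w) - w \<bullet> (S *\<^sub>v w)"
    have ineq: "2 * t * b \<le> t\<^sup>2 * c" for t
    proof -
      have "v \<bullet> w = 0" using w(1,3) v(1) by (metis comm_scalar_prod)
      then have "(v + t \<cdot>\<^sub>v w) \<bullet> (v + t \<cdot>\<^sub>v w) = 1 + t\<^sup>2 * (w \<bullet> w)"
        using v(1,2) w(1,3) by (simp add: scalar_prod_add_distrib[where n=d] add_scalar_prod_distrib[where n=d]
            power2_eq_square)
      moreover have "\<forall>i<k. e i \<bullet> (v + t \<cdot>\<^sub>v w) = 0"
        using v w e by (auto simp: scalar_prod_add_distrib[where n=d])
      ultimately have "(v + t \<cdot>\<^sub>v w) \<bullet> (S *\<^sub>v (v + t \<cdot>\<^sub>v w)) \<le> \<mu> * (1 + t\<^sup>2 * (w \<bullet> w))"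
        using max[of "v + t \<cdot>\<^sub>v w"] v(1) w(1) by (simp add: \<mu>_def)
      then show ?thesis unfolding form_add_smult[OF S v(1) w(1)] b_def c_def \<mu>_def
        by (simp add: algebra_simps)
    qed
    show ?thesis
    proof (rule ccontr)
      assume "w \<bullet> (S *\<^sub>v v) \<noteq> 0"
      then have b: "b \<noteq> 0" by (simp add: b_def)
      have bb: "b\<^sup>2 > 0" using b by simp
      (* for small t of the sign of b the linear term beats the quadratic one *)
      define s where "s = \<bar>c\<bar> + 1"
      have s: "s > 0" "c \<le> s" by (auto simp: s_def)
      have "2 * (b / s) * b \<le> (b / s)\<^sup>2 * c" by (rule ineq)
      also have "\<dots> \<le> (b / s)\<^sup>2 * s" using s by (intro mult_left_mono) auto
      also have "\<dots> = b\<^sup>2 / s" using s by (simp add: power2_eq_square field_simps)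
      finally have "b\<^sup>2 / s \<le> 0" by (simp add: power2_eq_square)
      then show False using bb s by (smt (verit) divide_pos_pos)
    qed
  qed
  define w where "w = S *\<^sub>v v - \<mu> \<cdot>\<^sub>v v"
  have Sv: "S *\<^sub>v v \<in> carrier_vec d" and w: "w \<in> carrier_vec d" using S v by (auto simp: w_def)
  have "e i \<bullet> w = 0" if "i < k" for i
  proof -
    have "e i \<bullet> (S *\<^sub>v v) = v \<bullet> (lam i \<cdot>\<^sub>v e i)"
      using form_symmetric[OF S e(1)[OF that] v(1)] e(2)[OF that] by simp
    also have "\<dots> = 0" using v that e(1)[OF that] comm_scalar_prod[of v d "e i"] by simp
    finally show ?thesis unfolding w_def using v that Sv e(1)[OF that]
      by (simp add: scalar_prod_minus_distrib[where n=d])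
  qed
  moreover have wv: "w \<bullet> v = 0"
    unfolding w_def using Sv v comm_scalar_prod[OF Sv v(1)]
    by (simp add: minus_scalar_prod_distrib[where n=d] \<mu>_def)
  ultimately have "w \<bullet> (S *\<^sub>v v) = 0" using crit[OF w] by blast
  then have "w \<bullet> w = 0" using w Sv v wv unfolding w_def
    by (subst scalar_prod_minus_distrib[where n=d]) auto
  then have "w = 0\<^sub>v d" using scalar_prod_self_pos[OF w] by fastforce
  then have ev: "S *\<^sub>v v = \<mu> \<cdot>\<^sub>v v" using w_def Sv v
    by (intro eq_vecI) (use S in \<open>auto simp: vec_eq_iff\<close>)
  define e' where "e' = e(k := v)"
  define l' where "l' = lam(k := \<mu>)"
  have ve: "v \<bullet> e i = 0" if "i < k" for i using v e that by (metis comm_scalar_prod)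
  have mu: "\<mu> \<le> lam i" if "i < k" for i
    using bound[OF v(1) _ that] v by (simp add: \<mu>_def)
  have "u \<bullet> (S *\<^sub>v u) \<le> l' i * (u \<bullet> u)"
    if u: "u \<in> carrier_vec d" "\<forall>i<Suc k. e' i \<bullet> u = 0" and i: "i < Suc k" for u i
  proof (cases "i = k")
    case True
    have "e i \<bullet> u = 0" if "i < k" for i using u(2)[rule_format, of i] that by (simp add: e'_def)
    then show ?thesis using max[OF u(1)] True by (simp add: l'_def \<mu>_def)
  next
    case False
    have "e i \<bullet> u = 0" if "i < k" for i using u(2)[rule_format, of i] that by (simp add: e'_def)
    then show ?thesis using bound[OF u(1)] False i by (simp add: l'_def)
  qed
  moreover have "\<forall>i<Suc k. e' i \<in> carrier_vec d \<and> S *\<^sub>v e' i = l' i \<cdot>\<^sub>v e' i"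
    using e v ev by (auto simp: e'_def l'_def less_Suc_eq)
  moreover have "\<forall>i<Suc k. \<forall>l<Suc k. e' i \<bullet> e' l = (if i = l then 1 else 0)"
    using o v ve by (auto simp: e'_def less_Suc_eq)
  moreover have "\<forall>i<Suc k. \<forall>l<i. l' i \<le> l' l"
    using mono mu by (auto simp: l'_def less_Suc_eq)
  ultimately have "top_eigenvectors S d (Suc k) e' l'" unfolding top_eigenvectors_def by (intro conjI ballI impI allI) simp_all
  then show ?case by blast
qed

lemma orthonormal_expansion:
  fixes e :: "nat \<Rightarrow> rvec"
  assumes e: "\<And>i. i < d \<Longrightarrow> e i \<in> carrier_vec d"
    and o: "\<And>i l. i < d \<Longrightarrow> l < d \<Longrightarrow> e i \<bullet> e l = (if i = l then 1 else 0)"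
    and U: "U = Matrix.mat d d (\<lambda>(i, k). e k $ i)"
  shows "U \<in> carrier_mat d d" "transpose_mat U * U = 1\<^sub>m d" "U * transpose_mat U = 1\<^sub>m d"
    "v \<in> carrier_vec d \<Longrightarrow> w \<in> carrier_vec d \<Longrightarrow> v \<bullet> w = (\<Sum>i<d. (e i \<bullet> v) * (e i \<bullet> w))"
proof -
  show U1: "U \<in> carrier_mat d d" by (simp add: U)
  have c: "col U k = e k" if "k < d" for k using that e[OF that] by (auto simp: U intro!: eq_vecI)
  show UU: "transpose_mat U * U = 1\<^sub>m d"
    using U1 c o by (intro eq_matI) auto
  show UU': "U * transpose_mat U = 1\<^sub>m d"
    using mat_mult_left_right_inverse[OF _ U1 UU] U1 by simp
  assume v: "v \<in> carrier_vec d" and w: "w \<in> carrier_vec d"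
  have tv: "transpose_mat U *\<^sub>v v = Matrix.vec d (\<lambda>i. e i \<bullet> v)" for v
    using U1 c by (intro eq_vecI) auto
  have "v \<bullet> w = v \<bullet> (U *\<^sub>v (transpose_mat U *\<^sub>v w))"
    using U1 v w UU' by (simp flip: assoc_mult_mat_vec[of U d d "transpose_mat U" d w])
  also have "\<dots> = (transpose_mat U *\<^sub>v v) \<bullet> (transpose_mat U *\<^sub>v w)"
    using transpose_vec_mult_scalar[OF U1 _ v] U1 w by simp
  also have "\<dots> = (\<Sum>i<d. (e i \<bullet> v) * (e i \<bullet> w))"
    unfolding tv by (simp add: scalar_prod_def atLeast0LessThan)
  finally show "v \<bullet> w = (\<Sum>i<d. (e i \<bullet> v) * (e i \<bullet> w))" .
qed

lemma proots_linear_factors: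
  "proots (\<Prod>a\<leftarrow>xs. [:- a, 1 :: real:]) = mset xs"
proof (induction xs)
  case (Cons a xs)
  have "(\<Prod>a\<leftarrow>xs. [:- a, 1 :: real:]) \<noteq> 0" by (auto simp: prod_list_zero_iff)
  then show ?case using Cons by (simp add: proots_mult del: mult_pCons_left)
qed simp

text \<open>
  The eigenvectors found greedily diagonalise \<open>S\<close>, so their eigenvalues are the roots of the
  characteristic polynomial with multiplicity; reversing the decreasing order gives the sorted
  list behind \<open>ord_eigenvalue\<close>.
\<close>

lemma symmetric_spectral:
  fixes S :: rmat
  assumes S: "S \<in> carrier_mat d d" "transpose_mat S = S"
  obtains e :: "nat \<Rightarrow> rvec" where "\<And>i. i < d \<Longrightarrow> e i \<in> carrier_vec d"
    and "\<And>v. v \<in> carrier_vec d \<Longrightarrow> v \<bullet> v = (\<Sum>i<d. (e i \<bullet> v)\<^sup>2)"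
    and "\<And>v. v \<in> carrier_vec d \<Longrightarrow> v \<bullet> (S *\<^sub>v v) = (\<Sum>i<d. ord_eigenvalue (Suc i) S * (e i \<bullet> v)\<^sup>2)"
    and "\<And>i l. i < d \<Longrightarrow> l \<le> i \<Longrightarrow> ord_eigenvalue (Suc l) S \<le> ord_eigenvalue (Suc i) S"
    and "\<And>i l. i < d \<Longrightarrow> l < d \<Longrightarrow> e i \<bullet> e l = (if i = l then 1 else 0)"
    and "\<And>i. i < d \<Longrightarrow> e i \<bullet> (S *\<^sub>v e i) = ord_eigenvalue (Suc i) S"
proof -
  obtain f lam where E: "top_eigenvectors S d d f lam" using greedy_eigenvectors[OF S order_refl] by blast
  have f: "\<And>i. i < d \<Longrightarrow> f i \<in> carrier_vec d" "\<And>i. i < d \<Longrightarrow> S *\<^sub>v f i = lam i \<cdot>\<^sub>v f i"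
    and fo: "\<And>i l. i < d \<Longrightarrow> l < d \<Longrightarrow> f i \<bullet> f l = (if i = l then 1 else 0)"
    and fmono: "\<And>i l. i < d \<Longrightarrow> l < i \<Longrightarrow> lam i \<le> lam l"
    using E unfolding top_eigenvectors_def by blast+
  define e where "e i = f (d - Suc i)" for i
  define mu where "mu i = lam (d - Suc i)" for i
  have e: "\<And>i. i < d \<Longrightarrow> e i \<in> carrier_vec d" "\<And>i. i < d \<Longrightarrow> S *\<^sub>v e i = mu i \<cdot>\<^sub>v e i"
    using f by (auto simp: e_def mu_def)
  have o: "e i \<bullet> e l = (if i = l then 1 else 0)" if "i < d" "l < d" for i l
    using fo[of "d - Suc i" "d - Suc l"] that by (auto simp: e_def)
  have mono: "mu l \<le> mu i" if "l \<le> i" "i < d" for i l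
    using fmono[of "d - Suc l" "d - Suc i"] that by (cases "l = i") (auto simp: mu_def)
  define U where "U = Matrix.mat d d (\<lambda>(i, k). e k $ i)"
  note U = orthonormal_expansion[OF e(1) o U_def]
  have U4: "v \<bullet> w = (\<Sum>i<d. (e i \<bullet> v) * (e i \<bullet> w))" if "v \<in> carrier_vec d" "w \<in> carrier_vec d" for v w
    by (rule orthonormal_expansion(4)[OF e(1) o U_def that])
  define D where "D = mat_diag d mu"
  have D: "D \<in> carrier_mat d d" by (simp add: D_def)
  have c: "col U k = e k" if "k < d" for k using that e(1)[OF that] by (auto simp: U_def intro!: eq_vecI)
  have "S * U = U * D"
  proof (rule eq_matI)
    fix i k assume ik: "i < dim_row (U * D)" "k < dim_col (U * D)"
    then have ik: "i < d" "k < d" using U(1) D by auto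
    have "(S * U) $$ (i, k) = (S *\<^sub>v e k) $ i" using ik U(1) S c by simp
    also have "\<dots> = mu k * U $$ (i, k)" using e[OF ik(2)] ik by (simp add: U_def)
    also have "\<dots> = (U * D) $$ (i, k)" unfolding D_def using U(1) ik
      by (simp add: mat_diag_mult_right[of _ d d])
    finally show "(S * U) $$ (i, k) = (U * D) $$ (i, k)" .
  qed (use U(1) S D in auto)
  then have "S = U * D * transpose_mat U" using U(1,3) S D
    by (metis assoc_mult_mat right_mult_one_mat transpose_carrier_mat)
  then have "similar_mat S D"
    unfolding similar_mat_def similar_mat_wit_def Let_def
    using U S D by (intro exI[of _ U] exI[of _ "transpose_mat U"]) auto
  then have "char_poly S = char_poly D" by (rule char_poly_similar)
  also have "\<dots> = (\<Prod>a\<leftarrow>diag_mat D. [:- a, 1:])"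
    by (rule char_poly_upper_triangular[OF D]) (auto simp: D_def mat_diag_def)
  also have "diag_mat D = map mu [0..<d]" by (auto simp: diag_mat_def D_def mat_diag_def)
  finally have "proots (char_poly S) = mset (map mu [0..<d])" by (simp only: proots_linear_factors)
  moreover have "sorted (map mu [0..<d])" using mono by (auto simp: sorted_iff_nth_mono)
  ultimately have "sorted_list_of_multiset (proots (char_poly S)) = map mu [0..<d]"
    by (metis sorted_list_of_multiset_mset sorted_sort_id)
  then have ord: "ord_eigenvalue (Suc i) S = mu i" if "i < d" for i
    using that by (simp add: ord_eigenvalue_def)
  have form: "v \<bullet> (S *\<^sub>v v) = (\<Sum>i<d. mu i * (e i \<bullet> v)\<^sup>2)" if v: "v \<in> carrier_vec d" for v
  proof -
    have "v \<bullet> (S *\<^sub>v v) = (\<Sum>i<d. (e i \<bullet> v) * (e i \<bullet> (S *\<^sub>v v)))"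
      using U4[OF v, of "S *\<^sub>v v"] v S by simp
    also have "\<dots> = (\<Sum>i<d. mu i * (e i \<bullet> v)\<^sup>2)"
    proof (intro sum.cong refl)
      fix i assume "i \<in> {..<d}"
      then have i: "i < d" by simp
      have "e i \<bullet> (S *\<^sub>v v) = mu i * (e i \<bullet> v)"
        using form_symmetric[OF S e(1)[OF i] v] e(2)[OF i] e(1)[OF i] v comm_scalar_prod[of v d "e i"] by simp
      then show "(e i \<bullet> v) * (e i \<bullet> (S *\<^sub>v v)) = mu i * (e i \<bullet> v)\<^sup>2" by (simp add: power2_eq_square)
    qed
    finally show ?thesis .
  qed
  show ?thesis
  proof (rule that[of e])
    show "v \<bullet> v = (\<Sum>i<d. (e i \<bullet> v)\<^sup>2)" if "v \<in> carrier_vec d" for v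
      using U4[OF that that] by (simp add: power2_eq_square)
    show "v \<bullet> (S *\<^sub>v v) = (\<Sum>i<d. ord_eigenvalue (Suc i) S * (e i \<bullet> v)\<^sup>2)" if "v \<in> carrier_vec d" for v
      using form[OF that] ord by simp
    show "ord_eigenvalue (Suc l) S \<le> ord_eigenvalue (Suc i) S" if "i < d" "l \<le> i" for i l
      using ord mono that by simp
    show "e i \<bullet> e l = (if i = l then 1 else 0)" if "i < d" "l < d" for i l
      using o[OF that] .
    show "e i \<in> carrier_vec d" "e i \<bullet> (S *\<^sub>v e i) = ord_eigenvalue (Suc i) S" if "i < d" for i
      using e[OF that] o[OF that that] ord[OF that] that by simp_all
  qed
qed

text \<open>
  The two halves of the min-max principle, phrased with linear constraints in place of subspaces.
  Here the \<open>d - k\<close> constraints together with orthogonality to the first \<open>k - 1\<close> eigenvectors leave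
  a nonzero vector, whose Rayleigh quotient is at least the \<open>k\<close>-th eigenvalue.
\<close>

lemma ord_eigenvalue_le:
  fixes S :: rmat and g :: "nat \<Rightarrow> rvec"
  assumes S: "S \<in> carrier_mat d d" "transpose_mat S = S"
    and k: "1 \<le> k" "k \<le> d"
    and g: "\<And>i. i < d - k \<Longrightarrow> g i \<in> carrier_vec d"
    and bound: "\<And>v. v \<in> carrier_vec d \<Longrightarrow> (\<forall>i<d - k. g i \<bullet> v = 0) \<Longrightarrow> v \<bullet> (S *\<^sub>v v) \<le> c * (v \<bullet> v)"
  shows "ord_eigenvalue k S \<le> c"
proof -
  obtain e :: "nat \<Rightarrow> rvec" where e: "\<And>i. i < d \<Longrightarrow> e i \<in> carrier_vec d"
    and n: "\<And>v. v \<in> carrier_vec d \<Longrightarrow> v \<bullet> v = (\<Sum>i<d. (e i \<bullet> v)\<^sup>2)"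
    and f: "\<And>v. v \<in> carrier_vec d \<Longrightarrow> v \<bullet> (S *\<^sub>v v) = (\<Sum>i<d. ord_eigenvalue (Suc i) S * (e i \<bullet> v)\<^sup>2)"
    and mono: "\<And>i l. i < d \<Longrightarrow> l \<le> i \<Longrightarrow> ord_eigenvalue (Suc l) S \<le> ord_eigenvalue (Suc i) S"
    by (rule symmetric_spectral[OF S]) (rule that)
  define h where "h i = (if i < k - 1 then e i else g (i - (k - 1)))" for i
  have "h i \<in> carrier_vec d" if "i < d - 1" for i using that e g k by (auto simp: h_def)
  then obtain v where v: "v \<in> carrier_vec d" "v \<noteq> 0\<^sub>v d" "\<And>i. i < d - 1 \<Longrightarrow> h i \<bullet> v = 0"
    using underdetermined_system[of "d - 1" h d] k by auto
  have ev: "e i \<bullet> v = 0" if "i < k - 1" for i using v(3)[of i] that k by (simp add: h_def)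
  have gv: "g i \<bullet> v = 0" if "i < d - k" for i 
  proof -
    have "h (i + (k - 1)) = g i" "i + (k - 1) < d - 1" using that k by (auto simp: h_def)
    then show ?thesis using v(3) by metis
  qed
  have "ord_eigenvalue k S * (v \<bullet> v) = (\<Sum>i<d. ord_eigenvalue k S * (e i \<bullet> v)\<^sup>2)"
    using n[OF v(1)] by (simp add: sum_distrib_left)
  also have "\<dots> \<le> (\<Sum>i<d. ord_eigenvalue (Suc i) S * (e i \<bullet> v)\<^sup>2)"
  proof (intro sum_mono)
    fix i assume i: "i \<in> {..<d}"
    show "ord_eigenvalue k S * (e i \<bullet> v)\<^sup>2 \<le> ord_eigenvalue (Suc i) S * (e i \<bullet> v)\<^sup>2"
      using ev[of i] mono[of i "k - 1"] i k by (cases "i < k - 1") (auto intro!: mult_right_mono)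
  qed
  also have "\<dots> \<le> c * (v \<bullet> v)" using bound[OF v(1)] gv f[OF v(1)] by simp
  finally show ?thesis using scalar_prod_self_pos[OF v(1,2)] by simp
qed

text \<open>
  The test space lies in the range of an isometry \<open>Q\<close> of \<open>\<real>\<^sup>r\<close>: \<open>q - 1\<close> constraints and orthogonality
  of \<open>Q u\<close> to the top \<open>r - q\<close> eigenvectors are only \<open>r - 1\<close> conditions on \<open>u\<close>.
\<close>

lemma ord_eigenvalue_ge:
  fixes S :: rmat and g :: "nat \<Rightarrow> rvec"
  assumes S: "S \<in> carrier_mat d d" "transpose_mat S = S"
    and Q: "Q \<in> carrier_mat d r" "transpose_mat Q * Q = 1\<^sub>m r"
    and q: "1 \<le> q" "q \<le> r" "r \<le> d"
    and g: "\<And>i. i < q - 1 \<Longrightarrow> g i \<in> carrier_vec r"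
    and bound: "\<And>u. u \<in> carrier_vec r \<Longrightarrow> (\<forall>i<q - 1. g i \<bullet> u = 0) \<Longrightarrow>
       c * (u \<bullet> u) \<le> (Q *\<^sub>v u) \<bullet> (S *\<^sub>v (Q *\<^sub>v u))"
  shows "c \<le> ord_eigenvalue (d - r + q) S"
proof -
  define k where "k = d - r + q"
  have k: "1 \<le> k" "k \<le> d" "d - k = r - q" using q by (auto simp: k_def)
  obtain e :: "nat \<Rightarrow> rvec" where e: "\<And>i. i < d \<Longrightarrow> e i \<in> carrier_vec d"
    and n: "\<And>v. v \<in> carrier_vec d \<Longrightarrow> v \<bullet> v = (\<Sum>i<d. (e i \<bullet> v)\<^sup>2)"
    and f: "\<And>v. v \<in> carrier_vec d \<Longrightarrow> v \<bullet> (S *\<^sub>v v) = (\<Sum>i<d. ord_eigenvalue (Suc i) S * (e i \<bullet> v)\<^sup>2)"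
    and mono: "\<And>i l. i < d \<Longrightarrow> l \<le> i \<Longrightarrow> ord_eigenvalue (Suc l) S \<le> ord_eigenvalue (Suc i) S"
    by (rule symmetric_spectral[OF S]) (rule that)
  define h where "h i = (if i < q - 1 then g i else transpose_mat Q *\<^sub>v e (k + (i - (q - 1))))" for i
  have "h i \<in> carrier_vec r" if "i < r - 1" for i using that e g k Q q by (auto simp: h_def)
  then obtain u where u: "u \<in> carrier_vec r" "u \<noteq> 0\<^sub>v r" "\<And>i. i < r - 1 \<Longrightarrow> h i \<bullet> u = 0"
    using underdetermined_system[of "r - 1" h r] q by auto
  define v where "v = Q *\<^sub>v u"
  have v: "v \<in> carrier_vec d" using Q u by (simp add: v_def)
  have gu: "g i \<bullet> u = 0" if "i < q - 1" for i using u(3)[of i] that q by (simp add: h_def)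
  have ev: "e i \<bullet> v = 0" if "k \<le> i" "i < d" for i
  proof -
    have "i - k < d - k" using that by auto
    then have i': "i - k + (q - 1) < r - 1" using k q by linarith
    have "(transpose_mat Q *\<^sub>v e i) \<bullet> u = 0"
    proof -
      have "h (i - k + (q - 1)) = transpose_mat Q *\<^sub>v e i" 
        unfolding h_def using that q by (subst if_not_P) (linarith, simp)
      then show ?thesis using u(3)[OF i'] by simp
    qed
    then show ?thesis unfolding v_def using transpose_vec_mult_scalar[OF Q(1) u(1) e[OF that(2)]] by simp
  qed
  have vv: "v \<bullet> v = u \<bullet> u"
    unfolding v_def using transpose_vec_mult_scalar[OF Q(1) u(1) v] Q u v_def
    by (metis assoc_mult_mat_vec one_mult_mat_vec transpose_carrier_mat)
  have "c * (v \<bullet> v) \<le> v \<bullet> (S *\<^sub>v v)" using bound[OF u(1)] gu by (simp add: v_def[symmetric] vv)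
  also have "\<dots> = (\<Sum>i<d. ord_eigenvalue (Suc i) S * (e i \<bullet> v)\<^sup>2)" using f[OF v] .
  also have "\<dots> \<le> (\<Sum>i<d. ord_eigenvalue k S * (e i \<bullet> v)\<^sup>2)"
  proof (intro sum_mono)
    fix i assume i: "i \<in> {..<d}"
    show "ord_eigenvalue (Suc i) S * (e i \<bullet> v)\<^sup>2 \<le> ord_eigenvalue k S * (e i \<bullet> v)\<^sup>2"
      using ev[of i] mono[of "k - 1" i] i k by (cases "k \<le> i") (auto intro!: mult_right_mono)
  qed
  also have "\<dots> = ord_eigenvalue k S * (v \<bullet> v)" using n[OF v] by (simp add: sum_distrib_left)
  finally show ?thesis using scalar_prod_self_pos[OF u(1,2)] vv by (simp add: k_def)
qed

section \<open>Cholesky factors and matrices known up to a rate\<close>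

text \<open>
  Cholesky factorisation with a lower triangular \<open>m\<close> in \<open>b = m\<^sup>* m\<close> (rather than \<open>b = m m\<^sup>*\<close>), so the
  square is completed in the last variable first and the induction continues with the Schur
  complement \<open>b'\<close>.
\<close>

lemma function_cholesky:
  fixes b :: "nat \<Rightarrow> nat \<Rightarrow> real"
  assumes "\<And>i k. i < r \<Longrightarrow> k < r \<Longrightarrow> b i k = b k i"
    and "\<And>x. \<exists>i<r. x i \<noteq> 0 \<Longrightarrow> 0 < (\<Sum>i<r. \<Sum>k<r. x i * b i k * x k)"
  shows "\<exists>m. (\<forall>i<r. 0 < m i i) \<and> (\<forall>l<r. \<forall>i<r. l < i \<longrightarrow> m l i = 0) \<and>
     (\<forall>i<r. \<forall>k<r. b i k = (\<Sum>l<r. m l i * m l k))"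
  using assms
proof (induction r arbitrary: b)
  case 0 show ?case by simp
next
  case (Suc r)
  define \<rho> where "\<rho> = b r r"
  have \<rho>: "\<rho> > 0"
  proof -
    have "0 < (\<Sum>i<Suc r. \<Sum>k<Suc r. (if i = r then 1 else 0) * b i k * (if k = r then 1 else 0))"
      by (rule Suc.prems(2)) auto
    then show ?thesis by (simp add: \<rho>_def)
  qed
  define b' where "b' i k = b i k - b i r * b r k / \<rho>" for i k
  have "\<exists>m. (\<forall>i<r. 0 < m i i) \<and> (\<forall>l<r. \<forall>i<r. l < i \<longrightarrow> m l i = 0) \<and>
     (\<forall>i<r. \<forall>k<r. b' i k = (\<Sum>l<r. m l i * m l k))"
  proof (rule Suc.IH)
    show "b' i k = b' k i" if "i < r" "k < r" for i k
      using Suc.prems(1)[of i k] Suc.prems(1)[of i r] Suc.prems(1)[of r k] that by (simp add: b'_def)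
    fix x :: "nat \<Rightarrow> real" assume x: "\<exists>i<r. x i \<noteq> 0"
    define s where "s = (\<Sum>k<r. b r k * x k)"
    (* the last coordinate minimises the form for given first coordinates *)
    define y where "y i = (if i < r then x i else - s / \<rho>)" for i
    have "\<exists>i<Suc r. y i \<noteq> 0" using x by (auto simp: y_def)
    then have "0 < (\<Sum>i<Suc r. \<Sum>k<Suc r. y i * b i k * y k)" by (rule Suc.prems(2))
    also have "\<dots> = (\<Sum>i<r. (\<Sum>k<r. x i * b i k * x k) + x i * b i r * (- s / \<rho>)) +
        ((\<Sum>k<r. (- s / \<rho>) * b r k * x k) + (- s / \<rho>) * \<rho> * (- s / \<rho>))"
      by (simp add: y_def \<rho>_def)
    also have "(\<Sum>i<r. (\<Sum>k<r. x i * b i k * x k) + x i * b i r * (- s / \<rho>)) =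
       (\<Sum>i<r. \<Sum>k<r. x i * b i k * x k) + s * (- s / \<rho>)"
    proof -
      have "(\<Sum>i<r. x i * b i r) = s" using Suc.prems(1) by (simp add: s_def mult.commute)
      then show ?thesis unfolding sum.distrib sum_distrib_right[symmetric] by simp
    qed
    also have "(\<Sum>k<r. (- s / \<rho>) * b r k * x k) = (- s / \<rho>) * s"
      unfolding mult.assoc sum_distrib_left[symmetric] by (simp only: s_def)
    also have "(\<Sum>i<r. \<Sum>k<r. x i * b i k * x k) + s * (- s / \<rho>) + ((- s / \<rho>) * s + (- s / \<rho>) * \<rho> * (- s / \<rho>)) =
       (\<Sum>i<r. \<Sum>k<r. x i * b i k * x k) - s * s / \<rho>" using \<rho> by (simp add: field_simps)
    also have "s * s / \<rho> = (\<Sum>i<r. \<Sum>k<r. x i * (b i r * b r k / \<rho>) * x k)"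
    proof -
      have "s * s = (\<Sum>i<r. b r i * x i) * (\<Sum>k<r. b r k * x k)" by (simp add: s_def)
      also have "\<dots> = (\<Sum>i<r. \<Sum>k<r. x i * (b i r * b r k) * x k)"
        unfolding sum_product using Suc.prems(1) by (intro sum.cong refl) (simp add: mult_ac)
      finally show ?thesis by (simp add: sum_divide_distrib)
    qed
    finally show "0 < (\<Sum>i<r. \<Sum>k<r. x i * b' i k * x k)"
      by (simp add: b'_def left_diff_distrib right_diff_distrib sum_subtractf)
  qed
  then obtain m where m: "\<And>i. i < r \<Longrightarrow> 0 < m i i" "\<And>l i. l < r \<Longrightarrow> i < r \<Longrightarrow> l < i \<Longrightarrow> m l i = 0"
    and bm: "\<And>i k. i < r \<Longrightarrow> k < r \<Longrightarrow> b' i k = (\<Sum>l<r. m l i * m l k)" by blast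
  define m' where "m' l i = (if l = r then b r i / sqrt \<rho> else if i = r then 0 else m l i)" for l i
  have "b i k = (\<Sum>l<Suc r. m' l i * m' l k)" if ik: "i < Suc r" "k < Suc r" for i k
  proof -
    have "(\<Sum>l<Suc r. m' l i * m' l k) = (\<Sum>l<r. m' l i * m' l k) + b r i * b r k / \<rho>"
      using \<rho> by (simp add: m'_def field_simps flip: real_sqrt_mult)
    also have "(\<Sum>l<r. m' l i * m' l k) = (if i = r \<or> k = r then 0 else b' i k)"
      using bm[of i k] ik by (auto simp: m'_def)
    finally show ?thesis using Suc.prems(1)[of i r] Suc.prems(1)[of i k] ik \<rho>
      by (auto simp: b'_def \<rho>_def)
  qed
  moreover have "\<forall>i<Suc r. 0 < m' i i" "\<forall>l<Suc r. \<forall>i<Suc r. l < i \<longrightarrow> m' l i = 0"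
    using m \<rho> by (auto simp: m'_def \<rho>_def less_Suc_eq)
  ultimately show ?case by blast
qed

lemma lower_cholesky:
  assumes B: "pos_def r B"
  obtains M where "M \<in> carrier_mat r r" "\<And>i. i < r \<Longrightarrow> 0 < M $$ (i, i)"
    "\<And>l i. l < r \<Longrightarrow> i < r \<Longrightarrow> l < i \<Longrightarrow> M $$ (l, i) = 0" "B = transpose_mat M * M"
proof -
  have Bc: "B \<in> carrier_mat r r" and sym: "transpose_mat B = B"
    and pos: "\<And>v. v \<in> carrier_vec r \<Longrightarrow> v \<noteq> 0\<^sub>v r \<Longrightarrow> 0 < v \<bullet> (B *\<^sub>v v)"
    using B by (auto simp: pos_def_def)
  have "B $$ (i, k) = B $$ (k, i)" if "i < r" "k < r" for i k
    using sym Bc that by (metis carrier_matD index_transpose_mat(1))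
  moreover have "0 < (\<Sum>i<r. \<Sum>k<r. x i * B $$ (i, k) * x k)" if "\<exists>i<r. x i \<noteq> 0" for x
  proof -
    have "Matrix.vec r x \<noteq> 0\<^sub>v r" using that by (metis index_vec index_zero_vec(1))
    then have "0 < Matrix.vec r x \<bullet> (B *\<^sub>v Matrix.vec r x)" using pos by simp
    also have "\<dots> = (\<Sum>i<r. \<Sum>k<r. x i * B $$ (i, k) * x k)"
      using Bc by (simp add: scalar_prod_def atLeast0LessThan sum_distrib_left mult.assoc)
    finally show ?thesis .
  qed
  ultimately obtain m where m: "\<forall>i<r. 0 < m i i" "\<forall>l<r. \<forall>i<r. l < i \<longrightarrow> m l i = 0"
     "\<forall>i<r. \<forall>k<r. B $$ (i, k) = (\<Sum>l<r. m l i * m l k)"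
    using function_cholesky[of r "\<lambda>i k. B $$ (i, k)"] by blast
  show ?thesis
    by (rule that[of "Matrix.mat r r (\<lambda>(l, i). m l i)"])
      (use m Bc in \<open>auto intro!: eq_matI simp: scalar_prod_def atLeast0LessThan\<close>)
qed

lemma inverse_of_injective:
  fixes K :: rmat
  assumes K: "K \<in> carrier_mat r r" and inj: "\<And>v. v \<in> carrier_vec r \<Longrightarrow> K *\<^sub>v v = 0\<^sub>v r \<Longrightarrow> v = 0\<^sub>v r"
  obtains J where "J \<in> carrier_mat r r" "J * K = 1\<^sub>m r" "K * J = 1\<^sub>m r"
proof -
  have "det K \<noteq> 0" using det_0_iff_vec_prod_zero_field[OF K] inj by blast
  then have "K \<in> Units (ring_mat TYPE(real) r ())" by (rule det_non_zero_imp_unit[OF K])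
  then obtain J where "mat_inverse K = Some J" using mat_inverse(1)[OF K] by fastforce
  then show ?thesis using mat_inverse(2)[OF K] that by blast
qed

lemma gram_form:
  fixes M :: rmat
  assumes "M \<in> carrier_mat k r" "v \<in> carrier_vec r"
  shows "v \<bullet> ((transpose_mat M * M) *\<^sub>v v) = (M *\<^sub>v v) \<bullet> (M *\<^sub>v v)"
  using assms transpose_vec_mult_scalar[of "transpose_mat M" r k "M *\<^sub>v v" v]
  by (simp add: assoc_mult_mat_vec[of _ r k _ r])

text \<open>
  Convergence at rate \<open>\<eta>\<close> is measured entrywise: the dimension \<open>r\<close> is fixed, and entrywise rates are
  stable under products and transposes.
\<close>

definition approx_mat :: "nat \<Rightarrow> (nat \<Rightarrow> real) \<Rightarrow> (nat \<Rightarrow> rmat) \<Rightarrow> rmat \<Rightarrow> bool" where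
  "approx_mat r \<eta> X Y \<longleftrightarrow> Y \<in> carrier_mat r r \<and> (\<forall>\<^sub>F n in sequentially. X n \<in> carrier_mat r r) \<and>
     (\<forall>i<r. \<forall>k<r. (\<lambda>n. X n $$ (i, k) - Y $$ (i, k)) \<in> O(\<eta>))"

lemma approx_mat_const: "Y \<in> carrier_mat r r \<Longrightarrow> approx_mat r \<eta> (\<lambda>_. Y) Y"
  by (simp add: approx_mat_def)

lemma approx_mat_transpose:
  assumes "approx_mat r \<eta> X Y"
  shows "approx_mat r \<eta> (\<lambda>n. transpose_mat (X n)) (transpose_mat Y)"
proof -
  have "(\<lambda>n. transpose_mat (X n) $$ (i, k) - transpose_mat Y $$ (i, k)) \<in> O(\<eta>)" if "i < r" "k < r" for i k
  proof -
    have "(\<lambda>n. X n $$ (k, i) - Y $$ (k, i)) \<in> O(\<eta>)" using assms that by (auto simp: approx_mat_def)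
    moreover have "\<forall>\<^sub>F n in sequentially. X n $$ (k, i) - Y $$ (k, i) = transpose_mat (X n) $$ (i, k) - transpose_mat Y $$ (i, k)"
      using assms that unfolding approx_mat_def by (auto elim!: eventually_mono)
    ultimately show ?thesis using landau_o.big.in_cong by fastforce
  qed
  with assms show ?thesis by (auto simp: approx_mat_def)
qed

lemma approx_mat_mult:
  assumes X: "approx_mat r \<eta> X Y" and X': "approx_mat r \<eta> X' Y'" and \<eta>: "\<eta> \<in> O(\<lambda>_. 1)"
  shows "approx_mat r \<eta> (\<lambda>n. X n * X' n) (Y * Y')"
proof -
  have c: "\<forall>\<^sub>F n in sequentially. X n \<in> carrier_mat r r \<and> X' n \<in> carrier_mat r r"
    using X X' by (auto simp: approx_mat_def eventually_conj)
  have Y: "Y \<in> carrier_mat r r" "Y' \<in> carrier_mat r r" using X X' by (auto simp: approx_mat_def)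
  have "(\<lambda>n. (X n * X' n) $$ (i, k) - (Y * Y') $$ (i, k)) \<in> O(\<eta>)" if ik: "i < r" "k < r" for i k
  proof -
    have "(\<lambda>n. \<Sum>l<r. (X n $$ (i, l) - Y $$ (i, l)) * (X' n $$ (l, k) - Y' $$ (l, k)) +
       Y $$ (i, l) * (X' n $$ (l, k) - Y' $$ (l, k)) + (X n $$ (i, l) - Y $$ (i, l)) * Y' $$ (l, k)) \<in> O(\<eta>)"
    proof (intro big_sum_in_bigo sum_in_bigo)
      fix l assume "l \<in> {..<r}"
      then have l: "l < r" by simp
      have 1: "(\<lambda>n. X n $$ (i, l) - Y $$ (i, l)) \<in> O(\<eta>)" "(\<lambda>n. X' n $$ (l, k) - Y' $$ (l, k)) \<in> O(\<eta>)"
        using X X' ik l by (auto simp: approx_mat_def)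
      have 2: "(\<lambda>n. X' n $$ (l, k) - Y' $$ (l, k)) \<in> O(\<lambda>_. 1)" using 1(2) \<eta> by (rule landau_o.big_trans)
      show "(\<lambda>n. (X n $$ (i, l) - Y $$ (i, l)) * (X' n $$ (l, k) - Y' $$ (l, k))) \<in> O(\<eta>)"
        using landau_o.big.mult[OF 1(1) 2] by simp
      show "(\<lambda>n. Y $$ (i, l) * (X' n $$ (l, k) - Y' $$ (l, k))) \<in> O(\<eta>)"
        "(\<lambda>n. (X n $$ (i, l) - Y $$ (i, l)) * Y' $$ (l, k)) \<in> O(\<eta>)"
        using 1 by (auto intro: landau_o.big.mult_left simp: landau_o.big.cmult_in_iff' landau_o.big.cmult_in_iff)
    qed
    moreover have "\<forall>\<^sub>F n in sequentially. (\<Sum>l<r. (X n $$ (i, l) - Y $$ (i, l)) * (X' n $$ (l, k) - Y' $$ (l, k)) +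
       Y $$ (i, l) * (X' n $$ (l, k) - Y' $$ (l, k)) + (X n $$ (i, l) - Y $$ (i, l)) * Y' $$ (l, k))
       = (X n * X' n) $$ (i, k) - (Y * Y') $$ (i, k)"
      using c
    proof eventually_elim
      case (elim n)
      then have "(X n * X' n) $$ (i, k) - (Y * Y') $$ (i, k) =
         (\<Sum>l<r. X n $$ (i, l) * X' n $$ (l, k) - Y $$ (i, l) * Y' $$ (l, k))"
        using Y ik by (auto simp add: scalar_prod_def atLeast0LessThan sum_subtractf)
      then show ?case by (auto intro!: sum.cong simp: algebra_simps)
    qed
    ultimately show ?thesis by (rule iffD1[OF landau_o.big.in_cong, rotated])
  qed
  with c Y show ?thesis unfolding approx_mat_def by (auto elim: eventually_mono)
qed

lemma abs_form_le:
  fixes E :: rmat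
  assumes E: "E \<in> carrier_mat r r" and b: "\<And>i k. i < r \<Longrightarrow> k < r \<Longrightarrow> \<bar>E $$ (i, k)\<bar> \<le> c"
    and u: "u \<in> carrier_vec r"
  shows "\<bar>u \<bullet> (E *\<^sub>v u)\<bar> \<le> real r * c * (u \<bullet> u)"
proof (cases "r = 0")
  case True then show ?thesis using u E by (simp add: scalar_prod_def)
next
  case False
  then have c: "0 \<le> c" using b[of 0 0] by linarith
  have "\<bar>u \<bullet> (E *\<^sub>v u)\<bar> = \<bar>\<Sum>i<r. \<Sum>k<r. u $ i * E $$ (i, k) * u $ k\<bar>"
    using E u by (simp add: scalar_prod_def atLeast0LessThan sum_distrib_left mult.assoc)
  also have "\<dots> \<le> (\<Sum>i<r. \<Sum>k<r. c * ((u $ i * u $ i + u $ k * u $ k) / 2))"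
  proof (rule order_trans[OF sum_abs], rule sum_mono, rule order_trans[OF sum_abs], rule sum_mono)
    fix i k assume ik: "i \<in> {..<r}" "k \<in> {..<r}"
    have "0 \<le> (\<bar>u $ i\<bar> - \<bar>u $ k\<bar>)\<^sup>2" by simp
    then have "\<bar>u $ i\<bar> * \<bar>u $ k\<bar> \<le> (u $ i * u $ i + u $ k * u $ k) / 2"
      by (simp add: power2_eq_square algebra_simps)
    then have "\<bar>E $$ (i, k)\<bar> * (\<bar>u $ i\<bar> * \<bar>u $ k\<bar>) \<le> c * ((u $ i * u $ i + u $ k * u $ k) / 2)"
      using b[of i k] ik c by (intro mult_mono) auto
    then show "\<bar>u $ i * E $$ (i, k) * u $ k\<bar> \<le> c * ((u $ i * u $ i + u $ k * u $ k) / 2)"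
      by (simp add: abs_mult mult_ac)
  qed
  also have "\<dots> = c / 2 * (\<Sum>i<r. \<Sum>k<r. u $ i * u $ i + u $ k * u $ k)"
    by (simp add: sum_distrib_left)
  also have "(\<Sum>i<r. \<Sum>k<r. u $ i * u $ i + u $ k * u $ k) = 2 * real r * (\<Sum>i<r. u $ i * u $ i)"
    by (simp add: sum.distrib flip: sum_distrib_left)
  also have "(\<Sum>i<r. u $ i * u $ i) = u \<bullet> u" using u by (simp add: scalar_prod_def atLeast0LessThan)
  also have "c / 2 * (2 * real r * (u \<bullet> u)) = real r * c * (u \<bullet> u)" by simp
  finally show ?thesis .
qed

lemma approx_mat_form:
  assumes X: "approx_mat r \<eta> X Y" and \<eta>: "\<And>n. 0 \<le> \<eta> n"
  shows "\<exists>C\<ge>0. \<forall>\<^sub>F n in sequentially. \<forall>u\<in>carrier_vec r. \<bar>u \<bullet> (X n *\<^sub>v u) - u \<bullet> (Y *\<^sub>v u)\<bar> \<le> C * \<eta> n * (u \<bullet> u)"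
proof -
  have "\<exists>c\<ge>0. \<forall>\<^sub>F n in sequentially. \<bar>X n $$ (i, k) - Y $$ (i, k)\<bar> \<le> c * \<eta> n" if "i < r" "k < r" for i k
  proof -
    have "(\<lambda>n. X n $$ (i, k) - Y $$ (i, k)) \<in> O(\<eta>)" using X that by (auto simp: approx_mat_def)
    then obtain c where "c > 0" "\<forall>\<^sub>F n in sequentially. norm (X n $$ (i, k) - Y $$ (i, k)) \<le> c * norm (\<eta> n)"
      by (rule landau_o.bigE)
    then show ?thesis using \<eta> by (intro exI[of _ c]) auto
  qed
  then have "\<forall>i k. \<exists>c. i < r \<longrightarrow> k < r \<longrightarrow> c \<ge> 0 \<and> (\<forall>\<^sub>F n in sequentially. \<bar>X n $$ (i, k) - Y $$ (i, k)\<bar> \<le> c * \<eta> n)"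
    by blast
  then obtain c where cc: "\<forall>i k. i < r \<longrightarrow> k < r \<longrightarrow> c i k \<ge> 0 \<and>
      (\<forall>\<^sub>F n in sequentially. \<bar>X n $$ (i, k) - Y $$ (i, k)\<bar> \<le> c i k * \<eta> n)"
    unfolding choice_iff by (elim exE) (rule that)
  then have c: "\<And>i k. i < r \<Longrightarrow> k < r \<Longrightarrow> c i k \<ge> 0"
    "\<And>i k. i < r \<Longrightarrow> k < r \<Longrightarrow> \<forall>\<^sub>F n in sequentially. \<bar>X n $$ (i, k) - Y $$ (i, k)\<bar> \<le> c i k * \<eta> n" by simp_all
  define c' where "c' = (\<Sum>i<r. \<Sum>k<r. c i k)"
  have c'0: "c' \<ge> 0" unfolding c'_def using c(1) by (intro sum_nonneg) auto
  have c': "c i k \<le> c'" if "i < r" "k < r" for i k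
  proof -
    have "c i k \<le> (\<Sum>k<r. c i k)" using that c(1) by (intro member_le_sum) auto
    also have "\<dots> \<le> c'" unfolding c'_def
      using that c(1) by (intro member_le_sum[of i _ "\<lambda>i. \<Sum>k<r. c i k"]) (auto intro: sum_nonneg)
    finally show ?thesis .
  qed
  have Y: "Y \<in> carrier_mat r r" using X by (auto simp: approx_mat_def)
  have "\<forall>\<^sub>F n in sequentially. \<forall>i\<in>{..<r}. \<forall>k\<in>{..<r}. \<bar>X n $$ (i, k) - Y $$ (i, k)\<bar> \<le> c i k * \<eta> n"
    using c(2) by (auto simp: eventually_ball_finite_distrib)
  moreover have "\<forall>\<^sub>F n in sequentially. X n \<in> carrier_mat r r" using X by (auto simp: approx_mat_def)
  ultimately have "\<forall>\<^sub>F n in sequentially. \<forall>u\<in>carrier_vec r. \<bar>u \<bullet> (X n *\<^sub>v u) - u \<bullet> (Y *\<^sub>v u)\<bar> \<le> (real r * c') * \<eta> n * (u \<bullet> u)"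
  proof eventually_elim
    case (elim n)
    show ?case
    proof
      fix u :: rvec assume u: "u \<in> carrier_vec r"
      have "\<bar>(X n - Y) $$ (i, k)\<bar> \<le> c' * \<eta> n" if "i < r" "k < r" for i k
      proof -
        have "\<bar>X n $$ (i, k) - Y $$ (i, k)\<bar> \<le> c i k * \<eta> n" using elim that by auto
        also have "\<dots> \<le> c' * \<eta> n" using c'[OF that] \<eta>[of n] by (rule mult_right_mono)
        finally show ?thesis using elim that Y by simp
      qed
      from abs_form_le[OF minus_carrier_mat[OF Y] this u]
      have "\<bar>u \<bullet> ((X n - Y) *\<^sub>v u)\<bar> \<le> real r * (c' * \<eta> n) * (u \<bullet> u)" by auto
      moreover have "u \<bullet> ((X n - Y) *\<^sub>v u) = u \<bullet> (X n *\<^sub>v u) - u \<bullet> (Y *\<^sub>v u)"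
        unfolding minus_mult_distrib_mat_vec[OF elim(2) Y u]
        by (rule scalar_prod_minus_distrib[where n=r]) (use elim Y u in auto)
      ultimately show "\<bar>u \<bullet> (X n *\<^sub>v u) - u \<bullet> (Y *\<^sub>v u)\<bar> \<le> (real r * c') * \<eta> n * (u \<bullet> u)" by (simp add: mult_ac)
    qed
  qed
  then show ?thesis using c'0 by (intro exI[of _ "real r * c'"]) auto
qed

text \<open>
  The error is relative and uniform in the vector. This is what survives for forms whose
  eigenvalues are of different orders of magnitude, where an absolute error would swamp the
  small ones.
\<close>

definition form_equiv :: "nat \<Rightarrow> (nat \<Rightarrow> real) \<Rightarrow> (nat \<Rightarrow> rvec \<Rightarrow> real) \<Rightarrow> (nat \<Rightarrow> rvec \<Rightarrow> real) \<Rightarrow> bool" where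
  "form_equiv r \<eta> F G \<longleftrightarrow> (\<exists>C\<ge>0. \<forall>\<^sub>F n in sequentially. \<forall>u\<in>carrier_vec r. \<bar>F n u - G n u\<bar> \<le> C * \<eta> n * G n u)"

lemma form_equiv_trans:
  assumes FG: "form_equiv r \<eta> F G" and GH: "form_equiv r \<eta> G H"
    and \<eta>: "\<And>n. 0 \<le> \<eta> n" "\<forall>\<^sub>F n in sequentially. \<eta> n \<le> 1"
    and H: "\<forall>\<^sub>F n in sequentially. \<forall>u\<in>carrier_vec r. 0 \<le> H n u"
  shows "form_equiv r \<eta> F H"
proof -
  obtain C C' where C: "C \<ge> 0" "\<forall>\<^sub>F n in sequentially. \<forall>u\<in>carrier_vec r. \<bar>F n u - G n u\<bar> \<le> C * \<eta> n * G n u"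
    and C': "C' \<ge> 0" "\<forall>\<^sub>F n in sequentially. \<forall>u\<in>carrier_vec r. \<bar>G n u - H n u\<bar> \<le> C' * \<eta> n * H n u"
    using FG GH unfolding form_equiv_def by auto
  have "\<forall>\<^sub>F n in sequentially. \<forall>u\<in>carrier_vec r. \<bar>F n u - H n u\<bar> \<le> (C * (1 + C') + C') * \<eta> n * H n u"
    using C(2) C'(2) \<eta>(2) H
  proof eventually_elim
    case (elim n)
    show ?case
    proof
      fix u :: rvec assume u: "u \<in> carrier_vec r"
      have h: "0 \<le> H n u" and e: "0 \<le> \<eta> n" "\<eta> n \<le> 1" using elim u \<eta> by auto
      have "C' * \<eta> n * H n u \<le> C' * H n u"
        using mult_left_mono[OF mult_right_mono[OF e(2) h] C'(1)] by simp
      then have "G n u \<le> (1 + C') * H n u" using elim(2) u by (fastforce simp: algebra_simps abs_le_iff)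
      then have "C * \<eta> n * G n u \<le> C * \<eta> n * ((1 + C') * H n u)"
        using C(1) e by (intro mult_left_mono) auto
      moreover have "\<bar>F n u - G n u\<bar> \<le> C * \<eta> n * G n u" "\<bar>G n u - H n u\<bar> \<le> C' * \<eta> n * H n u"
        using elim u by auto
      moreover have "\<bar>F n u - H n u\<bar> \<le> \<bar>F n u - G n u\<bar> + \<bar>G n u - H n u\<bar>" by linarith
      ultimately have "\<bar>F n u - H n u\<bar> \<le> C * \<eta> n * ((1 + C') * H n u) + C' * \<eta> n * H n u" by linarith
      then show "\<bar>F n u - H n u\<bar> \<le> (C * (1 + C') + C') * \<eta> n * H n u" by (simp add: algebra_simps)
    qed
  qed
  moreover have "0 \<le> C * (1 + C') + C'" using C C' by simp
  ultimately show ?thesis unfolding form_equiv_def by blast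
qed

lemma pos_def_coercive:
  assumes B: "pos_def r B"
  shows "\<exists>c>0. \<forall>y\<in>carrier_vec r. c * (y \<bullet> y) \<le> y \<bullet> (B *\<^sub>v y)"
proof (cases "r = 0")
  case True then show ?thesis using B by (intro exI[of _ 1]) (auto simp: scalar_prod_def)
next
  case False
  have Bc: "B \<in> carrier_mat r r" and sym: "transpose_mat B = B"
    and pos: "\<And>v. v \<in> carrier_vec r \<Longrightarrow> v \<noteq> 0\<^sub>v r \<Longrightarrow> 0 < v \<bullet> (B *\<^sub>v v)"
    using B by (auto simp: pos_def_def)
  obtain e :: "nat \<Rightarrow> rvec" where e: "\<And>i. i < r \<Longrightarrow> e i \<in> carrier_vec r"
    and n: "\<And>v. v \<in> carrier_vec r \<Longrightarrow> v \<bullet> v = (\<Sum>i<r. (e i \<bullet> v)\<^sup>2)"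
    and f: "\<And>v. v \<in> carrier_vec r \<Longrightarrow> v \<bullet> (B *\<^sub>v v) = (\<Sum>i<r. ord_eigenvalue (Suc i) B * (e i \<bullet> v)\<^sup>2)"
    and mono: "\<And>i l. i < r \<Longrightarrow> l \<le> i \<Longrightarrow> ord_eigenvalue (Suc l) B \<le> ord_eigenvalue (Suc i) B"
    and e1: "\<And>i l. i < r \<Longrightarrow> l < r \<Longrightarrow> e i \<bullet> e l = (if i = l then 1 else 0)" "\<And>i. i < r \<Longrightarrow> e i \<bullet> (B *\<^sub>v e i) = ord_eigenvalue (Suc i) B"
    by (rule symmetric_spectral[OF Bc sym]) (rule that)
  have "e 0 \<noteq> 0\<^sub>v r" using e1(1)[of 0 0] False by auto
  then have "0 < ord_eigenvalue (Suc 0) B" using pos[OF e[of 0]] e1(2)[of 0] False by simp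
  moreover have "ord_eigenvalue (Suc 0) B * (y \<bullet> y) \<le> y \<bullet> (B *\<^sub>v y)" if "y \<in> carrier_vec r" for y
    unfolding n[OF that] f[OF that] sum_distrib_left
    using mono[of _ 0] by (intro sum_mono mult_right_mono) auto
  ultimately show ?thesis by blast
qed

lemma pos_def_ord_eigenvalue:
  assumes B: "pos_def r B" and i: "i < r"
  shows "0 < ord_eigenvalue (Suc i) B"
proof -
  have Bc: "B \<in> carrier_mat r r" and sym: "transpose_mat B = B"
    and pos: "\<And>v. v \<in> carrier_vec r \<Longrightarrow> v \<noteq> 0\<^sub>v r \<Longrightarrow> 0 < v \<bullet> (B *\<^sub>v v)"
    using B by (auto simp: pos_def_def)
  obtain e :: "nat \<Rightarrow> rvec" where e: "\<And>i. i < r \<Longrightarrow> e i \<in> carrier_vec r"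
    and o: "\<And>i l. i < r \<Longrightarrow> l < r \<Longrightarrow> e i \<bullet> e l = (if i = l then 1 else 0)"
    and "\<And>i. i < r \<Longrightarrow> e i \<bullet> (B *\<^sub>v e i) = ord_eigenvalue (Suc i) B"
    by (rule symmetric_spectral[OF Bc sym]) (rule that)
  then have "e i \<in> carrier_vec r" "e i \<bullet> e i = 1" "e i \<bullet> (B *\<^sub>v e i) = ord_eigenvalue (Suc i) B"
    using i by simp_all
  moreover from this have "e i \<noteq> 0\<^sub>v r" by auto
  ultimately show ?thesis using pos[of "e i"] by simp
qed

text \<open>
  An absolute error \<open>O(\<eta>) \<parallel>y\<parallel>\<^sup>2\<close> is a relative one because the limit form is coercive. The vector
  \<open>y\<close> may itself depend on \<open>n\<close>, and may mix scales.
\<close>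

lemma approx_pos_def_form_equiv:
  assumes X: "approx_mat r \<eta> X B" and B: "pos_def r B" and \<eta>: "\<And>n. 0 \<le> \<eta> n"
    and y: "\<forall>\<^sub>F n in sequentially. \<forall>u\<in>carrier_vec r. y n u \<in> carrier_vec r"
  shows "form_equiv r \<eta> (\<lambda>n u. y n u \<bullet> (X n *\<^sub>v y n u)) (\<lambda>n u. y n u \<bullet> (B *\<^sub>v y n u))"
proof -
  obtain C where C: "C \<ge> 0" "\<forall>\<^sub>F n in sequentially. \<forall>u\<in>carrier_vec r. \<bar>u \<bullet> (X n *\<^sub>v u) - u \<bullet> (B *\<^sub>v u)\<bar> \<le> C * \<eta> n * (u \<bullet> u)"
    using approx_mat_form[OF X \<eta>] by auto
  obtain c where c: "c > 0" "\<And>y. y \<in> carrier_vec r \<Longrightarrow> c * (y \<bullet> y) \<le> y \<bullet> (B *\<^sub>v y)"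
    using pos_def_coercive[OF B] by blast
  have "\<forall>\<^sub>F n in sequentially. \<forall>u\<in>carrier_vec r.
    \<bar>y n u \<bullet> (X n *\<^sub>v y n u) - y n u \<bullet> (B *\<^sub>v y n u)\<bar> \<le> C / c * \<eta> n * (y n u \<bullet> (B *\<^sub>v y n u))"
    using C(2) y
  proof eventually_elim
    case (elim n)
    show ?case
    proof
      fix u :: rvec assume "u \<in> carrier_vec r"
      then have yn: "y n u \<in> carrier_vec r" using elim by blast
      have "\<bar>y n u \<bullet> (X n *\<^sub>v y n u) - y n u \<bullet> (B *\<^sub>v y n u)\<bar> \<le> C * \<eta> n * (y n u \<bullet> y n u)" using elim yn by blast
      also have "\<dots> = C / c * \<eta> n * (c * (y n u \<bullet> y n u))" using c by simp
      also have "\<dots> \<le> C / c * \<eta> n * (y n u \<bullet> (B *\<^sub>v y n u))"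
        using c(2)[OF yn] C(1) c(1) \<eta>[of n] by (intro mult_left_mono) auto
      finally show "\<bar>y n u \<bullet> (X n *\<^sub>v y n u) - y n u \<bullet> (B *\<^sub>v y n u)\<bar> \<le> C / c * \<eta> n * (y n u \<bullet> (B *\<^sub>v y n u))" .
    qed
  qed
  then show ?thesis unfolding form_equiv_def using C(1) c(1) by (intro exI[of _ "C / c"]) auto
qed

section \<open>Forms with power-law scales\<close>

text \<open>
  This is \<open>D R\<^sup>* u\<close> with \<open>D = diag(d\<^sub>0, \<dots>, d\<^sub>r\<^sub>-\<^sub>1)\<close>.
\<close>

definition graded_vec :: "nat \<Rightarrow> (nat \<Rightarrow> nat \<Rightarrow> real) \<Rightarrow> (nat \<Rightarrow> rmat) \<Rightarrow> nat \<Rightarrow> rvec \<Rightarrow> rvec" where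
  "graded_vec r d R n u = Matrix.vec r (\<lambda>i. d n i * (transpose_mat (R n) *\<^sub>v u) $ i)"

definition diag_form :: "nat \<Rightarrow> (nat \<Rightarrow> real) \<Rightarrow> (nat \<Rightarrow> nat \<Rightarrow> real) \<Rightarrow> nat \<Rightarrow> rvec \<Rightarrow> real" where
  "diag_form r \<gamma> d n z = (\<Sum>i<r. \<gamma> i * (d n i)\<^sup>2 * (z $ i)\<^sup>2)"

text \<open>
  The form \<open>F\<close> becomes diagonal with weights \<open>\<gamma>\<^sub>i d\<^sub>i\<^sup>2\<close> in the coordinates \<open>Z u\<close>, where \<open>Z\<close> is an
  isometry, both up to a relative error \<open>O(\<eta>)\<close>. The last clause says that the weights are
  eventually in increasing order, as needed to read off ordered eigenvalues.
\<close>

definition diagonal_asymp ::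
  "nat \<Rightarrow> (nat \<Rightarrow> real) \<Rightarrow> (nat \<Rightarrow> nat \<Rightarrow> real) \<Rightarrow> (nat \<Rightarrow> rvec \<Rightarrow> real) \<Rightarrow> (nat \<Rightarrow> rmat) \<Rightarrow> (nat \<Rightarrow> real) \<Rightarrow> bool" where
  "diagonal_asymp r \<eta> d F Z \<gamma> \<longleftrightarrow> (\<forall>i<r. 0 < \<gamma> i) \<and>
     (\<forall>\<^sub>F n in sequentially. Z n \<in> carrier_mat r r) \<and>
     approx_mat r \<eta> (\<lambda>n. transpose_mat (Z n) * Z n) (1\<^sub>m r) \<and>
     form_equiv r \<eta> F (\<lambda>n u. diag_form r \<gamma> d n (Z n *\<^sub>v u)) \<and>
     (\<forall>\<^sub>F n in sequentially. \<forall>q<r. \<forall>i\<le>q. \<gamma> i * (d n i)\<^sup>2 \<le> \<gamma> q * (d n q)\<^sup>2)"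

lemma bigo_cmult: "f \<in> O(g) \<Longrightarrow> (\<lambda>n. c * f n) \<in> O(g)" for f g :: "nat \<Rightarrow> real"
  by (cases "c = 0") auto

lemma pos_def_gram_inverse:
  assumes K: "K \<in> carrier_mat r r" and KK: "pos_def r (transpose_mat K * K)"
  obtains J where "J \<in> carrier_mat r r" "J * K = 1\<^sub>m r" "K * J = 1\<^sub>m r"
proof (rule inverse_of_injective[OF K])
  fix v :: rvec assume v: "v \<in> carrier_vec r" "K *\<^sub>v v = 0\<^sub>v r"
  show "v = 0\<^sub>v r"
  proof (rule ccontr)
    assume "v \<noteq> 0\<^sub>v r"
    then have "0 < v \<bullet> ((transpose_mat K * K) *\<^sub>v v)" using KK v by (auto simp: pos_def_def)
    then show False unfolding gram_form[OF K v(1)] v(2) by simp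
  qed
qed (rule that)

text \<open>
  With a common scale \<open>s\<close> the form is \<open>s\<^sup>2\<close> times that of \<open>R B R\<^sup>*\<close>, which converges to the positive
  definite matrix \<open>L B L\<^sup>*\<close>; \<open>Z\<close> is an orthonormal eigenbasis of the latter, the same for all \<open>n\<close>.
\<close>

lemma graded_form_equal_scales:
  assumes R: "approx_mat r \<eta> R L" and \<eta>: "\<And>n. 0 \<le> \<eta> n" "\<eta> \<in> O(\<lambda>_. 1)"
    and B: "pos_def r B" and LL: "pos_def r (transpose_mat L * L)"
    and d: "\<And>n i. i < r \<Longrightarrow> d n i = s n"
  shows "\<exists>Z \<gamma>. diagonal_asymp r \<eta> d (\<lambda>n u. graded_vec r d R n u \<bullet> (B *\<^sub>v graded_vec r d R n u)) Z \<gamma>"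
proof -
  have L: "L \<in> carrier_mat r r" using R by (simp add: approx_mat_def)
  have Bc: "B \<in> carrier_mat r r" and Bsym: "transpose_mat B = B"
    and Bpos: "\<And>v. v \<in> carrier_vec r \<Longrightarrow> v \<noteq> 0\<^sub>v r \<Longrightarrow> 0 < v \<bullet> (B *\<^sub>v v)"
    using B by (auto simp: pos_def_def)
  obtain J where J: "J \<in> carrier_mat r r" "J * L = 1\<^sub>m r" "L * J = 1\<^sub>m r"
    by (rule pos_def_gram_inverse[OF L LL]) (rule that)
  have LT: "transpose_mat L *\<^sub>v v = 0\<^sub>v r \<Longrightarrow> v = 0\<^sub>v r" if v: "v \<in> carrier_vec r" for v
  proof -
    assume 0: "transpose_mat L *\<^sub>v v = 0\<^sub>v r"
    have "transpose_mat J * transpose_mat L = 1\<^sub>m r" using J L transpose_mult[OF L J(1)] by simp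
    then have "v = transpose_mat J *\<^sub>v (transpose_mat L *\<^sub>v v)"
      using assoc_mult_mat_vec[of "transpose_mat J" r r "transpose_mat L" r v] J L v by simp
    also have "\<dots> = 0\<^sub>v r" unfolding 0 using J by (intro eq_vecI) auto
    finally show "v = 0\<^sub>v r" .
  qed
  define G where "G = L * B * transpose_mat L"
  have Gc: "G \<in> carrier_mat r r" using L Bc by (simp add: G_def)
  have Gform: "u \<bullet> (G *\<^sub>v u) = (transpose_mat L *\<^sub>v u) \<bullet> (B *\<^sub>v (transpose_mat L *\<^sub>v u))"
    if u: "u \<in> carrier_vec r" for u
    using L Bc u transpose_vec_mult_scalar[OF L _ u, of "B *\<^sub>v (transpose_mat L *\<^sub>v u)"]
    by (simp add: G_def assoc_mult_mat_vec[of _ r r _ r])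
  have "transpose_mat G = G" unfolding G_def using L Bc Bsym
    by (simp add: transpose_mult[of _ r r _ r] assoc_mult_mat[of _ r r _ r _ r])
  then have G: "pos_def r G" unfolding pos_def_def using Gc Gform LT Bpos L
    by (metis mult_mat_vec_carrier transpose_carrier_mat)
  have GS: "transpose_mat G = G" by fact
  obtain e :: "nat \<Rightarrow> rvec" where e: "\<And>i. i < r \<Longrightarrow> e i \<in> carrier_vec r"
    and n: "\<And>v. v \<in> carrier_vec r \<Longrightarrow> v \<bullet> v = (\<Sum>i<r. (e i \<bullet> v)\<^sup>2)"
    and f: "\<And>v. v \<in> carrier_vec r \<Longrightarrow> v \<bullet> (G *\<^sub>v v) = (\<Sum>i<r. ord_eigenvalue (Suc i) G * (e i \<bullet> v)\<^sup>2)"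
    and mono: "\<And>i l. i < r \<Longrightarrow> l \<le> i \<Longrightarrow> ord_eigenvalue (Suc l) G \<le> ord_eigenvalue (Suc i) G"
    and e1: "\<And>i l. i < r \<Longrightarrow> l < r \<Longrightarrow> e i \<bullet> e l = (if i = l then 1 else 0)"
    by (rule symmetric_spectral[OF Gc GS]) (rule that)
  define \<gamma> where "\<gamma> i = ord_eigenvalue (Suc i) G" for i
  define E where "E = Matrix.mat r r (\<lambda>(i, k). e i $ k)"
  have Ec: "E \<in> carrier_mat r r" by (simp add: E_def)
  have rowE: "row E i = e i" if "i < r" for i using that e[OF that] by (auto simp: E_def)
  have "E * transpose_mat E = 1\<^sub>m r"
    using Ec rowE e1 by (intro eq_matI) auto
  then have EE: "transpose_mat E * E = 1\<^sub>m r" using mat_mult_left_right_inverse Ec by (metis transpose_carrier_mat)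
  have Eu: "(E *\<^sub>v u) $ i = e i \<bullet> u" if "i < r" for i u using that Ec rowE by simp
  define Gn where "Gn n = R n * B * transpose_mat (R n)" for n
  have Gn: "approx_mat r \<eta> Gn G" unfolding Gn_def G_def
    by (intro approx_mat_mult approx_mat_transpose approx_mat_const R \<eta> Bc)
  have Rc: "\<forall>\<^sub>F n in sequentially. R n \<in> carrier_mat r r" using R by (simp add: approx_mat_def)
  have fe: "form_equiv r \<eta> (\<lambda>n u. u \<bullet> (Gn n *\<^sub>v u)) (\<lambda>n u. u \<bullet> (G *\<^sub>v u))"
    by (rule approx_pos_def_form_equiv[OF Gn G \<eta>(1), where y = "\<lambda>n u. u"]) simp
  obtain C where C: "C \<ge> 0" "\<forall>\<^sub>F n in sequentially. \<forall>u\<in>carrier_vec r.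
      \<bar>u \<bullet> (Gn n *\<^sub>v u) - u \<bullet> (G *\<^sub>v u)\<bar> \<le> C * \<eta> n * (u \<bullet> (G *\<^sub>v u))"
    using fe unfolding form_equiv_def by auto
  have "\<forall>\<^sub>F n in sequentially. \<forall>u\<in>carrier_vec r.
      \<bar>graded_vec r d R n u \<bullet> (B *\<^sub>v graded_vec r d R n u) - diag_form r \<gamma> d n (E *\<^sub>v u)\<bar>
        \<le> C * \<eta> n * diag_form r \<gamma> d n (E *\<^sub>v u)"
    using C(2) Rc
  proof eventually_elim
    case (elim n)
    show ?case
    proof
      fix u :: rvec assume u: "u \<in> carrier_vec r"
      have "graded_vec r d R n u = s n \<cdot>\<^sub>v (transpose_mat (R n) *\<^sub>v u)"
        using elim u d by (intro eq_vecI) (auto simp: graded_vec_def)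
      then have "graded_vec r d R n u \<bullet> (B *\<^sub>v graded_vec r d R n u) =
         (s n)\<^sup>2 * ((transpose_mat (R n) *\<^sub>v u) \<bullet> (B *\<^sub>v (transpose_mat (R n) *\<^sub>v u)))"
        using elim u Bc by (simp add: mult_mat_vec[of _ r r] power2_eq_square)
      also have "(transpose_mat (R n) *\<^sub>v u) \<bullet> (B *\<^sub>v (transpose_mat (R n) *\<^sub>v u)) = u \<bullet> (Gn n *\<^sub>v u)"
        using elim u Bc transpose_vec_mult_scalar[of "R n" r r "B *\<^sub>v (transpose_mat (R n) *\<^sub>v u)" u]
        by (simp add: Gn_def assoc_mult_mat_vec[of _ r r _ r])
      finally have 1: "graded_vec r d R n u \<bullet> (B *\<^sub>v graded_vec r d R n u) = (s n)\<^sup>2 * (u \<bullet> (Gn n *\<^sub>v u))" .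
      have 2: "diag_form r \<gamma> d n (E *\<^sub>v u) = (s n)\<^sup>2 * (u \<bullet> (G *\<^sub>v u))"
        unfolding f[OF u] diag_form_def sum_distrib_left using Eu d
        by (intro sum.cong) (auto simp: \<gamma>_def)
      have "(s n)\<^sup>2 * \<bar>u \<bullet> (Gn n *\<^sub>v u) - u \<bullet> (G *\<^sub>v u)\<bar> \<le> (s n)\<^sup>2 * (C * \<eta> n * (u \<bullet> (G *\<^sub>v u)))"
        using elim u by (intro mult_left_mono) auto
      then show "\<bar>graded_vec r d R n u \<bullet> (B *\<^sub>v graded_vec r d R n u) - diag_form r \<gamma> d n (E *\<^sub>v u)\<bar>
        \<le> C * \<eta> n * diag_form r \<gamma> d n (E *\<^sub>v u)"
        unfolding 1 2 right_diff_distrib[symmetric] abs_mult abs_power2 by (simp add: mult_ac)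
    qed
  qed
  then have "form_equiv r \<eta> (\<lambda>n u. graded_vec r d R n u \<bullet> (B *\<^sub>v graded_vec r d R n u)) (\<lambda>n u. diag_form r \<gamma> d n (E *\<^sub>v u))"
    unfolding form_equiv_def using C(1) by blast
  moreover have "\<forall>i<r. 0 < \<gamma> i" using pos_def_ord_eigenvalue[OF G] by (simp add: \<gamma>_def)
  moreover have "approx_mat r \<eta> (\<lambda>n. transpose_mat E * E) (1\<^sub>m r)" unfolding EE by (rule approx_mat_const) simp
  moreover have "\<forall>n. \<forall>q<r. \<forall>i\<le>q. \<gamma> i * (d n i)\<^sup>2 \<le> \<gamma> q * (d n q)\<^sup>2"
    using d mono by (auto simp: \<gamma>_def intro!: mult_right_mono)
  ultimately have "diagonal_asymp r \<eta> d (\<lambda>n u. graded_vec r d R n u \<bullet> (B *\<^sub>v graded_vec r d R n u)) (\<lambda>_. E) \<gamma>"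
    unfolding diagonal_asymp_def using Ec by simp
  then show ?thesis by blast
qed

text \<open>
  Factor \<open>B = M\<^sup>* M\<close> and \<open>L\<^sup>* L = K\<^sup>* K\<close> with \<open>M\<close>, \<open>K\<close> lower triangular, so that the form is
  \<open>\<parallel>M D R\<^sup>* u\<parallel>\<^sup>2\<close>. Then \<open>M D = D diag(M) C\<close> with \<open>C = I + O(\<eta>)\<close>. Setting \<open>z = Z u = K\<^bsup>-*\<^esup> C R\<^sup>* u\<close> gives
  \<open>M D R\<^sup>* u = diag(M) D K\<^sup>* z = N (D z)\<close>, where \<open>N\<close> is upper triangular with entries above the
  diagonal again damped by ratios \<open>d\<^sub>l / d\<^sub>k\<close>, so \<open>N\<close> is diagonal up to \<open>O(\<eta>)\<close>. Finally \<open>Z\<close> tends to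
  \<open>K\<^bsup>-*\<^esup> L\<^sup>*\<close>, which is orthogonal since \<open>K\<^sup>* K = L\<^sup>* L\<close>.
\<close>

lemma graded_form_separated_scales:
  assumes R: "approx_mat r \<eta> R L" and \<eta>: "\<And>n. 0 \<le> \<eta> n" "\<eta> \<longlonglongrightarrow> 0"
    and B: "pos_def r B" and LL: "pos_def r (transpose_mat L * L)"
    and d: "\<And>n i. i < r \<Longrightarrow> 0 < d n i"
    and sep: "\<And>i k. i < k \<Longrightarrow> k < r \<Longrightarrow> (\<lambda>n. d n i / d n k) \<in> O(\<eta>)"
  shows "\<exists>Z \<gamma>. diagonal_asymp r \<eta> d (\<lambda>n u. graded_vec r d R n u \<bullet> (B *\<^sub>v graded_vec r d R n u)) Z \<gamma>"
proof -
  have \<eta>1: "\<eta> \<in> O(\<lambda>_. 1)" using \<eta>(2) by (intro bigoI_tendsto[where c = 0]) auto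
  have L: "L \<in> carrier_mat r r" using R by (simp add: approx_mat_def)
  have Bc: "B \<in> carrier_mat r r" using B by (simp add: pos_def_def)
  have Rc: "\<forall>\<^sub>F n in sequentially. R n \<in> carrier_mat r r" using R by (simp add: approx_mat_def)
  obtain M where M: "M \<in> carrier_mat r r" "\<And>i. i < r \<Longrightarrow> 0 < M $$ (i, i)"
    "\<And>l i. l < r \<Longrightarrow> i < r \<Longrightarrow> l < i \<Longrightarrow> M $$ (l, i) = 0" "B = transpose_mat M * M"
    by (rule lower_cholesky[OF B]) (rule that)
  obtain K where K: "K \<in> carrier_mat r r" "\<And>i. i < r \<Longrightarrow> 0 < K $$ (i, i)"
    "\<And>l i. l < r \<Longrightarrow> i < r \<Longrightarrow> l < i \<Longrightarrow> K $$ (l, i) = 0" "transpose_mat L * L = transpose_mat K * K"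
    by (rule lower_cholesky[OF LL]) (rule that)
  obtain J where J: "J \<in> carrier_mat r r" "J * K = 1\<^sub>m r" "K * J = 1\<^sub>m r"
    by (rule pos_def_gram_inverse[OF K(1) LL[unfolded K(4)]]) (rule that)
  have JK: "transpose_mat K * transpose_mat J = 1\<^sub>m r" "transpose_mat J * transpose_mat K = 1\<^sub>m r"
    unfolding transpose_mult[OF J(1) K(1), symmetric] transpose_mult[OF K(1) J(1), symmetric] J(2,3) by simp_all
  have dn: "d n i \<noteq> 0" if "i < r" for n i using d[OF that, of n] by simp
  define c where "c n = Matrix.mat r r (\<lambda>(l, i). M $$ (l, i) / M $$ (l, l) * (d n i / d n l))" for n
  have c: "approx_mat r \<eta> c (1\<^sub>m r)"
  proof -
    have "(\<lambda>n. c n $$ (l, i) - 1\<^sub>m r $$ (l, i)) \<in> O(\<eta>)" if li: "l < r" "i < r" for l i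
    proof -
      consider "l = i" | "l < i" | "i < l" by linarith
      then show ?thesis
      proof cases
        case 1 then show ?thesis using li M(2)[of i] d[OF li(2)] by (simp add: c_def less_imp_neq[symmetric])
      next
        case 2 then show ?thesis using li M(3) by (simp add: c_def)
      next
        case 3
        have "c n $$ (l, i) - 1\<^sub>m r $$ (l, i) = M $$ (l, i) / M $$ (l, l) * (d n i / d n l)" for n
          using 3 li by (simp add: c_def)
        then show ?thesis by (simp only:) (rule bigo_cmult[OF sep[OF 3 li(1)]])
      qed
    qed
    then show ?thesis by (auto simp: approx_mat_def c_def)
  qed
  define Z where "Z n = transpose_mat J * (c n * transpose_mat (R n))" for n
  define Z0 where "Z0 = transpose_mat J * (1\<^sub>m r * transpose_mat L)"
  have cc: "c n \<in> carrier_mat r r" for n by (simp add: c_def)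
  have Z: "approx_mat r \<eta> Z Z0" unfolding Z_def Z0_def
    by (intro approx_mat_mult approx_mat_transpose approx_mat_const R \<eta>1 c) (use J in auto)
  have Zc: "\<forall>\<^sub>F n in sequentially. Z n \<in> carrier_mat r r" using Z by (simp add: approx_mat_def)
  have "Z0 * (L * J) = transpose_mat J * (transpose_mat K * K) * J"
    unfolding Z0_def K(4)[symmetric] using J L
    by (simp add: assoc_mult_mat[of _ r r _ r _ r])
  also have "\<dots> = (transpose_mat J * transpose_mat K) * (K * J)"
    using J K(1) by (simp add: assoc_mult_mat[of _ r r _ r _ r])
  also have "\<dots> = 1\<^sub>m r" using JK J by simp
  finally have "(L * J) * Z0 = 1\<^sub>m r"
    by (rule mat_mult_left_right_inverse[rotated 2]) (use J L in \<open>auto simp: Z0_def\<close>)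
  moreover have "transpose_mat Z0 = L * J" unfolding Z0_def using J L
    by (simp add: transpose_mult[of _ r r _ r])
  ultimately have ZZ: "approx_mat r \<eta> (\<lambda>n. transpose_mat (Z n) * Z n) (1\<^sub>m r)"
    using approx_mat_mult[OF approx_mat_transpose[OF Z] Z \<eta>1] by simp
  define N where "N n = Matrix.mat r r (\<lambda>(l, k). M $$ (l, l) * K $$ (k, l) * (d n l / d n k))" for n
  define N0 where "N0 = mat_diag r (\<lambda>l. M $$ (l, l) * K $$ (l, l))"
  have N: "approx_mat r \<eta> N N0"
  proof -
    have "(\<lambda>n. N n $$ (l, k) - N0 $$ (l, k)) \<in> O(\<eta>)" if lk: "l < r" "k < r" for l k
    proof -
      consider "l = k" | "k < l" | "l < k" by linarith
      then show ?thesis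
      proof cases
        case 1 then show ?thesis using lk d[OF lk(2)] by (simp add: N_def N0_def mat_diag_def less_imp_neq[symmetric])
      next
        case 2 then show ?thesis using lk K(3) by (simp add: N_def N0_def mat_diag_def)
      next
        case 3
        have "N n $$ (l, k) - N0 $$ (l, k) = M $$ (l, l) * K $$ (k, l) * (d n l / d n k)" for n
          using 3 lk by (simp add: N_def N0_def mat_diag_def)
        then show ?thesis by (simp only:) (rule bigo_cmult[OF sep[OF 3 lk(2)]])
      qed
    qed
    then show ?thesis by (auto simp: approx_mat_def N_def N0_def)
  qed
  define \<gamma> where "\<gamma> l = (M $$ (l, l) * K $$ (l, l))\<^sup>2" for l
  have \<gamma>: "0 < \<gamma> l" if "l < r" for l
  proof -
    have "0 < M $$ (l, l) * K $$ (l, l)" using M(2)[OF that] K(2)[OF that] by (rule mult_pos_pos)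
    then show ?thesis unfolding \<gamma>_def by (rule zero_less_power)
  qed
  have NN: "approx_mat r \<eta> (\<lambda>n. transpose_mat (N n) * N n) (transpose_mat N0 * N0)"
    by (intro approx_mat_mult approx_mat_transpose N \<eta>1)
  have N0c: "N0 \<in> carrier_mat r r" by (simp add: N0_def)
  have N0v: "(N0 *\<^sub>v x) $ l = M $$ (l, l) * K $$ (l, l) * x $ l" if "l < r" "x \<in> carrier_vec r" for l x
  proof -
    have "(N0 *\<^sub>v x) $ l = (\<Sum>k<r. (if l = k then M $$ (l, l) * K $$ (l, l) else 0) * x $ k)"
      using that by (auto simp add: N0_def mat_diag_def scalar_prod_def atLeast0LessThan intro!: sum.cong)
    also have "\<dots> = (\<Sum>k<r. if l = k then M $$ (l, l) * K $$ (l, l) * x $ k else 0)" by (intro sum.cong) auto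
    also have "\<dots> = M $$ (l, l) * K $$ (l, l) * x $ l" using that by simp
    finally show ?thesis .
  qed
  have N0form: "x \<bullet> ((transpose_mat N0 * N0) *\<^sub>v x) = (\<Sum>l<r. \<gamma> l * (x $ l)\<^sup>2)" if "x \<in> carrier_vec r" for x
    unfolding gram_form[OF N0c that] using that N0v[OF _ that] N0c
    by (auto simp: scalar_prod_def atLeast0LessThan \<gamma>_def power2_eq_square mult_ac intro!: sum.cong)
  have N0pos: "pos_def r (transpose_mat N0 * N0)"
    unfolding pos_def_def
  proof (intro conjI ballI impI)
    fix v :: rvec assume v: "v \<in> carrier_vec r" "v \<noteq> 0\<^sub>v r"
    then obtain l where l: "l < r" "v $ l \<noteq> 0" by (metis carrier_vecD eq_vecI index_zero_vec)
    have "0 < \<gamma> l * (v $ l)\<^sup>2" using \<gamma> l by simp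
    also have "\<dots> \<le> (\<Sum>l<r. \<gamma> l * (v $ l)\<^sup>2)"
      using l \<gamma> by (intro member_le_sum) (auto simp: less_imp_le)
    finally show "0 < v \<bullet> ((transpose_mat N0 * N0) *\<^sub>v v)" using N0form[OF v(1)] by simp
  qed (use N0c in \<open>auto simp: transpose_mult[of _ r r _ r]\<close>)
  define \<zeta> where "\<zeta> n u = Matrix.vec r (\<lambda>k. d n k * (Z n *\<^sub>v u) $ k)" for n u
  have fe: "form_equiv r \<eta> (\<lambda>n u. \<zeta> n u \<bullet> ((transpose_mat (N n) * N n) *\<^sub>v \<zeta> n u))
     (\<lambda>n u. \<zeta> n u \<bullet> ((transpose_mat N0 * N0) *\<^sub>v \<zeta> n u))"
    by (rule approx_pos_def_form_equiv[OF NN N0pos \<eta>(1)]) (simp add: \<zeta>_def)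
  have 2: "\<zeta> n u \<bullet> ((transpose_mat N0 * N0) *\<^sub>v \<zeta> n u) = diag_form r \<gamma> d n (Z n *\<^sub>v u)" for n u
    by (subst N0form) (auto simp: \<zeta>_def diag_form_def power_mult_distrib mult_ac)
  have 1: "graded_vec r d R n u \<bullet> (B *\<^sub>v graded_vec r d R n u) = \<zeta> n u \<bullet> ((transpose_mat (N n) * N n) *\<^sub>v \<zeta> n u)"
    if Rn: "R n \<in> carrier_mat r r" and u: "u \<in> carrier_vec r" for n u
  proof -
    define x where "x = transpose_mat (R n) *\<^sub>v u"
    define z where "z = Z n *\<^sub>v u"
    have x: "x \<in> carrier_vec r" using Rn u by (simp add: x_def)
    have RT: "transpose_mat (R n) \<in> carrier_mat r r" and JT: "transpose_mat J \<in> carrier_mat r r" using Rn J by auto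
    have z: "z \<in> carrier_vec r" unfolding z_def Z_def
      by (rule mult_mat_vec_carrier[OF mult_carrier_mat[OF JT mult_carrier_mat[OF cc RT]] u])
    have y: "graded_vec r d R n u \<in> carrier_vec r" by (simp add: graded_vec_def)
    have Kz: "transpose_mat K *\<^sub>v z = c n *\<^sub>v x"
    proof -
      have "z = transpose_mat J *\<^sub>v (c n *\<^sub>v x)"
        unfolding z_def Z_def x_def assoc_mult_mat_vec[OF JT mult_carrier_mat[OF cc RT] u]
          assoc_mult_mat_vec[OF cc RT u] ..
      then have "transpose_mat K *\<^sub>v z = (transpose_mat K * transpose_mat J) *\<^sub>v (c n *\<^sub>v x)"
        using assoc_mult_mat_vec[OF _ JT mult_mat_vec_carrier[OF cc x], of "transpose_mat K"] K(1) by simp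
      then show ?thesis unfolding JK(1) using one_mult_mat_vec[OF mult_mat_vec_carrier[OF cc x]] by simp
    qed
    have "(M *\<^sub>v graded_vec r d R n u) $ l = (N n *\<^sub>v \<zeta> n u) $ l" if l: "l < r" for l
    proof -
      have "(M *\<^sub>v graded_vec r d R n u) $ l = (\<Sum>i<r. M $$ (l, i) * (d n i * x $ i))"
        using l M(1) by (simp add: scalar_prod_def atLeast0LessThan graded_vec_def x_def)
      also have "\<dots> = d n l * M $$ (l, l) * (\<Sum>i<r. c n $$ (l, i) * x $ i)"
        unfolding sum_distrib_left using l M(2)[OF l] dn[OF l] by (intro sum.cong) (auto simp: c_def)
      also have "(\<Sum>i<r. c n $$ (l, i) * x $ i) = (c n *\<^sub>v x) $ l"
        using l x by (simp add: c_def scalar_prod_def atLeast0LessThan)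
      also have "c n *\<^sub>v x = transpose_mat K *\<^sub>v z" using Kz ..
      also have "(transpose_mat K *\<^sub>v z) $ l = (\<Sum>k<r. K $$ (k, l) * z $ k)"
        using l K(1) carrier_vecD[OF z] by (simp add: scalar_prod_def atLeast0LessThan)
      also have "d n l * M $$ (l, l) * (\<Sum>k<r. K $$ (k, l) * z $ k) = (\<Sum>k<r. N n $$ (l, k) * (d n k * z $ k))"
        unfolding sum_distrib_left using l dn by (intro sum.cong) (auto simp: N_def)
      also have "\<dots> = (N n *\<^sub>v \<zeta> n u) $ l"
        using l by (simp add: N_def \<zeta>_def z_def scalar_prod_def atLeast0LessThan)
      finally show ?thesis .
    qed
    then have "M *\<^sub>v graded_vec r d R n u = N n *\<^sub>v \<zeta> n u"
      using M(1) by (intro eq_vecI) (auto simp: N_def)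
    then show ?thesis unfolding M(4) gram_form[OF M(1) y]
      by (subst gram_form[of _ r r]) (auto simp: N_def \<zeta>_def)
  qed
  have "form_equiv r \<eta> (\<lambda>n u. graded_vec r d R n u \<bullet> (B *\<^sub>v graded_vec r d R n u)) (\<lambda>n u. diag_form r \<gamma> d n (Z n *\<^sub>v u))"
  proof -
    obtain C where C: "C \<ge> 0" "\<forall>\<^sub>F n in sequentially. \<forall>u\<in>carrier_vec r.
      \<bar>\<zeta> n u \<bullet> ((transpose_mat (N n) * N n) *\<^sub>v \<zeta> n u) - diag_form r \<gamma> d n (Z n *\<^sub>v u)\<bar> \<le> C * \<eta> n * diag_form r \<gamma> d n (Z n *\<^sub>v u)"
      using fe unfolding form_equiv_def 2 by auto
    show ?thesis unfolding form_equiv_def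
      using C(1) eventually_conj[OF C(2) Rc] 1 by (intro exI[of _ C]) (auto elim!: eventually_mono)
  qed
  moreover have "\<forall>\<^sub>F n in sequentially. \<forall>q<r. \<forall>i\<le>q. \<gamma> i * (d n i)\<^sup>2 \<le> \<gamma> q * (d n q)\<^sup>2"
  proof -
    have "\<forall>\<^sub>F n in sequentially. \<gamma> i * (d n i)\<^sup>2 \<le> \<gamma> q * (d n q)\<^sup>2" if "q < r" "i \<le> q" for q i
    proof (cases "i = q")
      case False
      then have iq: "i < q" using that by simp
      have "(\<lambda>n. d n i / d n q) \<longlonglongrightarrow> 0"
        using smalloD_tendsto[OF landau_o.big_small_trans[OF sep[OF iq that(1)]
              smalloI_tendsto[of \<eta> "\<lambda>_. 1"]]] \<eta>(2) by simp
      then have "(\<lambda>n. (d n i / d n q)\<^sup>2) \<longlonglongrightarrow> 0\<^sup>2" by (rule tendsto_power)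
      then have "\<forall>\<^sub>F n in sequentially. (d n i / d n q)\<^sup>2 < \<gamma> q / \<gamma> i"
        using \<gamma>[OF that(1)] \<gamma>[of i] that by (intro order_tendstoD(2)[of _ 0]) auto
      then show ?thesis
      proof eventually_elim
        case (elim n)
        then show ?case using d[OF that(1), of n] \<gamma>[of i] that by (simp add: field_simps power_divide)
      qed
    qed simp
    then have "\<forall>\<^sub>F n in sequentially. \<forall>q\<in>{..<r}. \<forall>i\<in>{..q}. \<gamma> i * (d n i)\<^sup>2 \<le> \<gamma> q * (d n q)\<^sup>2"
      by (intro eventually_ball_finite ballI) auto
    then show ?thesis by (rule eventually_mono) auto
  qed
  ultimately have "diagonal_asymp r \<eta> d (\<lambda>n u. graded_vec r d R n u \<bullet> (B *\<^sub>v graded_vec r d R n u)) Z \<gamma>"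
    unfolding diagonal_asymp_def using \<gamma> Zc ZZ by simp
  then show ?thesis by blast
qed

section \<open>Top eigenvalues of a sandwiched sequence\<close>

lemma bessel:
  fixes Q :: rmat
  assumes Q: "Q \<in> carrier_mat p r" "transpose_mat Q * Q = 1\<^sub>m r" and v: "v \<in> carrier_vec p"
  shows "(transpose_mat Q *\<^sub>v v) \<bullet> (transpose_mat Q *\<^sub>v v) \<le> v \<bullet> v"
proof -
  define u where "u = transpose_mat Q *\<^sub>v v"
  have u: "u \<in> carrier_vec r" using Q v by (simp add: u_def)
  have Qu: "Q *\<^sub>v u \<in> carrier_vec p" using Q u by simp
  have 1: "(Q *\<^sub>v u) \<bullet> (Q *\<^sub>v u) = u \<bullet> u" using gram_form[OF Q(1) u] Q u by simp
  have 2: "v \<bullet> (Q *\<^sub>v u) = u \<bullet> u"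
    using transpose_vec_mult_scalar[OF Q(1) u v] by (simp add: u_def)
  have "0 \<le> (v - Q *\<^sub>v u) \<bullet> (v - Q *\<^sub>v u)" by (rule scalar_prod_self_nonneg)
  also have "\<dots> = v \<bullet> v - u \<bullet> u"
    using v Qu 1 2 comm_scalar_prod[OF v Qu]
    by (simp add: scalar_prod_minus_distrib[where n=p] minus_scalar_prod_distrib[where n=p])
  finally show ?thesis by (simp add: u_def)
qed

lemma one_plus_prod_le:
  fixes a b c x :: real
  assumes "0 \<le> a" "0 \<le> b" "0 \<le> c" "0 \<le> x" "x \<le> 1"
  shows "(1 + a * x) * ((1 + b * x) * (1 + c * x)) \<le> 1 + ((1 + a) * (1 + b) * (1 + c) - 1) * x"
proof -
  have "x * x \<le> x" "x * x * x \<le> x" using assms by (auto simp: mult_left_le mult_le_one mult_left_le_one_le)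
  then have "(a * b + a * c + b * c) * (x * x) \<le> (a * b + a * c + b * c) * x"
    "a * b * c * (x * x * x) \<le> a * b * c * x"
    using assms by (auto intro!: mult_left_mono)
  then show ?thesis by (simp add: algebra_simps)
qed

lemma one_minus_prod_ge:
  fixes a b c x :: real
  assumes "0 \<le> a" "0 \<le> b" "0 \<le> c" "0 \<le> x" "a * x \<le> 1"
  shows "1 - (a + b + c) * x \<le> (1 - a * x) * ((1 - b * x) * (1 - c * x))"
proof -
  have 1: "(1 - b * x) * (1 - c * x) \<ge> 1 - (b + c) * x"
    using assms by (simp add: algebra_simps)
  have "(1 - a * x) * (1 - (b + c) * x) \<le> (1 - a * x) * ((1 - b * x) * (1 - c * x))"
    using 1 assms by (intro mult_left_mono) auto
  moreover have "1 - (a + b + c) * x \<le> (1 - a * x) * (1 - (b + c) * x)"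
    using assms by (simp add: algebra_simps)
  ultimately show ?thesis by linarith
qed

text \<open>
  Both bounds are applications of the min-max principle with test vectors constrained in the
  coordinates \<open>z = Z Q\<^sup>* v\<close>: if \<open>z\<^sub>i = 0\<close> for \<open>i \<ge> q\<close> then the diagonal form is at most its \<open>q\<close>-th weight
  times \<open>\<parallel>z\<parallel>\<^sup>2\<close>, and if \<open>z\<^sub>i = 0\<close> for \<open>i < q - 1\<close> (and \<open>v\<close> is in the range of \<open>Q\<close>) it is at least that
  (coordinates count from 0, eigenvalues from 1). The additive error \<open>e\<close> shifts an eigenvalue by
  at most \<open>e\<close>.
\<close>

lemma top_eigenvalue_asymptotics:
  fixes S :: "nat \<Rightarrow> rmat"
  assumes dia: "diagonal_asymp r \<eta> d F Z \<gamma>" and \<eta>: "\<And>n. 0 \<le> \<eta> n" "\<eta> \<longlonglongrightarrow> 0"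
    and S: "\<forall>\<^sub>F n in sequentially. S n \<in> carrier_mat (p n) (p n) \<and> transpose_mat (S n) = S n"
    and Q: "\<forall>\<^sub>F n in sequentially. Q n \<in> carrier_mat (p n) r \<and> transpose_mat (Q n) * Q n = 1\<^sub>m r \<and> r \<le> p n"
    and upper: "\<forall>\<^sub>F n in sequentially. \<forall>v\<in>carrier_vec (p n).
        v \<bullet> (S n *\<^sub>v v) \<le> (1 + a * \<eta> n) * F n (transpose_mat (Q n) *\<^sub>v v) + e n * (v \<bullet> v)"
    and lower: "\<forall>\<^sub>F n in sequentially. \<forall>u\<in>carrier_vec r.
        (1 - a * \<eta> n) * F n u - e n * (u \<bullet> u) \<le> (Q n *\<^sub>v u) \<bullet> (S n *\<^sub>v (Q n *\<^sub>v u))"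
    and a: "0 \<le> a" and d: "\<And>n i. i < r \<Longrightarrow> 0 < d n i" and e0: "\<And>n. 0 \<le> e n"
    and e: "\<And>i. i < r \<Longrightarrow> (\<lambda>n. e n / (d n i)\<^sup>2) \<in> O(\<eta>)"
    and q: "1 \<le> q" "q \<le> r"
  shows "(\<lambda>n. ord_eigenvalue (p n - r + q) (S n) / (d n (q - 1))\<^sup>2 - \<gamma> (q - 1)) \<in> O(\<eta>)"
proof -
  define m where "m = q - 1"
  have m: "m < r" "q = Suc m" using q by (auto simp: m_def)
  have \<gamma>: "\<And>i. i < r \<Longrightarrow> 0 < \<gamma> i"
    and Zc: "\<forall>\<^sub>F n in sequentially. Z n \<in> carrier_mat r r"
    and ZZ: "approx_mat r \<eta> (\<lambda>n. transpose_mat (Z n) * Z n) (1\<^sub>m r)"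
    and FE: "form_equiv r \<eta> F (\<lambda>n u. diag_form r \<gamma> d n (Z n *\<^sub>v u))"
    and mono: "\<forall>\<^sub>F n in sequentially. \<forall>q<r. \<forall>i\<le>q. \<gamma> i * (d n i)\<^sup>2 \<le> \<gamma> q * (d n q)\<^sup>2"
    using dia unfolding diagonal_asymp_def by auto
  obtain C1 where C1: "C1 \<ge> 0" "\<forall>\<^sub>F n in sequentially. \<forall>u\<in>carrier_vec r.
     \<bar>F n u - diag_form r \<gamma> d n (Z n *\<^sub>v u)\<bar> \<le> C1 * \<eta> n * diag_form r \<gamma> d n (Z n *\<^sub>v u)"
    using FE unfolding form_equiv_def by auto
  obtain C2 where C2: "C2 \<ge> 0" "\<forall>\<^sub>F n in sequentially. \<forall>u\<in>carrier_vec r.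
     \<bar>u \<bullet> ((transpose_mat (Z n) * Z n) *\<^sub>v u) - u \<bullet> (1\<^sub>m r *\<^sub>v u)\<bar> \<le> C2 * \<eta> n * (u \<bullet> u)"
    using approx_mat_form[OF ZZ \<eta>(1)] by auto
  obtain C3 where C3: "C3 > 0" "\<forall>\<^sub>F n in sequentially. norm (e n / (d n m)\<^sup>2) \<le> C3 * norm (\<eta> n)"
    using e[OF m(1)] by (rule landau_o.bigE)
  define K where "K = (1 + a) * (1 + C1) * (1 + C2) - 1"
  define K' where "K' = a + C1 + C2"
  have small: "\<forall>\<^sub>F n in sequentially. c * \<eta> n < 1" for c
    using order_tendstoD(2)[OF tendsto_mult_right_zero[OF \<eta>(2)], of 1 c] by simp
  have "\<forall>\<^sub>F n in sequentially. norm (ord_eigenvalue (p n - r + q) (S n) / (d n m)\<^sup>2 - \<gamma> m)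
      \<le> (\<gamma> m * (\<bar>K\<bar> + K') + C3) * norm (\<eta> n)"
    using S Q upper lower Zc C1(2) C2(2) C3(2) mono small[of 1] small[of a] small[of C1]
  proof eventually_elim
    case (elim n)
    define D where "D = (d n m)\<^sup>2"
    have D: "D > 0" using d[OF m(1), of n] by (simp add: D_def)
    define z where "z u = Z n *\<^sub>v u" for u
    define df where "df u = diag_form r \<gamma> d n (z u)" for u
    have Sn: "S n \<in> carrier_mat (p n) (p n)" "transpose_mat (S n) = S n"
      and Qn: "Q n \<in> carrier_mat (p n) r" "transpose_mat (Q n) * Q n = 1\<^sub>m r" and rp: "r \<le> p n"
      and Zn: "Z n \<in> carrier_mat r r" using elim by auto
    have rc: "row (Z n) i \<in> carrier_vec r" for i using row_carrier[of "Z n" i] carrier_matD(2)[OF Zn] by simp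
    have zc: "z u \<in> carrier_vec r" if "u \<in> carrier_vec r" for u using that Zn by (simp add: z_def)
    have zz: "\<bar>z u \<bullet> z u - u \<bullet> u\<bar> \<le> C2 * \<eta> n * (u \<bullet> u)" if "u \<in> carrier_vec r" for u
      using elim(7) that gram_form[OF Zn that] by (auto simp: z_def)
    have zsum: "z u \<bullet> z u = (\<Sum>i<r. (z u $ i)\<^sup>2)" if "u \<in> carrier_vec r" for u
      using carrier_vecD[OF zc[OF that]] by (simp add: scalar_prod_def atLeast0LessThan power2_eq_square)
    have Fdf: "\<bar>F n u - df u\<bar> \<le> C1 * \<eta> n * df u" if "u \<in> carrier_vec r" for u
      using elim(6) that by (auto simp: df_def z_def)
    have \<gamma>m: "\<gamma> m > 0" using \<gamma> m by simp
    have eD: "e n = (e n / D) * D" using D by simp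
    have e3: "e n / D \<le> C3 * \<eta> n" using elim(8) \<eta>(1)[of n] e0[of n] by (simp add: D_def)
    have ord1: "ord_eigenvalue (p n - r + q) (S n) \<le> (1 + a * \<eta> n) * ((1 + C1 * \<eta> n) * (1 + C2 * \<eta> n)) * (\<gamma> m * D) + e n"
    proof (rule ord_eigenvalue_le[OF Sn, where g = "\<lambda>i. Q n *\<^sub>v row (Z n) (q + i)"])
      show "1 \<le> p n - r + q" "p n - r + q \<le> p n" using q rp by auto
      show "Q n *\<^sub>v row (Z n) (q + i) \<in> carrier_vec (p n)" if "i < p n - (p n - r + q)" for i
        using Qn(1) rc by (rule mult_mat_vec_carrier)
      fix v :: rvec assume v: "v \<in> carrier_vec (p n)"
        and orth: "\<forall>i<p n - (p n - r + q). (Q n *\<^sub>v row (Z n) (q + i)) \<bullet> v = 0"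
      define u where "u = transpose_mat (Q n) *\<^sub>v v"
      have u: "u \<in> carrier_vec r" using Qn v by (simp add: u_def)
      have z0: "z u $ i = 0" if i: "i < r" "m < i" for i
      proof -
        have "i - q < p n - (p n - r + q)" "q + (i - q) = i" using i m q rp by auto
        then have "(Q n *\<^sub>v row (Z n) i) \<bullet> v = 0" using orth by metis
        then have "row (Z n) i \<bullet> u = 0"
          using transpose_vec_mult_scalar[OF Qn(1) rc v, of i] comm_scalar_prod[OF v mult_mat_vec_carrier[OF Qn(1) rc], of i]
            comm_scalar_prod[OF u rc, of i] by (simp add: u_def)
        then show ?thesis using i Zn by (simp add: z_def)
      qed
      have "df u \<le> (\<Sum>i<r. \<gamma> m * D * (z u $ i)\<^sup>2)"
        unfolding df_def diag_form_def
      proof (intro sum_mono)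
        fix i assume "i \<in> {..<r}"
        then show "\<gamma> i * (d n i)\<^sup>2 * (z u $ i)\<^sup>2 \<le> \<gamma> m * D * (z u $ i)\<^sup>2"
          using z0[of i] elim(9) m(1) by (cases "m < i") (auto simp: D_def intro!: mult_right_mono)
      qed
      also have "\<dots> = \<gamma> m * D * (z u \<bullet> z u)" by (simp add: zsum[OF u] sum_distrib_left)
      also have "\<dots> \<le> \<gamma> m * D * ((1 + C2 * \<eta> n) * (u \<bullet> u))"
        using zz[OF u] \<gamma>m D by (intro mult_left_mono) (auto simp: algebra_simps abs_le_iff)
      also have "\<dots> \<le> \<gamma> m * D * ((1 + C2 * \<eta> n) * (v \<bullet> v))"
        using bessel[OF Qn v] \<gamma>m D C2(1) \<eta>(1)[of n] by (intro mult_left_mono) (auto simp: u_def)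
      finally have dfu: "df u \<le> \<gamma> m * D * ((1 + C2 * \<eta> n) * (v \<bullet> v))" .
      have "F n u \<le> (1 + C1 * \<eta> n) * df u" using Fdf[OF u] by (simp add: algebra_simps abs_le_iff)
      also have "\<dots> \<le> (1 + C1 * \<eta> n) * (\<gamma> m * D * ((1 + C2 * \<eta> n) * (v \<bullet> v)))"
        using dfu C1(1) \<eta>(1)[of n] by (intro mult_left_mono) auto
      finally have "(1 + a * \<eta> n) * F n u \<le> (1 + a * \<eta> n) * ((1 + C1 * \<eta> n) * (\<gamma> m * D * ((1 + C2 * \<eta> n) * (v \<bullet> v))))"
        using a \<eta>(1)[of n] by (intro mult_left_mono) auto
      moreover have "v \<bullet> (S n *\<^sub>v v) \<le> (1 + a * \<eta> n) * F n u + e n * (v \<bullet> v)"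
        using elim(3) v by (auto simp: u_def)
      ultimately show "v \<bullet> (S n *\<^sub>v v) \<le> ((1 + a * \<eta> n) * ((1 + C1 * \<eta> n) * (1 + C2 * \<eta> n)) * (\<gamma> m * D) + e n) * (v \<bullet> v)"
        by (simp add: algebra_simps)
    qed
    have ord2: "(1 - a * \<eta> n) * ((1 - C1 * \<eta> n) * (1 - C2 * \<eta> n)) * (\<gamma> m * D) - e n \<le> ord_eigenvalue (p n - r + q) (S n)"
    proof (rule ord_eigenvalue_ge[OF Sn Qn q rp, where g = "\<lambda>i. row (Z n) i"])
      show "row (Z n) i \<in> carrier_vec r" if "i < q - 1" for i by (rule rc)
      fix u :: rvec assume u: "u \<in> carrier_vec r" and orth: "\<forall>i<q - 1. row (Z n) i \<bullet> u = 0"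
      have z0: "z u $ i = 0" if i: "i < m" for i using orth i m Zn by (simp add: z_def)
      have "\<gamma> m * D * ((1 - C2 * \<eta> n) * (u \<bullet> u)) \<le> \<gamma> m * D * (z u \<bullet> z u)"
        using zz[OF u] \<gamma>m D by (intro mult_left_mono) (auto simp: algebra_simps abs_le_iff)
      also have "\<dots> = (\<Sum>i<r. \<gamma> m * D * (z u $ i)\<^sup>2)" by (simp add: zsum[OF u] sum_distrib_left)
      also have "\<dots> \<le> df u"
        unfolding df_def diag_form_def
      proof (intro sum_mono)
        fix i assume "i \<in> {..<r}"
        then show "\<gamma> m * D * (z u $ i)\<^sup>2 \<le> \<gamma> i * (d n i)\<^sup>2 * (z u $ i)\<^sup>2"
          using z0[of i] elim(9) m(1) by (cases "i < m") (auto simp: D_def intro!: mult_right_mono)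
      qed
      finally have dfu: "\<gamma> m * D * ((1 - C2 * \<eta> n) * (u \<bullet> u)) \<le> df u" .
      have "(1 - C1 * \<eta> n) * (\<gamma> m * D * ((1 - C2 * \<eta> n) * (u \<bullet> u))) \<le> (1 - C1 * \<eta> n) * df u"
        using dfu elim(12) by (intro mult_left_mono) auto
      also have "\<dots> \<le> F n u" using Fdf[OF u] by (simp add: algebra_simps abs_le_iff)
      finally have "(1 - a * \<eta> n) * ((1 - C1 * \<eta> n) * (\<gamma> m * D * ((1 - C2 * \<eta> n) * (u \<bullet> u)))) \<le> (1 - a * \<eta> n) * F n u"
        using elim(11) by (intro mult_left_mono) auto
      moreover have "(1 - a * \<eta> n) * F n u - e n * (u \<bullet> u) \<le> (Q n *\<^sub>v u) \<bullet> (S n *\<^sub>v (Q n *\<^sub>v u))"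
        using elim(4) u by auto
      ultimately show "((1 - a * \<eta> n) * ((1 - C1 * \<eta> n) * (1 - C2 * \<eta> n)) * (\<gamma> m * D) - e n) * (u \<bullet> u)
         \<le> (Q n *\<^sub>v u) \<bullet> (S n *\<^sub>v (Q n *\<^sub>v u))"
        by (simp add: algebra_simps)
    qed
    have \<gamma>D: "0 \<le> \<gamma> m * D" using \<gamma>m D by simp
    have pp: "(1 + a * \<eta> n) * ((1 + C1 * \<eta> n) * (1 + C2 * \<eta> n)) \<le> 1 + K * \<eta> n"
      unfolding K_def by (rule one_plus_prod_le) (use a C1(1) C2(1) \<eta>(1)[of n] elim(10) in auto)
    have pm: "1 - K' * \<eta> n \<le> (1 - a * \<eta> n) * ((1 - C1 * \<eta> n) * (1 - C2 * \<eta> n))"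
      unfolding K'_def by (rule one_minus_prod_ge) (use a C1(1) C2(1) \<eta>(1)[of n] elim(11,12) in auto)
    define l where "l = ord_eigenvalue (p n - r + q) (S n)"
    have "l \<le> (1 + K * \<eta> n) * (\<gamma> m * D) + e n"
      using ord1 mult_right_mono[OF pp \<gamma>D] unfolding l_def by linarith
    then have "l / D \<le> ((1 + K * \<eta> n) * (\<gamma> m * D) + e n) / D" using D by (intro divide_right_mono) auto
    also have "\<dots> = (1 + K * \<eta> n) * \<gamma> m + e n / D" using D by (simp add: field_simps)
    finally have up: "l / D - \<gamma> m \<le> \<gamma> m * K * \<eta> n + C3 * \<eta> n" using e3 by (simp add: algebra_simps)
    have "(1 - K' * \<eta> n) * (\<gamma> m * D) - e n \<le> l"
      using ord2 mult_right_mono[OF pm \<gamma>D] unfolding l_def by linarith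
    then have "((1 - K' * \<eta> n) * (\<gamma> m * D) - e n) / D \<le> l / D" using D by (intro divide_right_mono) auto
    moreover have "((1 - K' * \<eta> n) * (\<gamma> m * D) - e n) / D = (1 - K' * \<eta> n) * \<gamma> m - e n / D" using D by (simp add: field_simps)
    ultimately have lo: "- (\<gamma> m * K' * \<eta> n + C3 * \<eta> n) \<le> l / D - \<gamma> m" using e3 by (simp add: algebra_simps)
    have K'0: "0 \<le> K'" using a C1 C2 by (simp add: K'_def)
    have 1: "\<gamma> m * K * \<eta> n \<le> \<gamma> m * (\<bar>K\<bar> + K') * \<eta> n" "\<gamma> m * K' * \<eta> n \<le> \<gamma> m * (\<bar>K\<bar> + K') * \<eta> n"
      using K'0 \<gamma>m \<eta>(1)[of n] by (auto intro!: mult_right_mono mult_left_mono)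
    have "\<bar>l / D - \<gamma> m\<bar> \<le> \<gamma> m * (\<bar>K\<bar> + K') * \<eta> n + C3 * \<eta> n"
      using up lo 1 by linarith
    then show ?case using \<eta>(1)[of n] unfolding l_def D_def by (simp add: algebra_simps)
  qed
  then show ?thesis unfolding m_def by (rule bigoI)
qed

section \<open>Powers of the scaling matrix\<close>

lemma mult_square_mat: "A \<in> carrier_mat r r \<Longrightarrow> B \<in> carrier_mat r r \<Longrightarrow> A * B \<in> carrier_mat r r"
  by (rule mult_carrier_mat)

lemmas assoc_square_mat = assoc_mult_mat[of _ r r _ r _ r for r]

lemma minv_eq:
  fixes A :: rmat
  assumes A: "A \<in> carrier_mat d d" "B \<in> carrier_mat d d" "A * B = 1\<^sub>m d" "B * A = 1\<^sub>m d"
  shows "minv A = B"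
proof -
  have "det A * det B = 1" using det_mult[OF A(1,2)] A(3) by simp
  then have "det A \<noteq> 0" by auto
  then have "A \<in> Units (ring_mat TYPE(real) d ())" by (rule det_non_zero_imp_unit[OF A(1)])
  then obtain C where C: "mat_inverse A = Some C" using mat_inverse(1)[OF A(1)] by fastforce
  have C': "A * C = 1\<^sub>m d" "C * A = 1\<^sub>m d" "C \<in> carrier_mat d d" using mat_inverse(2)[OF A(1) C] by auto
  have "C = C * (A * B)" unfolding A(3) using right_mult_one_mat[OF C'(3)] ..
  also have "\<dots> = (C * A) * B" using assoc_square_mat[OF C'(3) A(1,2)] ..
  also have "\<dots> = B" unfolding C'(2) by (rule left_mult_one_mat[OF A(2)])
  finally show ?thesis using C by (simp add: minv_def)
qed

lemma conj_diag_entry: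
  assumes P: "P \<in> carrier_mat r r" "Pv \<in> carrier_mat r r" and ik: "i < r" "k < r"
  shows "(P * mat_diag r f * Pv) $$ (i, k) = (\<Sum>l<r. P $$ (i, l) * f l * Pv $$ (l, k))"
  using P ik by (simp add: mat_diag_mult_right[OF P(1)] scalar_prod_def atLeast0LessThan)

lemma conj_diag_power:
  fixes P :: rmat
  assumes P: "P \<in> carrier_mat r r" "Pv \<in> carrier_mat r r" "P * Pv = 1\<^sub>m r" "Pv * P = 1\<^sub>m r"
  shows "(P * mat_diag r f * Pv) ^\<^sub>m k = P * mat_diag r (\<lambda>l. f l ^ k) * Pv"
proof (induction k)
  case 0 then show ?case using P by simp
next
  case (Suc k)
  have c: "mat_diag r g \<in> carrier_mat r r" for g :: "nat \<Rightarrow> real" by simp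
  have "(P * mat_diag r f * Pv) ^\<^sub>m Suc k = (P * mat_diag r (\<lambda>l. f l ^ k) * Pv) * (P * mat_diag r f * Pv)"
    using Suc by simp
  also have "\<dots> = P * mat_diag r (\<lambda>l. f l ^ k) * (Pv * P) * mat_diag r f * Pv"
    using P(1,2) c by (simp only: assoc_mult_mat[of _ r r _ r _ r] mult_square_mat[of _ r])
  also have "\<dots> = P * (mat_diag r (\<lambda>l. f l ^ k) * mat_diag r f) * Pv"
    unfolding P(4) using assoc_square_mat[OF P(1) c c] right_mult_one_mat[OF mult_square_mat[OF P(1) c]] by metis
  finally show ?case by (simp add: mult.commute)
qed

text \<open>
  The exponential series is conjugated term by term.
\<close>

lemma mat_powr_diagonalisable:
  fixes P :: rmat
  assumes P: "P \<in> carrier_mat r r" "Pv \<in> carrier_mat r r" "P * Pv = 1\<^sub>m r" "Pv * P = 1\<^sub>m r" and c: "0 < c"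
  shows "mat_powr c (P * mat_diag r f * Pv) = P * mat_diag r (\<lambda>l. c powr f l) * Pv"
proof -
  have "ln c \<cdot>\<^sub>m (P * mat_diag r f * Pv) = P * mat_diag r (\<lambda>l. ln c * f l) * Pv"
  proof (rule eq_matI)
    fix i k assume "i < dim_row (P * mat_diag r (\<lambda>l. ln c * f l) * Pv)" "k < dim_col (P * mat_diag r (\<lambda>l. ln c * f l) * Pv)"
    then have ik: "i < r" "k < r" using P by auto
    have "P * mat_diag r f * Pv \<in> carrier_mat r r" using P by (intro mult_square_mat) auto
    then show "(ln c \<cdot>\<^sub>m (P * mat_diag r f * Pv)) $$ (i, k) = (P * mat_diag r (\<lambda>l. ln c * f l) * Pv) $$ (i, k)"
      using ik conj_diag_entry[OF P(1,2) ik] by (simp add: sum_distrib_left mult_ac del: index_mult_mat)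
  qed (use P in auto)
  then have "mat_powr c (P * mat_diag r f * Pv) = mat_exp (P * mat_diag r (\<lambda>l. ln c * f l) * Pv)"
    by (simp add: mat_powr_def)
  also have "\<dots> = P * mat_diag r (\<lambda>l. c powr f l) * Pv"
  proof (rule eq_matI)
    fix i k assume "i < dim_row (P * mat_diag r (\<lambda>l. c powr f l) * Pv)" "k < dim_col (P * mat_diag r (\<lambda>l. c powr f l) * Pv)"
    then have ik: "i < r" "k < r" using P by auto
    have "(\<lambda>m. \<Sum>l<r. P $$ (i, l) * ((ln c * f l) ^ m /\<^sub>R fact m) * Pv $$ (l, k)) sums (\<Sum>l<r. P $$ (i, l) * exp (ln c * f l) * Pv $$ (l, k))"
      by (intro sums_sum sums_mult sums_mult2 exp_converges)
    then have "(\<lambda>m. (P * mat_diag r (\<lambda>l. (ln c * f l) ^ m) * Pv) $$ (i, k) / fact m) sums (\<Sum>l<r. P $$ (i, l) * exp (ln c * f l) * Pv $$ (l, k))"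
      by (simp add: conj_diag_entry[OF P(1,2) ik] sum_divide_distrib field_simps)
    then have "(\<Sum>m. (P * mat_diag r (\<lambda>l. (ln c * f l) ^ m) * Pv) $$ (i, k) / fact m) = (\<Sum>l<r. P $$ (i, l) * exp (ln c * f l) * Pv $$ (l, k))"
      by (rule sums_unique[symmetric])
    then show "mat_exp (P * mat_diag r (\<lambda>l. ln c * f l) * Pv) $$ (i, k) = (P * mat_diag r (\<lambda>l. c powr f l) * Pv) $$ (i, k)"
      using ik P c by (simp add: mat_exp_def conj_diag_power[OF P] conj_diag_entry[OF P(1,2) ik] powr_def mult.commute)
  qed (use P in \<open>auto simp: mat_exp_def\<close>)
  finally show ?thesis .
qed

lemma invertible_mat_inverse:
  fixes P :: rmat
  assumes P: "P \<in> carrier_mat r r" "invertible_mat P"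
  obtains Pv where "Pv \<in> carrier_mat r r" "P * Pv = 1\<^sub>m r" "Pv * P = 1\<^sub>m r"
proof -
  obtain Pv where "inverts_mat P Pv" "inverts_mat Pv P" using P(2) unfolding invertible_mat_def by auto
  then have Pv: "P * Pv = 1\<^sub>m r" "Pv * P = 1\<^sub>m (dim_row Pv)" using P(1) by (auto simp: inverts_mat_def)
  have "dim_col Pv = r" using Pv(1) by (metis index_mult_mat(3) index_one_mat(3))
  moreover have "dim_row Pv = r" using Pv(2) P(1) by (metis carrier_matD(2) index_mult_mat(3) index_one_mat(3))
  ultimately show ?thesis using that[of Pv] Pv by auto
qed

text \<open>
  The outer factors \<open>P\<^sub>H\<^sup>-\<^sup>1\<close> and \<open>P\<^sub>H\<close> cancel against those of \<open>a\<^bsup>-H - I/2\<^esup>\<close>, and a purely diagonal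
  scaling remains.
\<close>

lemma Bhat_eq:
  assumes P: "PH S \<in> carrier_mat (rdim S) (rdim S)"
    and Pv: "Pv \<in> carrier_mat (rdim S) (rdim S)" "PH S * Pv = 1\<^sub>m (rdim S)" "Pv * PH S = 1\<^sub>m (rdim S)"
    and a: "0 < ascale S n"
    and W: "WX S j n \<omega> \<in> carrier_mat (rdim S) (rdim S)"
  shows "Bhat S j n \<omega> = mat_diag (rdim S) (\<lambda>i. real (ascale S n) powr (- hexp S (i + 1) - 1 / 2)) *
       (Pv * WX S j n \<omega> * transpose_mat Pv) * mat_diag (rdim S) (\<lambda>i. real (ascale S n) powr (- hexp S (i + 1) - 1 / 2))"
proof -
  define r where "r = rdim S"
  define h where "h i = hexp S (i + 1)" for i
  define e where "e i = real (ascale S n) powr (- h i - 1 / 2)" for i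
  define W' where "W' = WX S j n \<omega>"
  have Pc: "PH S \<in> carrier_mat r r" using P by (simp add: r_def)
  have Pv: "PH S * Pv = 1\<^sub>m r" and Pvc: "Pv \<in> carrier_mat r r" "Pv * PH S = 1\<^sub>m r"
    using Pv by (simp_all add: r_def)
  have PT: "transpose_mat (PH S) * transpose_mat Pv = 1\<^sub>m r" "transpose_mat Pv * transpose_mat (PH S) = 1\<^sub>m r"
    unfolding transpose_mult[OF Pc Pvc(1), symmetric] transpose_mult[OF Pvc(1) Pc, symmetric] Pv Pvc(2) by simp_all
  have m1: "minv (PH S) = Pv" by (rule minv_eq[OF Pc Pvc(1) Pv Pvc(2)])
  have m2: "minv (transpose_mat (PH S)) = transpose_mat Pv"
    by (rule minv_eq[OF _ _ PT]) (use Pc Pvc in auto)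
  have one: "(1\<^sub>m r :: rmat) $$ (i, k) = (\<Sum>l<r. PH S $$ (i, l) * Pv $$ (l, k))" if "i < r" "k < r" for i k
    using arg_cong[OF Pv, of "\<lambda>A. A $$ (i, k)"] that Pc Pvc by (simp add: scalar_prod_def atLeast0LessThan)
  have H: "Hmat S = PH S * mat_diag r h * Pv" by (simp add: Hmat_def m1 r_def h_def[abs_def])
  have Hc: "Hmat S \<in> carrier_mat r r" unfolding H using Pc Pvc by (intro mult_square_mat) auto
  have e1: "- Hmat S - (1 / 2) \<cdot>\<^sub>m 1\<^sub>m r = PH S * mat_diag r (\<lambda>i. - h i - 1 / 2) * Pv"
  proof (rule eq_matI)
    fix i k assume "i < dim_row (PH S * mat_diag r (\<lambda>i. - h i - 1 / 2) * Pv)" "k < dim_col (PH S * mat_diag r (\<lambda>i. - h i - 1 / 2) * Pv)"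
    then have ik: "i < r" "k < r" using Pc Pvc by auto
    have "(- Hmat S - (1 / 2) \<cdot>\<^sub>m 1\<^sub>m r) $$ (i, k) = - Hmat S $$ (i, k) - 1 / 2 * 1\<^sub>m r $$ (i, k)"
      using ik Hc by simp
    also have "\<dots> = (\<Sum>l<r. PH S $$ (i, l) * (- h l - 1 / 2) * Pv $$ (l, k))"
      unfolding H conj_diag_entry[OF Pc Pvc(1) ik] one[OF ik]
      by (simp add: sum_distrib_left algebra_simps flip: sum_negf sum_subtractf sum.distrib)
    finally show "(- Hmat S - (1 / 2) \<cdot>\<^sub>m 1\<^sub>m r) $$ (i, k) = (PH S * mat_diag r (\<lambda>i. - h i - 1 / 2) * Pv) $$ (i, k)"
      unfolding conj_diag_entry[OF Pc Pvc(1) ik] .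
  qed (use Hc Pc Pvc in auto)
  have "- transpose_mat (Hmat S) - (1 / 2) \<cdot>\<^sub>m 1\<^sub>m r = transpose_mat (- Hmat S - (1 / 2) \<cdot>\<^sub>m 1\<^sub>m r)"
    using Hc by (intro eq_matI) auto
  also have "\<dots> = transpose_mat Pv * mat_diag r (\<lambda>i. - h i - 1 / 2) * transpose_mat (PH S)"
    unfolding e1
  proof (rule eq_matI)
    fix i k assume "i < dim_row (transpose_mat Pv * mat_diag r (\<lambda>i. - h i - 1 / 2) * transpose_mat (PH S))"
      "k < dim_col (transpose_mat Pv * mat_diag r (\<lambda>i. - h i - 1 / 2) * transpose_mat (PH S))"
    then have ik: "i < r" "k < r" using Pc Pvc by auto
    have T: "transpose_mat Pv \<in> carrier_mat r r" "transpose_mat (PH S) \<in> carrier_mat r r" using Pc Pvc by auto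
    show "transpose_mat (PH S * mat_diag r (\<lambda>i. - h i - 1 / 2) * Pv) $$ (i, k) =
       (transpose_mat Pv * mat_diag r (\<lambda>i. - h i - 1 / 2) * transpose_mat (PH S)) $$ (i, k)"
      unfolding conj_diag_entry[OF T ik] using ik Pc Pvc conj_diag_entry[OF Pc Pvc(1) ik(2,1)]
      by (auto simp: mult_ac intro!: sum.cong)
  qed (use Pc Pvc in auto)
  finally have e2: "- transpose_mat (Hmat S) - (1 / 2) \<cdot>\<^sub>m 1\<^sub>m r = transpose_mat Pv * mat_diag r (\<lambda>i. - h i - 1 / 2) * transpose_mat (PH S)" .
  have a0: "0 < real (ascale S n)" using a by simp
  have p1: "mat_powr (real (ascale S n)) (- Hmat S - (1 / 2) \<cdot>\<^sub>m 1\<^sub>m r) = PH S * mat_diag r e * Pv"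
    unfolding e1 e_def by (rule mat_powr_diagonalisable[OF Pc Pvc(1) Pv Pvc(2) a0])
  have p2: "mat_powr (real (ascale S n)) (- transpose_mat (Hmat S) - (1 / 2) \<cdot>\<^sub>m 1\<^sub>m r) = transpose_mat Pv * mat_diag r e * transpose_mat (PH S)"
    unfolding e2 e_def by (rule mat_powr_diagonalisable[OF _ _ PT(2,1) a0]) (use Pc Pvc in auto)
  have c: "Pv \<in> carrier_mat r r" "PH S \<in> carrier_mat r r" "transpose_mat Pv \<in> carrier_mat r r"
    "transpose_mat (PH S) \<in> carrier_mat r r" "mat_diag r e \<in> carrier_mat r r" "W' \<in> carrier_mat r r"
    using Pc Pvc W by (auto simp: r_def W'_def)
  have X: "mat_diag r e * (Pv * W' * transpose_mat Pv) * mat_diag r e \<in> carrier_mat r r"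
    by (intro mult_square_mat c)
  have "Bhat S j n \<omega> = Pv * (PH S * mat_diag r e * Pv) * W' * (transpose_mat Pv * mat_diag r e * transpose_mat (PH S)) * transpose_mat Pv"
    unfolding Bhat_def m1 m2 W'_def using p1 p2 by (simp add: r_def)
  also have "\<dots> = (Pv * PH S) * mat_diag r e * (Pv * W' * transpose_mat Pv) * mat_diag r e * (transpose_mat (PH S) * transpose_mat Pv)"
    using c by (simp only: assoc_square_mat mult_square_mat)
  also have "\<dots> = mat_diag r e * (Pv * W' * transpose_mat Pv) * mat_diag r e"
    unfolding PT Pvc(2) left_mult_one_mat[OF c(5)] by (rule right_mult_one_mat[OF X])
  finally show ?thesis unfolding r_def W'_def e_def h_def by simp
qed

section \<open>Second moments of the wavelet coefficients\<close>

text \<open>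
  Both functions have compact support, so far translates of \<open>\<phi>\<close> do not meet the support of the
  dilated \<open>\<psi>\<close>. Consequently every wavelet coefficient is a finite linear combination of
  observations, for every outcome, and inherits their second moments.
\<close>

lemma wav_filter_finite_support:
  assumes W2: "cond_W2 \<phi> \<psi>" and s: "0 < s"
  shows "\<exists>F. finite F \<and> (\<forall>l. l \<notin> F \<longrightarrow> wav_filter \<phi> \<psi> s l = 0)"
proof -
  obtain K1 K2 where K1: "compact K1" "AE t in lborel. t \<notin> K1 \<longrightarrow> \<phi> t = 0"
    and K2: "compact K2" "AE t in lborel. t \<notin> K2 \<longrightarrow> \<psi> t = 0"
    using W2 by (auto simp: cond_W2_def compactly_supported_def)
  have [measurable]: "\<phi> \<in> borel_measurable borel" "\<psi> \<in> borel_measurable borel"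
    using W2 by (auto simp: cond_W2_def dest!: borel_measurable_integrable)
  have [measurable]: "K1 \<in> sets borel" "K2 \<in> sets borel" using K1 K2 by (auto intro: borel_compact)
  obtain B1 B2 where B: "\<And>t. t \<in> K1 \<Longrightarrow> \<bar>t\<bar> \<le> B1" "\<And>t. t \<in> K2 \<Longrightarrow> \<bar>t\<bar> \<le> B2"
    using compact_imp_bounded[OF K1(1)] compact_imp_bounded[OF K2(1)] by (auto simp: bounded_iff)
  define N where "N = \<lceil>B1 + real s * B2\<rceil>"
  have "wav_filter \<phi> \<psi> s l = 0" if l: "l \<notin> {-N..N}" for l
  proof -
    have big: "\<bar>real_of_int l\<bar> > B1 + real s * B2" using l unfolding N_def by (auto simp: not_le ceiling_less_iff le_ceiling_iff abs_if) linarith+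
    have "AE t in lborel. real_of_int l + 1 * t \<notin> K1 \<longrightarrow> \<phi> (real_of_int l + 1 * t) = 0"
      by (rule AE_borel_affine[OF _ _ K1(2)]) simp_all
    moreover have "AE t in lborel. 0 + (1 / real s) * t \<notin> K2 \<longrightarrow> \<psi> (0 + (1 / real s) * t) = 0"
      by (rule AE_borel_affine[OF _ _ K2(2)]) (use s in simp_all)
    ultimately have "AE t in lborel. \<phi> (t + real_of_int l) * \<psi> (t / real s) = 0"
    proof eventually_elim
      case (elim t)
      show ?case
      proof (rule ccontr)
        assume "\<phi> (t + real_of_int l) * \<psi> (t / real s) \<noteq> 0"
        then have "t + real_of_int l \<in> K1" "t / real s \<in> K2" using elim by (auto simp: add.commute)
        then have "\<bar>t + real_of_int l\<bar> \<le> B1" "\<bar>t / real s\<bar> \<le> B2" by (auto intro!: B simp del: abs_divide)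
        then have "\<bar>t + real_of_int l\<bar> \<le> B1" "\<bar>t\<bar> \<le> real s * B2" using s by (auto simp: field_simps abs_divide)
        then show False using big by linarith
      qed
    qed
    then show ?thesis unfolding wav_filter_def by (simp add: integral_eq_zero_AE)
  qed
  then show ?thesis by (intro exI[of _ "{-N..N}"]) auto
qed

lemma wav_coef_finite_sum:
  assumes W2: "cond_W2 \<phi> \<psi>" and s: "0 < s"
  obtains F g where "finite F"
    "\<And>d (U :: int \<Rightarrow> 'a \<Rightarrow> rvec) \<omega> i. i < d \<Longrightarrow> wav_coef \<phi> \<psi> d U s k \<omega> $ i = (\<Sum>l\<in>F. g l * U l \<omega> $ i)"
proof -
  obtain F where F: "finite F" "\<And>l. l \<notin> F \<Longrightarrow> wav_filter \<phi> \<psi> s l = 0"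
    using wav_filter_finite_support[OF W2 s] by blast
  define F' where "F' = (\<lambda>x. int (s * k) - x) ` F"
  have F': "finite F'" "\<And>l. l \<notin> F' \<Longrightarrow> wav_filter \<phi> \<psi> s (int (s * k) - l) = 0"
  proof -
    show "finite F'" using F by (simp add: F'_def)
    fix l assume "l \<notin> F'"
    then have "int (s * k) - l \<notin> F" by (force simp: F'_def image_iff)
    then show "wav_filter \<phi> \<psi> s (int (s * k) - l) = 0" by (rule F(2))
  qed
  have "wav_coef \<phi> \<psi> d U s k \<omega> $ i = (\<Sum>l\<in>F'. wav_filter \<phi> \<psi> s (int (s * k) - l) * U l \<omega> $ i)"
    if "i < d" for d and U :: "int \<Rightarrow> 'a \<Rightarrow> rvec" and \<omega> i
  proof -
    have "wav_coef \<phi> \<psi> d U s k \<omega> $ i = (\<Sum>\<^sub>\<infinity>l. U l \<omega> $ i * wav_filter \<phi> \<psi> s (int (s * k) - l))"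
      using that by (simp add: wav_coef_def)
    also have "\<dots> = (\<Sum>\<^sub>\<infinity>l\<in>F'. U l \<omega> $ i * wav_filter \<phi> \<psi> s (int (s * k) - l))"
      using F'(2) by (intro infsum_cong_neutral) auto
    finally show ?thesis using F'(1) by (simp add: mult.commute)
  qed
  with F'(1) show ?thesis by (rule that)
qed

lemma square_integrable_product:
  fixes f g :: "'a \<Rightarrow> real"
  assumes [measurable]: "f \<in> borel_measurable M" "g \<in> borel_measurable M"
    and "integrable M (\<lambda>x. (f x)\<^sup>2)" "integrable M (\<lambda>x. (g x)\<^sup>2)"
  shows "integrable M (\<lambda>x. f x * g x)"
proof (rule Bochner_Integration.integrable_bound[of M "\<lambda>x. (f x)\<^sup>2 + (g x)\<^sup>2"])
  show "AE x in M. norm (f x * g x) \<le> norm ((f x)\<^sup>2 + (g x)\<^sup>2)"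
  proof (rule AE_I2)
    fix x
    have "2 * (\<bar>f x\<bar> * \<bar>g x\<bar>) \<le> (f x)\<^sup>2 + (g x)\<^sup>2"
      using sum_squares_bound[of "\<bar>f x\<bar>" "\<bar>g x\<bar>"] by simp
    moreover have "0 \<le> \<bar>f x\<bar> * \<bar>g x\<bar>" by simp
    ultimately show "norm (f x * g x) \<le> norm ((f x)\<^sup>2 + (g x)\<^sup>2)" 
      unfolding real_norm_def abs_mult by linarith
  qed
qed (intro Bochner_Integration.integrable_add assms(3,4), simp)

lemma wav_coef_product_integrable:
  fixes M :: "'a measure" and U :: "int \<Rightarrow> 'a \<Rightarrow> rvec"
  assumes W2: "cond_W2 \<phi> \<psi>" and s: "0 < s"
    and U: "\<And>l. finite_variance_vec M d (U l)" and i: "i < d" "i' < d"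
  shows "integrable M (\<lambda>\<omega>. wav_coef \<phi> \<psi> d U s k \<omega> $ i * wav_coef \<phi> \<psi> d U s k \<omega> $ i')"
proof -
  obtain F g where F: "finite F"
    "\<And>d (U :: int \<Rightarrow> 'a \<Rightarrow> rvec) \<omega> i. i < d \<Longrightarrow> wav_coef \<phi> \<psi> d U s k \<omega> $ i = (\<Sum>l\<in>F. g l * U l \<omega> $ i)"
    by (rule wav_coef_finite_sum[OF W2 s]) (rule that)
  have "integrable M (\<lambda>\<omega>. U l \<omega> $ i * U m \<omega> $ i')" for l m
    using U[of l] U[of m] i by (intro square_integrable_product) (auto simp: finite_variance_vec_def random_vec_def)
  then have "integrable M (\<lambda>\<omega>. \<Sum>l\<in>F. \<Sum>m\<in>F. g l * g m * (U l \<omega> $ i * U m \<omega> $ i'))"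
    by (intro Bochner_Integration.integrable_sum integrable_mult_right)
  also have "(\<lambda>\<omega>. \<Sum>l\<in>F. \<Sum>m\<in>F. g l * g m * (U l \<omega> $ i * U m \<omega> $ i')) =
     (\<lambda>\<omega>. wav_coef \<phi> \<psi> d U s k \<omega> $ i * wav_coef \<phi> \<psi> d U s k \<omega> $ i')"
    by (simp add: F(2)[OF i(1)] F(2)[OF i(2)] sum_product mult_ac)
  finally show ?thesis .
qed

lemma sample_cross_integrable:
  assumes W2: "cond_W2 \<phi> \<psi>" and s: "0 < s"
    and U: "\<And>l. finite_variance_vec M d (U l)" and i: "i < d" "i' < d"
  shows "integrable M (\<lambda>\<omega>. sample_cross K d d (wav_coef \<phi> \<psi> d U s) (wav_coef \<phi> \<psi> d U s) \<omega> $$ (i, i'))"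
proof -
  have "sample_cross K d d (wav_coef \<phi> \<psi> d U s) (wav_coef \<phi> \<psi> d U s) \<omega> $$ (i, i') =
      1 / real K * (\<Sum>k=1..K. wav_coef \<phi> \<psi> d U s k \<omega> $ i * wav_coef \<phi> \<psi> d U s k \<omega> $ i')" for \<omega>
    using i by (simp add: sample_cross_def)
  then show ?thesis
    by (simp only:) (intro integrable_mult_right Bochner_Integration.integrable_sum wav_coef_product_integrable[OF W2 s U i])
qed

lemma sample_cross_form:
  assumes v: "v \<in> carrier_vec d"
  shows "v \<bullet> (sample_cross K d d D D \<omega> *\<^sub>v v) = 1 / real K * (\<Sum>k=1..K. (\<Sum>i<d. v $ i * D k \<omega> $ i)\<^sup>2)"
proof -
  have "v \<bullet> (sample_cross K d d D D \<omega> *\<^sub>v v) =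
     (\<Sum>i<d. v $ i * (\<Sum>i'<d. 1 / real K * (\<Sum>k=1..K. D k \<omega> $ i * D k \<omega> $ i') * v $ i'))"
    using v by (simp add: scalar_prod_def atLeast0LessThan sample_cross_def)
  also have "\<dots> = (\<Sum>i<d. \<Sum>i'<d. \<Sum>k=1..K. 1 / real K * ((v $ i * D k \<omega> $ i) * (v $ i' * D k \<omega> $ i')))"
    by (simp add: sum_distrib_left sum_distrib_right mult_ac)
  also have "\<dots> = (\<Sum>k=1..K. \<Sum>i<d. \<Sum>i'<d. 1 / real K * ((v $ i * D k \<omega> $ i) * (v $ i' * D k \<omega> $ i')))"
    by (subst sum.swap, subst (2) sum.swap) (rule refl)
  also have "\<dots> = 1 / real K * (\<Sum>k=1..K. (\<Sum>i<d. v $ i * D k \<omega> $ i)\<^sup>2)"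
    unfolding power2_eq_square sum_product by (simp only: sum_distrib_left)
  finally show ?thesis .
qed

lemma mat_expectation_form:
  assumes V: "\<And>\<omega>. V \<omega> \<in> carrier_mat d d"
    and int: "\<And>i i'. i < d \<Longrightarrow> i' < d \<Longrightarrow> integrable M (\<lambda>\<omega>. V \<omega> $$ (i, i'))"
    and v: "v \<in> carrier_vec d"
  shows "integrable M (\<lambda>\<omega>. v \<bullet> (V \<omega> *\<^sub>v v))" and "v \<bullet> (mat_expectation M d d V *\<^sub>v v) = (LINT \<omega>|M. v \<bullet> (V \<omega> *\<^sub>v v))"
proof -
  have eq: "v \<bullet> (V \<omega> *\<^sub>v v) = (\<Sum>i<d. \<Sum>i'<d. v $ i * v $ i' * V \<omega> $$ (i, i'))" for \<omega>
    using carrier_matD[OF V[of \<omega>]] v by (simp add: scalar_prod_def atLeast0LessThan sum_distrib_left mult_ac)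
  show "integrable M (\<lambda>\<omega>. v \<bullet> (V \<omega> *\<^sub>v v))"
    unfolding eq using int by (intro Bochner_Integration.integrable_sum integrable_mult_right) auto
  have "v \<bullet> (mat_expectation M d d V *\<^sub>v v) = (\<Sum>i<d. \<Sum>i'<d. v $ i * v $ i' * (LINT \<omega>|M. V \<omega> $$ (i, i')))"
    using v by (simp add: scalar_prod_def atLeast0LessThan sum_distrib_left mult_ac mat_expectation_def)
  also have "\<dots> = (\<Sum>i<d. LINT \<omega>|M. (\<Sum>i'<d. v $ i * v $ i' * V \<omega> $$ (i, i')))"
    using int by (intro sum.cong refl, subst Bochner_Integration.integral_sum) auto
  also have "\<dots> = (LINT \<omega>|M. v \<bullet> (V \<omega> *\<^sub>v v))"
    unfolding eq using int by (intro Bochner_Integration.integral_sum[symmetric] Bochner_Integration.integrable_sum) auto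
  finally show "v \<bullet> (mat_expectation M d d V *\<^sub>v v) = (LINT \<omega>|M. v \<bullet> (V \<omega> *\<^sub>v v))" .
qed

lemma square_sum_bounds:
  fixes x y \<epsilon> :: real assumes "0 < \<epsilon>"
  shows "(x + y)\<^sup>2 \<le> (1 + \<epsilon>) * x\<^sup>2 + (1 + 1 / \<epsilon>) * y\<^sup>2" "(1 - \<epsilon>) * x\<^sup>2 - 1 / \<epsilon> * y\<^sup>2 \<le> (x + y)\<^sup>2"
proof -
  have "0 \<le> (\<epsilon> * x - y)\<^sup>2 / \<epsilon>" "0 \<le> (\<epsilon> * x + y)\<^sup>2 / \<epsilon>" using assms by auto
  then have "2 * x * y \<le> \<epsilon> * x\<^sup>2 + y\<^sup>2 / \<epsilon>" "- (2 * x * y) \<le> \<epsilon> * x\<^sup>2 + y\<^sup>2 / \<epsilon>"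
    using assms by (auto simp: power2_eq_square field_simps)
  moreover have "0 \<le> y\<^sup>2" by simp
  ultimately show "(x + y)\<^sup>2 \<le> (1 + \<epsilon>) * x\<^sup>2 + (1 + 1 / \<epsilon>) * y\<^sup>2" "(1 - \<epsilon>) * x\<^sup>2 - 1 / \<epsilon> * y\<^sup>2 \<le> (x + y)\<^sup>2"
    by (simp_all add: power2_sum algebra_simps)
qed

text \<open>
  By linearity \<open>v \<bullet> D\<^sub>Y = (P\<^sup>* v) \<bullet> D\<^sub>X + v \<bullet> D\<^sub>Z\<close>, and \<open>square_sum_bounds\<close> is applied to these two
  summands before averaging over the coefficients and taking expectations.
\<close>

lemma EW_form_bounds:
  fixes S :: "'a wav_model" and n j :: nat
  assumes S: "factor_model S" and W2: "cond_W2 (phi S) (psi S)" and n: "1 \<le> n" and \<epsilon>: "0 < \<epsilon>"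
    and v: "v \<in> carrier_vec (pdim S n)"
  defines "x \<equiv> transpose_mat (Pmat S n) *\<^sub>v v"
    and "MX \<equiv> mat_expectation (prb S) (rdim S) (rdim S) (WX S j n)"
    and "MZ \<equiv> mat_expectation (prb S) (pdim S n) (pdim S n) (WZ S j n)"
  shows "v \<bullet> (EW S j n *\<^sub>v v) \<le> (1 + \<epsilon>) * (x \<bullet> (MX *\<^sub>v x)) + (1 + 1 / \<epsilon>) * (v \<bullet> (MZ *\<^sub>v v))"
    and "(1 - \<epsilon>) * (x \<bullet> (MX *\<^sub>v x)) - 1 / \<epsilon> * (v \<bullet> (MZ *\<^sub>v v)) \<le> v \<bullet> (EW S j n *\<^sub>v v)"
proof -
  interpret prob_space "prb S" using S by (simp add: factor_model_def)
  define s where "s = ascale S n * 2 ^ j"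
  define K where "K = neff S j n"
  define p where "p = pdim S n"
  define r where "r = rdim S"
  have "\<exists>k. ascale S n = 2 ^ k" using S by (simp add: factor_model_def)
  then have s: "0 < s" by (auto simp: s_def)
  have X: "\<And>l. finite_variance_vec (prb S) r (Xproc S l)" and Z: "\<And>l. finite_variance_vec (prb S) p (Zproc S n l)"
    and P: "Pmat S n \<in> carrier_mat p r" using S n by (auto simp: factor_model_def p_def r_def)
  have Y: "finite_variance_vec (prb S) p (Yproc S n l)" for l
  proof -
    have Xl: "\<And>\<omega>. \<omega> \<in> space (prb S) \<Longrightarrow> Xproc S l \<omega> \<in> carrier_vec r" "\<And>i. i < r \<Longrightarrow> (\<lambda>\<omega>. Xproc S l \<omega> $ i) \<in> borel_measurable (prb S)"
        "\<And>i. i < r \<Longrightarrow> integrable (prb S) (\<lambda>\<omega>. (Xproc S l \<omega> $ i)\<^sup>2)"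
      using X[of l] by (auto simp: finite_variance_vec_def random_vec_def)
    have Zl: "\<And>\<omega>. \<omega> \<in> space (prb S) \<Longrightarrow> Zproc S n l \<omega> \<in> carrier_vec p" "\<And>i. i < p \<Longrightarrow> (\<lambda>\<omega>. Zproc S n l \<omega> $ i) \<in> borel_measurable (prb S)"
        "\<And>i. i < p \<Longrightarrow> integrable (prb S) (\<lambda>\<omega>. (Zproc S n l \<omega> $ i)\<^sup>2)"
      using Z[of l] by (auto simp: finite_variance_vec_def random_vec_def)
    have Yi: "Yproc S n l \<omega> $ i = (\<Sum>k<r. Pmat S n $$ (i, k) * Xproc S l \<omega> $ k) + Zproc S n l \<omega> $ i"
      if "\<omega> \<in> space (prb S)" "i < p" for \<omega> i
      using that P carrier_vecD[OF Xl(1)[OF that(1)]] carrier_vecD[OF Zl(1)[OF that(1)]]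
      by (simp add: Yproc_def scalar_prod_def atLeast0LessThan)
    show ?thesis
      unfolding finite_variance_vec_def random_vec_def
    proof (intro conjI ballI allI impI)
      show "Yproc S n l \<omega> \<in> carrier_vec p" if "\<omega> \<in> space (prb S)" for \<omega>
        using P Xl(1)[OF that] Zl(1)[OF that] by (auto simp: Yproc_def)
      fix i assume i: "i < p"
      show "(\<lambda>\<omega>. Yproc S n l \<omega> $ i) \<in> borel_measurable (prb S)"
        using Xl(2) Zl(2)[OF i] by (subst measurable_cong[OF Yi[OF _ i]]) auto
      have XX: "integrable (prb S) (\<lambda>\<omega>. Xproc S l \<omega> $ k * Xproc S l \<omega> $ m)" if "k < r" "m < r" for k m
        using that Xl by (intro square_integrable_product) auto
      have XZ: "integrable (prb S) (\<lambda>\<omega>. Xproc S l \<omega> $ k * Zproc S n l \<omega> $ i)" if "k < r" for k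
        using that Xl Zl(2,3)[OF i] by (intro square_integrable_product) auto
      have "integrable (prb S) (\<lambda>\<omega>. (\<Sum>k<r. \<Sum>m<r. Pmat S n $$ (i, k) * Pmat S n $$ (i, m) * (Xproc S l \<omega> $ k * Xproc S l \<omega> $ m))
         + (2 * (\<Sum>k<r. Pmat S n $$ (i, k) * (Xproc S l \<omega> $ k * Zproc S n l \<omega> $ i)) + (Zproc S n l \<omega> $ i)\<^sup>2))"
        using XX XZ Zl(3)[OF i] by (intro Bochner_Integration.integrable_add Bochner_Integration.integrable_sum integrable_mult_right) auto
      also have "?this \<longleftrightarrow> integrable (prb S) (\<lambda>\<omega>. (Yproc S n l \<omega> $ i)\<^sup>2)"
      proof (rule Bochner_Integration.integrable_cong[OF refl])
        fix \<omega> assume "\<omega> \<in> space (prb S)"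
        note Y = Yi[OF this i]
        show "(\<Sum>k<r. \<Sum>m<r. Pmat S n $$ (i, k) * Pmat S n $$ (i, m) * (Xproc S l \<omega> $ k * Xproc S l \<omega> $ m))
         + (2 * (\<Sum>k<r. Pmat S n $$ (i, k) * (Xproc S l \<omega> $ k * Zproc S n l \<omega> $ i)) + (Zproc S n l \<omega> $ i)\<^sup>2) = (Yproc S n l \<omega> $ i)\<^sup>2"
          unfolding Y power2_sum by (simp add: power2_eq_square sum_product sum_distrib_left sum_distrib_right mult_ac)
      qed
      finally show "integrable (prb S) (\<lambda>\<omega>. (Yproc S n l \<omega> $ i)\<^sup>2)" .
    qed
  qed
  have x: "x \<in> carrier_vec r" using P v by (simp add: x_def p_def)
  have vp: "v \<in> carrier_vec p" using v by (simp add: p_def)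
  have WY: "Wmat S j n = sample_cross K p p (wav_coef (phi S) (psi S) p (Yproc S n) s) (wav_coef (phi S) (psi S) p (Yproc S n) s)"
    by (simp add: Wmat_def[abs_def] coefY_def K_def p_def s_def)
  have WX: "WX S j n = sample_cross K r r (wav_coef (phi S) (psi S) r (Xproc S) s) (wav_coef (phi S) (psi S) r (Xproc S) s)"
    by (simp add: WX_def[abs_def] coefX_def K_def r_def s_def)
  have WZ: "WZ S j n = sample_cross K p p (wav_coef (phi S) (psi S) p (Zproc S n) s) (wav_coef (phi S) (psi S) p (Zproc S n) s)"
    by (simp add: WZ_def[abs_def] coefZ_def K_def p_def s_def)
  have c: "sample_cross K d d D D \<omega> \<in> carrier_mat d d" for d and D :: "nat \<Rightarrow> 'a \<Rightarrow> rvec" and \<omega> by (simp add: sample_cross_def)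
  note eY = mat_expectation_form[where V = "Wmat S j n", unfolded WY, OF c sample_cross_integrable[OF W2 s Y] vp]
  note eX = mat_expectation_form[where V = "WX S j n", unfolded WX, OF c sample_cross_integrable[OF W2 s X] x]
  note eZ = mat_expectation_form[where V = "WZ S j n", unfolded WZ, OF c sample_cross_integrable[OF W2 s Z] vp]
  define A where "A k \<omega> = (\<Sum>i<r. x $ i * wav_coef (phi S) (psi S) r (Xproc S) s k \<omega> $ i)" for k \<omega>
  define C where "C k \<omega> = (\<Sum>i<p. v $ i * wav_coef (phi S) (psi S) p (Zproc S n) s k \<omega> $ i)" for k \<omega>
  have fX: "x \<bullet> (WX S j n \<omega> *\<^sub>v x) = 1 / real K * (\<Sum>k=1..K. (A k \<omega>)\<^sup>2)" for \<omega>
    unfolding WX A_def by (rule sample_cross_form[OF x])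
  have fZ: "v \<bullet> (WZ S j n \<omega> *\<^sub>v v) = 1 / real K * (\<Sum>k=1..K. (C k \<omega>)\<^sup>2)" for \<omega>
    unfolding WZ C_def by (rule sample_cross_form[OF vp])
  have fY: "v \<bullet> (Wmat S j n \<omega> *\<^sub>v v) = 1 / real K * (\<Sum>k=1..K. (A k \<omega> + C k \<omega>)\<^sup>2)" if \<omega>: "\<omega> \<in> space (prb S)" for \<omega>
  proof -
    have "(\<Sum>i<p. v $ i * wav_coef (phi S) (psi S) p (Yproc S n) s k \<omega> $ i) = A k \<omega> + C k \<omega>" for k
    proof -
      obtain F g where F: "finite F"
        "\<And>d (U :: int \<Rightarrow> 'a \<Rightarrow> rvec) \<omega> i. i < d \<Longrightarrow> wav_coef (phi S) (psi S) d U s k \<omega> $ i = (\<Sum>l\<in>F. g l * U l \<omega> $ i)"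
        by (rule wav_coef_finite_sum[OF W2 s]) (rule that)
      have Xl: "Xproc S l \<omega> \<in> carrier_vec r" and Zl: "Zproc S n l \<omega> \<in> carrier_vec p" for l
        using X[of l] Z[of l] \<omega> by (auto simp: finite_variance_vec_def random_vec_def)
      have Yl: "(\<Sum>i<p. v $ i * Yproc S n l \<omega> $ i) = (\<Sum>i<r. x $ i * Xproc S l \<omega> $ i) + (\<Sum>i<p. v $ i * Zproc S n l \<omega> $ i)" for l
      proof -
        have PX: "Pmat S n *\<^sub>v Xproc S l \<omega> \<in> carrier_vec p" using P Xl by (rule mult_mat_vec_carrier)
        have "v \<bullet> Yproc S n l \<omega> = v \<bullet> (Pmat S n *\<^sub>v Xproc S l \<omega>) + v \<bullet> Zproc S n l \<omega>"
          unfolding Yproc_def using vp PX Zl by (rule scalar_prod_add_distrib)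
        also have "v \<bullet> (Pmat S n *\<^sub>v Xproc S l \<omega>) = x \<bullet> Xproc S l \<omega>"
          using transpose_vec_mult_scalar[OF P Xl vp] by (simp add: x_def)
        finally show ?thesis
          using carrier_vecD[OF Xl[of l]] carrier_vecD[OF Zl[of l]] carrier_vecD[OF PX]
          by (simp add: scalar_prod_def atLeast0LessThan Yproc_def)
      qed
      have "(\<Sum>i<p. v $ i * wav_coef (phi S) (psi S) p (Yproc S n) s k \<omega> $ i) = (\<Sum>l\<in>F. g l * (\<Sum>i<p. v $ i * Yproc S n l \<omega> $ i))"
        by (simp add: F(2) sum_distrib_left mult_ac) (rule sum.swap)
      also have "\<dots> = (\<Sum>l\<in>F. g l * (\<Sum>i<r. x $ i * Xproc S l \<omega> $ i)) + (\<Sum>l\<in>F. g l * (\<Sum>i<p. v $ i * Zproc S n l \<omega> $ i))"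
        by (simp add: Yl distrib_left sum.distrib)
      also have "(\<Sum>l\<in>F. g l * (\<Sum>i<r. x $ i * Xproc S l \<omega> $ i)) = A k \<omega>"
        unfolding A_def by (simp add: F(2) sum_distrib_left mult_ac) (rule sum.swap)
      also have "(\<Sum>l\<in>F. g l * (\<Sum>i<p. v $ i * Zproc S n l \<omega> $ i)) = C k \<omega>"
        unfolding C_def by (simp add: F(2) sum_distrib_left mult_ac) (rule sum.swap)
      finally show ?thesis .
    qed
    then show ?thesis unfolding WY sample_cross_form[OF vp] by simp
  qed
  have up: "v \<bullet> (Wmat S j n \<omega> *\<^sub>v v) \<le> (1 + \<epsilon>) * (x \<bullet> (WX S j n \<omega> *\<^sub>v x)) + (1 + 1 / \<epsilon>) * (v \<bullet> (WZ S j n \<omega> *\<^sub>v v))"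
    if "\<omega> \<in> space (prb S)" for \<omega>
  proof -
    have "(\<Sum>k=1..K. (A k \<omega> + C k \<omega>)\<^sup>2) \<le> (\<Sum>k=1..K. (1 + \<epsilon>) * (A k \<omega>)\<^sup>2 + (1 + 1 / \<epsilon>) * (C k \<omega>)\<^sup>2)"
      by (intro sum_mono square_sum_bounds \<epsilon>)
    also have "\<dots> = (1 + \<epsilon>) * (\<Sum>k=1..K. (A k \<omega>)\<^sup>2) + (1 + 1 / \<epsilon>) * (\<Sum>k=1..K. (C k \<omega>)\<^sup>2)"
      by (simp only: sum.distrib sum_distrib_left)
    finally have "1 / real K * (\<Sum>k=1..K. (A k \<omega> + C k \<omega>)\<^sup>2) \<le>
       1 / real K * ((1 + \<epsilon>) * (\<Sum>k=1..K. (A k \<omega>)\<^sup>2) + (1 + 1 / \<epsilon>) * (\<Sum>k=1..K. (C k \<omega>)\<^sup>2))"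
      by (intro mult_left_mono) auto
    then show ?thesis unfolding fY[OF that] fX fZ by (simp only: distrib_left mult.left_commute)
  qed
  have lo: "(1 - \<epsilon>) * (x \<bullet> (WX S j n \<omega> *\<^sub>v x)) - 1 / \<epsilon> * (v \<bullet> (WZ S j n \<omega> *\<^sub>v v)) \<le> v \<bullet> (Wmat S j n \<omega> *\<^sub>v v)"
    if "\<omega> \<in> space (prb S)" for \<omega>
  proof -
    have "(1 - \<epsilon>) * (\<Sum>k=1..K. (A k \<omega>)\<^sup>2) - 1 / \<epsilon> * (\<Sum>k=1..K. (C k \<omega>)\<^sup>2) =
        (\<Sum>k=1..K. (1 - \<epsilon>) * (A k \<omega>)\<^sup>2 - 1 / \<epsilon> * (C k \<omega>)\<^sup>2)"
      by (simp only: sum_subtractf sum_distrib_left)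
    also have "\<dots> \<le> (\<Sum>k=1..K. (A k \<omega> + C k \<omega>)\<^sup>2)"
      by (intro sum_mono square_sum_bounds \<epsilon>)
    finally have "1 / real K * ((1 - \<epsilon>) * (\<Sum>k=1..K. (A k \<omega>)\<^sup>2) - 1 / \<epsilon> * (\<Sum>k=1..K. (C k \<omega>)\<^sup>2)) \<le>
       1 / real K * (\<Sum>k=1..K. (A k \<omega> + C k \<omega>)\<^sup>2)"
      by (intro mult_left_mono) auto
    then show ?thesis unfolding fY[OF that] fX fZ by (simp only: right_diff_distrib mult.left_commute)
  qed
  have EY: "v \<bullet> (EW S j n *\<^sub>v v) = (LINT \<omega>|prb S. v \<bullet> (Wmat S j n \<omega> *\<^sub>v v))"
    and MX: "x \<bullet> (MX *\<^sub>v x) = (LINT \<omega>|prb S. x \<bullet> (WX S j n \<omega> *\<^sub>v x))"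
    and MZ: "v \<bullet> (MZ *\<^sub>v v) = (LINT \<omega>|prb S. v \<bullet> (WZ S j n \<omega> *\<^sub>v v))"
    using eY(2) eX(2) eZ(2) by (simp_all add: EW_def MX_def MZ_def WY WX WZ p_def r_def)
  have iY: "integrable (prb S) (\<lambda>\<omega>. v \<bullet> (Wmat S j n \<omega> *\<^sub>v v))"
    and iX: "integrable (prb S) (\<lambda>\<omega>. x \<bullet> (WX S j n \<omega> *\<^sub>v x))"
    and iZ: "integrable (prb S) (\<lambda>\<omega>. v \<bullet> (WZ S j n \<omega> *\<^sub>v v))"
    using eY(1) eX(1) eZ(1) by (simp_all add: WY WX WZ)
  have "(LINT \<omega>|prb S. v \<bullet> (Wmat S j n \<omega> *\<^sub>v v)) \<le>
     (LINT \<omega>|prb S. (1 + \<epsilon>) * (x \<bullet> (WX S j n \<omega> *\<^sub>v x)) + (1 + 1 / \<epsilon>) * (v \<bullet> (WZ S j n \<omega> *\<^sub>v v)))"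
    using up iY iX iZ by (intro integral_mono) auto
  also have "\<dots> = (1 + \<epsilon>) * (x \<bullet> (MX *\<^sub>v x)) + (1 + 1 / \<epsilon>) * (v \<bullet> (MZ *\<^sub>v v))"
    unfolding MX MZ using iX iZ by simp
  finally show "v \<bullet> (EW S j n *\<^sub>v v) \<le> (1 + \<epsilon>) * (x \<bullet> (MX *\<^sub>v x)) + (1 + 1 / \<epsilon>) * (v \<bullet> (MZ *\<^sub>v v))"
    unfolding EY .
  have "(1 - \<epsilon>) * (x \<bullet> (MX *\<^sub>v x)) - 1 / \<epsilon> * (v \<bullet> (MZ *\<^sub>v v)) =
     (LINT \<omega>|prb S. (1 - \<epsilon>) * (x \<bullet> (WX S j n \<omega> *\<^sub>v x)) - 1 / \<epsilon> * (v \<bullet> (WZ S j n \<omega> *\<^sub>v v)))"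
    unfolding MX MZ using iX iZ by simp
  also have "\<dots> \<le> (LINT \<omega>|prb S. v \<bullet> (Wmat S j n \<omega> *\<^sub>v v))"
    using lo iY iX iZ by (intro integral_mono) auto
  finally show "(1 - \<epsilon>) * (x \<bullet> (MX *\<^sub>v x)) - 1 / \<epsilon> * (v \<bullet> (MZ *\<^sub>v v)) \<le> v \<bullet> (EW S j n *\<^sub>v v)"
    unfolding EY .
qed

section \<open>Consequences of the standing conditions\<close>

lemma vnorm_le_sum: "vnorm v \<le> (\<Sum>i<dim_vec v. \<bar>v $ i\<bar>)"
proof -
  have "vnorm v = L2_set (\<lambda>i. v $ i) {..<dim_vec v}"
    by (simp add: vnorm_def scalar_prod_def atLeast0LessThan L2_set_def power2_eq_square)
  then show ?thesis by (simp add: L2_set_le_sum_abs)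
qed

lemma abs_component_le_vnorm:
  assumes "i < dim_vec v" shows "\<bar>v $ i\<bar> \<le> vnorm v"
proof -
  have "(v $ i)\<^sup>2 \<le> (\<Sum>i<dim_vec v. (v $ i)\<^sup>2)" using assms by (intro member_le_sum) auto
  then have "sqrt ((v $ i)\<^sup>2) \<le> vnorm v"
    unfolding vnorm_def by (intro real_sqrt_le_mono) (simp add: scalar_prod_def atLeast0LessThan power2_eq_square)
  then show ?thesis by simp
qed

lemma vnorm_mult_le_op_norm:
  assumes v: "v \<in> carrier_vec (dim_col A)" "vnorm v \<le> 1"
  shows "vnorm (A *\<^sub>v v) \<le> op_norm A"
proof -
  have "vnorm (A *\<^sub>v w) \<le> (\<Sum>i<dim_row A. \<Sum>k<dim_col A. \<bar>A $$ (i, k)\<bar>)"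
    if w: "w \<in> carrier_vec (dim_col A)" "vnorm w \<le> 1" for w
  proof -
    have "\<bar>(A *\<^sub>v w) $ i\<bar> \<le> (\<Sum>k<dim_col A. \<bar>A $$ (i, k)\<bar>)" if i: "i < dim_row A" for i
    proof -
      have "\<bar>(A *\<^sub>v w) $ i\<bar> = \<bar>\<Sum>k<dim_col A. A $$ (i, k) * w $ k\<bar>"
        using i carrier_vecD[OF w(1)] by (simp add: scalar_prod_def atLeast0LessThan)
      also have "\<dots> \<le> (\<Sum>k<dim_col A. \<bar>A $$ (i, k) * w $ k\<bar>)" by (rule sum_abs)
      also have "\<dots> \<le> (\<Sum>k<dim_col A. \<bar>A $$ (i, k)\<bar> * 1)"
        unfolding abs_mult
      proof (intro sum_mono mult_left_mono)
        fix k assume "k \<in> {..<dim_col A}"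
        then have "\<bar>w $ k\<bar> \<le> vnorm w" using carrier_vecD[OF w(1)] by (intro abs_component_le_vnorm) simp
        then show "\<bar>w $ k\<bar> \<le> 1" using w(2) by linarith
      qed simp
      finally show ?thesis by simp
    qed
    then have "(\<Sum>i<dim_row A. \<bar>(A *\<^sub>v w) $ i\<bar>) \<le> (\<Sum>i<dim_row A. \<Sum>k<dim_col A. \<bar>A $$ (i, k)\<bar>)"
      by (intro sum_mono) simp
    then show ?thesis using vnorm_le_sum[of "A *\<^sub>v w"] by simp
  qed
  then have "bdd_above {vnorm (A *\<^sub>v v) | v. v \<in> carrier_vec (dim_col A) \<and> vnorm v \<le> 1}"
    by (intro bdd_aboveI[of _ "\<Sum>i<dim_row A. \<Sum>k<dim_col A. \<bar>A $$ (i, k)\<bar>"]) auto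
  then show ?thesis unfolding op_norm_def using v by (intro cSup_upper) auto
qed

lemma abs_entry_le_op_norm:
  assumes "i < dim_row A" "k < dim_col A"
  shows "\<bar>A $$ (i, k)\<bar> \<le> op_norm A"
proof -
  have "(A *\<^sub>v unit_vec (dim_col A) k) $ i = A $$ (i, k)" using assms by simp
  moreover have "vnorm (unit_vec (dim_col A) k) \<le> 1" using assms by (simp add: vnorm_def)
  ultimately show ?thesis
    using abs_component_le_vnorm[of i "A *\<^sub>v unit_vec (dim_col A) k"]
      vnorm_mult_le_op_norm[of "unit_vec (dim_col A) k" A] assms by simp
qed

lemma form_le_op_norm:
  assumes A: "A \<in> carrier_mat d d" and v: "v \<in> carrier_vec d"
  shows "v \<bullet> (A *\<^sub>v v) \<le> op_norm A * (v \<bullet> v)"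
proof (cases "v = 0\<^sub>v d")
  case True
  then show ?thesis using A by (simp add: scalar_prod_def)
next
  case False
  define s where "s = vnorm v"
  have s2: "s * s = v \<bullet> v" using scalar_prod_self_nonneg[of v] by (simp add: s_def vnorm_def)
  have s: "s > 0" using scalar_prod_self_pos[OF v False] by (simp add: s_def vnorm_def)
  define u where "u = (1 / s) \<cdot>\<^sub>v v"
  have u: "u \<in> carrier_vec d" using v by (simp add: u_def)
  have uu: "u \<bullet> u = 1"
  proof -
    have "u \<bullet> u = 1 / s * (1 / s * (v \<bullet> v))" using v by (simp add: u_def)
    then show ?thesis unfolding s2[symmetric] using s by simp
  qed
  have Au: "A *\<^sub>v u \<in> carrier_vec d" using A u by simp
  have "u \<bullet> (A *\<^sub>v u) = (\<Sum>i<d. u $ i * (A *\<^sub>v u) $ i)"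
    using carrier_vecD[OF Au] by (simp add: scalar_prod_def atLeast0LessThan)
  also have "\<dots> \<le> L2_set (\<lambda>i. u $ i) {..<d} * L2_set (\<lambda>i. (A *\<^sub>v u) $ i) {..<d}"
    using L2_set_mult_ineq[of "\<lambda>i. u $ i" "\<lambda>i. (A *\<^sub>v u) $ i" "{..<d}"]
    by (rule order_trans[rotated]) (auto intro!: sum_mono simp: abs_mult[symmetric])
  also have "L2_set (\<lambda>i. u $ i) {..<d} = sqrt (u \<bullet> u)"
    using carrier_vecD[OF u] by (simp add: L2_set_def scalar_prod_def atLeast0LessThan power2_eq_square)
  also have "L2_set (\<lambda>i. (A *\<^sub>v u) $ i) {..<d} = vnorm (A *\<^sub>v u)"
    using carrier_vecD[OF Au] by (simp add: L2_set_def vnorm_def scalar_prod_def atLeast0LessThan power2_eq_square)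
  also have "vnorm (A *\<^sub>v u) \<le> op_norm A"
    using vnorm_mult_le_op_norm[of u A] u A uu by (simp add: vnorm_def)
  finally have "u \<bullet> (A *\<^sub>v u) \<le> op_norm A" by (simp add: uu)
  moreover have "v \<bullet> (A *\<^sub>v v) = (s * s) * (u \<bullet> (A *\<^sub>v u))"
    using A v s by (simp add: u_def mult_mat_vec[of _ d d])
  ultimately show ?thesis using s2 s by (metis mult.commute mult_left_mono less_imp_le mult_pos_pos)
qed

text \<open>
  The quantity is deterministic: if it exceeded \<open>K\<close>, the event whose probability is at most 1/2
  would be the whole space.
\<close>

lemma cond_A2_noise_bound:
  assumes S: "prob_space (prb S)" and A2: "cond_A2 S j1 j2" and j: "j \<in> {j1..j2}"
  shows "\<exists>C. \<forall>\<^sub>F n in sequentially. op_norm (mat_expectation (prb S) (pdim S n) (pdim S n) (WZ S j n)) \<le> C"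
proof -
  interpret prob_space "prb S" by (rule S)
  define c where "c n = op_norm (mat_expectation (prb S) (pdim S n) (pdim S n) (WZ S j n))" for n
  define V where "V n \<omega> = Max {c n, op_norm (WZ S j n \<omega>),
          op_norm (mat_powr (real (ascale S n)) (- Hmat S - (1 / 2) \<cdot>\<^sub>m 1\<^sub>m (rdim S)) * WXZ S j n \<omega>)}" for n \<omega>
  have "bounded_in_prob (prb S) V" using A2 j by (simp add: cond_A2_def V_def[abs_def] c_def)
  then have V: "\<forall>\<^sub>F n in sequentially. V n \<in> borel_measurable (prb S)"
    and ex: "\<And>\<epsilon>. 0 < \<epsilon> \<Longrightarrow> \<exists>K. \<forall>\<^sub>F n in sequentially. measure (prb S) {\<omega>\<in>space (prb S). \<bar>V n \<omega>\<bar> > K} \<le> \<epsilon>"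
    unfolding bounded_in_prob_def by blast+
  obtain K where K: "\<forall>\<^sub>F n in sequentially. measure (prb S) {\<omega>\<in>space (prb S). \<bar>V n \<omega>\<bar> > K} \<le> 1 / 2"
    using ex[of "1 / 2"] by auto
  have "\<forall>\<^sub>F n in sequentially. c n \<le> K"
    using V K
  proof eventually_elim
    case (elim n)
    show ?case
    proof (rule ccontr)
      assume "\<not> c n \<le> K"
      moreover have "c n \<le> V n \<omega>" for \<omega> by (simp add: V_def)
      ultimately have "K < \<bar>V n \<omega>\<bar>" for \<omega> by (meson abs_ge_self less_le_trans not_le)
      then have "{\<omega>\<in>space (prb S). \<bar>V n \<omega>\<bar> > K} = space (prb S)" by auto
      then show False using elim(2) prob_space by simp
    qed
  qed
  then show ?thesis unfolding c_def by blast
qed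

lemma diagonal_asymp_cong:
  assumes "diagonal_asymp r \<eta> d F Z \<gamma>" "form_equiv r \<eta> F' F" "\<And>n. 0 \<le> \<eta> n" "\<forall>\<^sub>F n in sequentially. \<eta> n \<le> 1"
  shows "diagonal_asymp r \<eta> d F' Z \<gamma>"
proof -
  have "0 \<le> diag_form r \<gamma> d n u" for n u
    using assms(1) unfolding diag_form_def diagonal_asymp_def by (intro sum_nonneg) (auto simp: less_imp_le)
  then show ?thesis using assms form_equiv_trans[OF assms(2) _ assms(3,4)]
    unfolding diagonal_asymp_def by simp
qed

lemma approx_mat_op_norm:
  assumes "Y \<in> carrier_mat r r" "\<forall>\<^sub>F n in sequentially. X n \<in> carrier_mat r r"
    and "(\<lambda>n. op_norm (X n - Y)) \<in> O(\<eta>)"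
  shows "approx_mat r \<eta> X Y"
  unfolding approx_mat_def
proof (intro conjI allI impI)
  fix i k assume ik: "i < r" "k < r"
  have "\<forall>\<^sub>F n in sequentially. norm (X n $$ (i, k) - Y $$ (i, k)) \<le> norm (op_norm (X n - Y))"
    using assms(2)
  proof eventually_elim
    case (elim n)
    then show ?case using abs_entry_le_op_norm[of i "X n - Y" k] ik assms(1) by auto
  qed
  then show "(\<lambda>n. X n $$ (i, k) - Y $$ (i, k)) \<in> O(\<eta>)"
    by (intro landau_o.big_trans[OF landau_o.bigI[of 1] assms(3)]) auto
qed (use assms in auto)


lemma factor_model_D:
  assumes "factor_model S"
  shows "prob_space (prb S)" "1 \<le> rdim S" "PH S \<in> carrier_mat (rdim S) (rdim S)" "invertible_mat (PH S)"
    "- 1 / 2 < hexp S 1" "\<And>i k. 1 \<le> i \<Longrightarrow> i \<le> k \<Longrightarrow> k \<le> rdim S \<Longrightarrow> hexp S i \<le> hexp S k" "1 \<le> ascale S n"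
    "1 \<le> n \<Longrightarrow> Pmat S n \<in> carrier_mat (pdim S n) (rdim S)"
    "\<And>l. finite_variance_vec (prb S) (rdim S) (Xproc S l)"
proof -
  have "\<exists>k. ascale S n = 2 ^ k" using assms by (simp add: factor_model_def)
  then show "1 \<le> ascale S n" by auto
qed (use assms in \<open>auto simp: factor_model_def mono_on_def\<close>)

lemma varpi_bounds:
  assumes S: "factor_model S" and \<beta>: "0 < \<beta>"
  shows "0 < varpi S \<beta>" "varpi S \<beta> \<le> \<beta>" "2 * varpi S \<beta> \<le> hexp S 1 + 1 / 2"
    "2 \<le> i \<Longrightarrow> i \<le> rdim S \<Longrightarrow> hexp S (i - 1) < hexp S i \<Longrightarrow> varpi S \<beta> \<le> hexp S i - hexp S (i - 1)"
proof -
  let ?G = "{hexp S i - hexp S (i - 1) | i. i \<in> {2..rdim S} \<and> hexp S i - hexp S (i - 1) > 0}"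
  have fin: "finite (?G \<union> {\<beta>, hexp S 1 / 2 + 1 / 4})"
    by (auto intro!: finite_subset[of ?G "(\<lambda>i. hexp S i - hexp S (i - 1)) ` {2..rdim S}"])
  show "0 < varpi S \<beta>" unfolding varpi_def
    by (subst Min_gr_iff[OF fin]) (use \<beta> factor_model_D(5)[OF S] in auto)
  show "varpi S \<beta> \<le> \<beta>" unfolding varpi_def by (rule Min_le[OF fin]) simp
  have "varpi S \<beta> \<le> hexp S 1 / 2 + 1 / 4" unfolding varpi_def by (rule Min_le[OF fin]) simp
  then show "2 * varpi S \<beta> \<le> hexp S 1 + 1 / 2" by simp
  assume "2 \<le> i" "i \<le> rdim S" "hexp S (i - 1) < hexp S i"
  then show "varpi S \<beta> \<le> hexp S i - hexp S (i - 1)" unfolding varpi_def by (intro Min_le[OF fin]) auto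
qed

text \<open>
  The sequence \<open>\<surd>(n/a) a\<^bsup>-\<varpi>\<^esup>\<close> is the square root of \<open>n / a\<^bsup>2\<varpi>+1\<^esup>\<close>; it dominates \<open>a\<^bsup>-\<varpi>\<^esup>\<close> since
  \<open>n/a\<close> is eventually at least 1.
\<close>

lemma scale_rates:
  assumes S: "factor_model S" and \<beta>: "0 < \<beta>" and A4: "cond_A4 S j2 \<beta>"
  shows "(\<lambda>n. real (ascale S n) / real n) \<longlonglongrightarrow> 0"
    and "(\<lambda>n. sqrt (real n / real (ascale S n)) * real (ascale S n) powr (- varpi S \<beta>)) \<longlonglongrightarrow> 0"
    and "(\<lambda>n. real (ascale S n) powr (- varpi S \<beta>)) \<longlonglongrightarrow> 0"
proof -
  define a where "a n = real (ascale S n)" for n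
  define w where "w = varpi S \<beta>"
  have a: "1 \<le> a n" for n using factor_model_D(7)[OF S, of n] by (simp add: a_def)
  have a00: "0 \<le> a n" for n by (simp add: a_def)
  have lim: "(\<lambda>n. a n / real n + real n / a n powr (2 * w + 1)) \<longlonglongrightarrow> 0"
    using A4 by (simp add: cond_A4_def a_def w_def)
  have 1: "(\<lambda>n. a n / real n) \<longlonglongrightarrow> 0"
    by (rule tendsto_sandwich[OF _ _ tendsto_const lim]) (use a00 in auto)
  have 2: "(\<lambda>n. real n / a n powr (2 * w + 1)) \<longlonglongrightarrow> 0"
    by (rule tendsto_sandwich[OF _ _ tendsto_const lim]) (use a00 in auto)
  show "(\<lambda>n. real (ascale S n) / real n) \<longlonglongrightarrow> 0" using 1 by (simp add: a_def)
  have eq: "sqrt (real n / a n powr (2 * w + 1)) = sqrt (real n / a n) * a n powr (- w)" for n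
  proof -
    have a0: "0 < a n" using a[of n] by linarith
    have "real n / a n powr (2 * w + 1) = real n / a n * (a n powr (- w))\<^sup>2"
    proof -
      have "2 * w + 1 = w + w + 1" by simp
      then have "a n powr (2 * w + 1) = a n powr w * a n powr w * a n" using a0 by (simp only: powr_add) simp
      then show ?thesis by (simp add: powr_minus power2_eq_square field_simps)
    qed
    then show ?thesis by (simp only: real_sqrt_mult) simp
  qed
  have 3: "(\<lambda>n. sqrt (real n / a n) * a n powr (- w)) \<longlonglongrightarrow> 0"
    using tendsto_real_sqrt[OF 2] unfolding eq by simp
  show "(\<lambda>n. sqrt (real n / real (ascale S n)) * real (ascale S n) powr (- varpi S \<beta>)) \<longlonglongrightarrow> 0"
    using 3 by (simp add: a_def w_def)
  have "\<forall>\<^sub>F n in sequentially. a n / real n < 1" using order_tendstoD(2)[OF 1] by simp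
  then have "\<forall>\<^sub>F n in sequentially. a n powr (- w) \<le> sqrt (real n / a n) * a n powr (- w)"
    using eventually_gt_at_top[of 0]
  proof eventually_elim
    case (elim n)
    then have "1 \<le> real n / a n" using a[of n] by (simp add: field_simps)
    then have "1 \<le> sqrt (real n / a n)" by simp
    then show ?case using mult_right_mono[of 1 "sqrt (real n / a n)" "a n powr (- w)"] by simp
  qed
  then have "(\<lambda>n. a n powr (- w)) \<longlonglongrightarrow> 0"
    by (intro tendsto_sandwich[OF _ _ tendsto_const 3]) auto
  then show "(\<lambda>n. real (ascale S n) powr (- varpi S \<beta>)) \<longlonglongrightarrow> 0" by (simp add: a_def w_def)
qed

text \<open>
  In terms of forms, \<open>E W\<^sub>X = P\<^sub>H D B\<^sub>a D P\<^sub>H\<^sup>*\<close>.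
\<close>

lemma Bdet_form:
  fixes S :: "'a wav_model" and n j :: nat
  assumes S: "factor_model S" and W2: "cond_W2 (phi S) (psi S)"
    and x: "x \<in> carrier_vec (rdim S)"
  defines "y \<equiv> Matrix.vec (rdim S) (\<lambda>i. real (ascale S n) powr (hexp S (i + 1) + 1 / 2) * (transpose_mat (PH S) *\<^sub>v x) $ i)"
  shows "y \<bullet> (Bdet S j n *\<^sub>v y) = x \<bullet> (mat_expectation (prb S) (rdim S) (rdim S) (WX S j n) *\<^sub>v x)"
proof -
  define r where "r = rdim S"
  define e where "e i = real (ascale S n) powr (- hexp S (i + 1) - 1 / 2)" for i
  have a: "0 < ascale S n" using factor_model_D(7)[OF S, of n] by simp
  have Pc: "PH S \<in> carrier_mat r r" and Pi: "invertible_mat (PH S)" using factor_model_D[OF S] by (simp_all add: r_def)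
  obtain Pv where Pv: "Pv \<in> carrier_mat r r" "PH S * Pv = 1\<^sub>m r" "Pv * PH S = 1\<^sub>m r"
    by (rule invertible_mat_inverse[OF Pc Pi]) (rule that)
  have Wc: "WX S j n \<omega> \<in> carrier_mat r r" for \<omega> by (simp add: WX_def sample_cross_def r_def)
  have Be: "Bhat S j n \<omega> = mat_diag r e * (Pv * WX S j n \<omega> * transpose_mat Pv) * mat_diag r e" for \<omega>
    using Bhat_eq[of S Pv n j \<omega>] Pc Pv a Wc[of \<omega>] by (simp add: r_def e_def[abs_def])
  have Dc: "mat_diag r e \<in> carrier_mat r r" by simp
  have PvT: "transpose_mat Pv \<in> carrier_mat r r" using Pv by simp
  have PWc: "Pv * WX S j n \<omega> * transpose_mat Pv \<in> carrier_mat r r" for \<omega>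
    by (intro mult_square_mat Pv Wc PvT)
  have Bc: "Bhat S j n \<omega> \<in> carrier_mat r r" for \<omega> unfolding Be by (intro mult_square_mat PWc Dc)
  have xr: "x \<in> carrier_vec r" using x by (simp add: r_def)
  have y: "y \<in> carrier_vec r" by (simp add: y_def r_def)
  have Wint: "integrable (prb S) (\<lambda>\<omega>. WX S j n \<omega> $$ (i, k))" if "i < r" "k < r" for i k
    unfolding WX_def coefX_def by (rule sample_cross_integrable[OF W2 _ factor_model_D(9)[OF S]]) (use a that in \<open>auto simp: r_def\<close>)
  have Bik: "Bhat S j n \<omega> $$ (i, k) = (\<Sum>l<r. \<Sum>m<r. e i * e k * Pv $$ (i, m) * Pv $$ (k, l) * WX S j n \<omega> $$ (m, l))"
    if ik: "i < r" "k < r" for i k \<omega>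
  proof -
    have PW: "Pv * WX S j n \<omega> \<in> carrier_mat r r" by (intro mult_square_mat Pv Wc)
    have "Bhat S j n \<omega> $$ (i, k) = e i * (Pv * WX S j n \<omega> * transpose_mat Pv) $$ (i, k) * e k"
      unfolding Be using ik PWc[of \<omega>] by (simp add: mat_diag_mult_left[OF PWc] mat_diag_mult_right[of _ r r] del: index_mult_mat)
    also have "(Pv * WX S j n \<omega> * transpose_mat Pv) $$ (i, k) = (\<Sum>l<r. (Pv * WX S j n \<omega>) $$ (i, l) * Pv $$ (k, l))"
      using ik Pv(1) carrier_matD[OF PW] by (auto simp: scalar_prod_def atLeast0LessThan)
    also have "\<dots> = (\<Sum>l<r. (\<Sum>m<r. Pv $$ (i, m) * WX S j n \<omega> $$ (m, l)) * Pv $$ (k, l))"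
      using ik Pv(1) carrier_matD[OF Wc[of \<omega>]] by (auto simp: scalar_prod_def atLeast0LessThan)
    finally show ?thesis by (simp add: sum_distrib_left sum_distrib_right mult_ac)
  qed
  have Bint: "integrable (prb S) (\<lambda>\<omega>. Bhat S j n \<omega> $$ (i, k))" if "i < r" "k < r" for i k
    unfolding Bik[OF that] using Wint by (intro Bochner_Integration.integrable_sum integrable_mult_right) auto
  have form: "y \<bullet> (Bhat S j n \<omega> *\<^sub>v y) = x \<bullet> (WX S j n \<omega> *\<^sub>v x)" for \<omega>
  proof -
    have Dy: "mat_diag r e *\<^sub>v y = transpose_mat (PH S) *\<^sub>v x"
    proof (rule eq_vecI)
      fix i assume "i < dim_vec (transpose_mat (PH S) *\<^sub>v x)"
      then have i: "i < r" using Pc by simp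
      have "(mat_diag r e *\<^sub>v y) $ i = (\<Sum>k<dim_vec y. (if i = k then e k else 0) * y $ k)"
        using i y by (simp add: mat_diag_def scalar_prod_def atLeast0LessThan)
      also have "\<dots> = (\<Sum>k<r. if i = k then e k * y $ k else 0)"
        unfolding carrier_vecD[OF y] by (intro sum.cong) auto
      also have "\<dots> = e i * y $ i" using i by simp
      also have "\<dots> = (e i * real (ascale S n) powr (hexp S (i + 1) + 1 / 2)) * (transpose_mat (PH S) *\<^sub>v x) $ i"
        using i by (simp add: y_def r_def)
      also have "e i * real (ascale S n) powr (hexp S (i + 1) + 1 / 2) = 1"
        using a by (simp add: e_def flip: powr_add)
      finally show "(mat_diag r e *\<^sub>v y) $ i = (transpose_mat (PH S) *\<^sub>v x) $ i" by simp
    qed (use Pc in \<open>simp add: mat_diag_def\<close>)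
    have PTc: "transpose_mat (PH S) \<in> carrier_mat r r" using Pc by simp
    have "transpose_mat Pv *\<^sub>v (mat_diag r e *\<^sub>v y) = (transpose_mat Pv * transpose_mat (PH S)) *\<^sub>v x"
      unfolding Dy using assoc_mult_mat_vec[OF PvT PTc xr] ..
    also have "transpose_mat Pv * transpose_mat (PH S) = 1\<^sub>m r"
      unfolding transpose_mult[OF Pc Pv(1), symmetric] Pv(2) by simp
    finally have Px: "transpose_mat Pv *\<^sub>v (mat_diag r e *\<^sub>v y) = x" using xr by simp
    have Dyc: "mat_diag r e *\<^sub>v y \<in> carrier_vec r" using Dc y by (rule mult_mat_vec_carrier)
    have Wx: "WX S j n \<omega> *\<^sub>v x \<in> carrier_vec r" using Wc xr by (rule mult_mat_vec_carrier)
    have PWx: "Pv *\<^sub>v (WX S j n \<omega> *\<^sub>v x) \<in> carrier_vec r" using Pv(1) Wx by (rule mult_mat_vec_carrier)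
    have Dt: "transpose_mat (mat_diag r e) = mat_diag r e" by (intro eq_matI) (auto simp: mat_diag_def)
    have "Bhat S j n \<omega> *\<^sub>v y = mat_diag r e *\<^sub>v (Pv *\<^sub>v (WX S j n \<omega> *\<^sub>v (transpose_mat Pv *\<^sub>v (mat_diag r e *\<^sub>v y))))"
      unfolding Be
      using assoc_mult_mat_vec[OF mult_square_mat[OF Dc PWc] Dc y] assoc_mult_mat_vec[OF Dc PWc Dyc]
        assoc_mult_mat_vec[OF mult_square_mat[OF Pv(1) Wc] PvT Dyc] assoc_mult_mat_vec[OF Pv(1) Wc mult_mat_vec_carrier[OF PvT Dyc]]
      by simp
    then have "y \<bullet> (Bhat S j n \<omega> *\<^sub>v y) = y \<bullet> (mat_diag r e *\<^sub>v (Pv *\<^sub>v (WX S j n \<omega> *\<^sub>v x)))" unfolding Px by simp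
    also have "\<dots> = (mat_diag r e *\<^sub>v y) \<bullet> (Pv *\<^sub>v (WX S j n \<omega> *\<^sub>v x))"
      using transpose_vec_mult_scalar[OF Dc PWx y] unfolding Dt by simp
    also have "\<dots> = (transpose_mat Pv *\<^sub>v (mat_diag r e *\<^sub>v y)) \<bullet> (WX S j n \<omega> *\<^sub>v x)"
      using transpose_vec_mult_scalar[OF Pv(1) Wx Dyc] by simp
    finally show ?thesis unfolding Px .
  qed
  have "y \<bullet> (Bdet S j n *\<^sub>v y) = (LINT \<omega>|prb S. y \<bullet> (Bhat S j n \<omega> *\<^sub>v y))"
    unfolding Bdet_def r_def[symmetric] by (rule mat_expectation_form(2)[OF Bc Bint y])
  also have "\<dots> = (LINT \<omega>|prb S. x \<bullet> (WX S j n \<omega> *\<^sub>v x))" unfolding form ..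
  also have "\<dots> = x \<bullet> (mat_expectation (prb S) r r (WX S j n) *\<^sub>v x)"
    by (rule mat_expectation_form(2)[OF Wc Wint xr, symmetric])
  finally show ?thesis by (simp add: r_def)
qed

section \<open>The rate for the deterministic eigenvalues\<close>

lemma more_rows_than_columns:
  fixes Q :: rmat
  assumes Q: "Q \<in> carrier_mat p r" "transpose_mat Q * Q = 1\<^sub>m r"
  shows "r \<le> p"
proof (rule ccontr)
  assume "\<not> r \<le> p"
  then obtain v where v: "v \<in> carrier_vec r" "v \<noteq> 0\<^sub>v r" "\<forall>i<p. row Q i \<bullet> v = 0"
    using underdetermined_system[of p "\<lambda>i. row Q i" r] Q row_carrier[of Q] by auto
  then have "Q *\<^sub>v v = 0\<^sub>v p" using Q by (intro eq_vecI) auto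
  then have "v \<bullet> v = 0" using gram_form[OF Q(1) v(1)] Q(2) v(1) by simp
  then show False using scalar_prod_self_pos[OF v(1,2)] by simp
qed

lemma EW_symmetric:
  "EW S j n \<in> carrier_mat (pdim S n) (pdim S n)" "transpose_mat (EW S j n) = EW S j n"
proof -
  show "EW S j n \<in> carrier_mat (pdim S n) (pdim S n)" by (simp add: EW_def mat_expectation_def)
  have "Wmat S j n \<omega> $$ (k, i) = Wmat S j n \<omega> $$ (i, k)" if "i < pdim S n" "k < pdim S n" for i k \<omega>
    using that by (simp add: Wmat_def sample_cross_def mult.commute)
  then show "transpose_mat (EW S j n) = EW S j n"
    by (intro eq_matI) (auto simp: EW_def mat_expectation_def)
qed

text \<open>
  Three errors enter, all \<open>O(a\<^bsup>-\<varpi>\<^esup>)\<close>: the distances of \<open>R(n)\<close> and \<open>B\<^sub>a\<close> from their limits, the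
  ratios of different scales (by the gaps between the exponents), and the noise. For the latter
  the parameter \<open>\<epsilon>\<close> of \<open>EW_form_bounds\<close> is \<open>a\<^bsup>-\<varpi>\<^esup>\<close>; the remaining absolute error of order \<open>a\<^bsup>\<varpi>\<^esup>\<close> is
  small against every eigenvalue because \<open>2 \<varpi> \<le> h\<^sub>1 + 1/2\<close>.
\<close>

lemma EW_eigenvalue_rate:
  assumes S: "factor_model S" and W2: "cond_W2 (phi S) (psi S)"
    and A2: "cond_A2 S j1 j2" and A3: "cond_A3 S j1 j2 \<beta> B" and A4: "cond_A4 S j2 \<beta>" and A5: "cond_A5 S \<beta>"
    and j: "j \<in> {j1..j2}"
    and cases: "strict_mono_on {1..rdim S} (hexp S) \<or> (\<forall>q\<in>{1..rdim S}. hexp S q = hexp S 1)"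
  shows "\<exists>\<gamma>. \<forall>q\<in>{1..rdim S}. 0 < \<gamma> q \<and>
     (\<lambda>n. top_eig S n q (EW S j n) / real (ascale S n) powr (2 * hexp S q + 1) - \<gamma> q)
       \<in> O(\<lambda>n. real (ascale S n) powr (- varpi S \<beta>))"
proof -
  define r where "r = rdim S"
  define a where "a n = real (ascale S n)" for n
  define w where "w = varpi S \<beta>"
  define \<eta> where "\<eta> n = a n powr (- w)" for n
  define h where "h i = hexp S (i + 1)" for i
  define d where "d n i = a n powr (h i + 1 / 2)" for n i
  have \<beta>: "0 < \<beta>" using A3 by (simp add: cond_A3_def)
  note w_bounds = varpi_bounds[OF S \<beta>, folded w_def]
  have a1: "1 \<le> a n" for n using factor_model_D(7)[OF S, of n] by (simp add: a_def)
  have a0: "0 < a n" for n using a1[of n] by linarith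
  have \<eta>0: "0 \<le> \<eta> n" "0 < \<eta> n" for n using a0[of n] by (simp_all add: \<eta>_def)
  have \<eta>1: "\<eta> n \<le> 1" for n using w_bounds(1) a1[of n] powr_mono[of "- w" 0 "a n"] by (simp add: \<eta>_def)
  have \<eta>lim: "\<eta> \<longlonglongrightarrow> 0" using scale_rates(3)[OF S \<beta> A4] by (simp add: \<eta>_def[abs_def] a_def w_def)
  have d0: "0 < d n i" for n i using a0[of n] by (simp add: d_def)
  have Bpd: "pos_def r (B j)" and Brate: "(\<lambda>n. op_norm (Bdet S j n - B j)) \<in> O(\<lambda>n. a n powr (- \<beta>))"
    using A3 j by (simp_all add: cond_A3_def r_def a_def)
  obtain Q R A L where QR0: "\<forall>n\<ge>1. Q n \<in> carrier_mat (pdim S n) (rdim S) \<and>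
        transpose_mat (Q n) * Q n = 1\<^sub>m (rdim S) \<and>
        R n \<in> carrier_mat (rdim S) (rdim S) \<and> invertible_mat (R n) \<and> upper_triangular (R n) \<and>
        Pmat S n * PH S = Q n * R n"
     and A: "pos_def (rdim S) A" and L: "L \<in> carrier_mat (rdim S) (rdim S)" "A = transpose_mat L * L"
     and Rrate: "(\<lambda>n. op_norm (R n - L)) \<in> O(\<lambda>n. real (ascale S n) powr (- varpi S \<beta>))"
    using A5 unfolding cond_A5_def by blast
  have QR: "Q n \<in> carrier_mat (pdim S n) r" "transpose_mat (Q n) * Q n = 1\<^sub>m r"
     "R n \<in> carrier_mat r r" "Pmat S n * PH S = Q n * R n" if "1 \<le> n" for n
    using QR0 that by (simp_all add: r_def)
  note A = A[folded r_def] and L = L[folded r_def] and Rrate = Rrate[folded a_def w_def, folded \<eta>_def]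
  have Rapp: "approx_mat r \<eta> R L"
    by (rule approx_mat_op_norm[OF L(1) eventually_sequentiallyI[of 1, OF QR(3)] Rrate])
  have "(\<lambda>n. a n powr (- \<beta>)) \<in> O(\<eta>)"
    using a1 w_bounds(2) by (intro bigoI[of _ 1] always_eventually allI) (auto simp: \<eta>_def intro!: powr_mono)
  then have "(\<lambda>n. op_norm (Bdet S j n - B j)) \<in> O(\<eta>)" by (rule landau_o.big_trans[OF Brate])
  then have Bapp: "approx_mat r \<eta> (\<lambda>n. Bdet S j n) (B j)"
    by (rule approx_mat_op_norm[rotated 2]) (use Bpd in \<open>auto simp: pos_def_def Bdet_def mat_expectation_def r_def\<close>)
  define F0 where "F0 n u = graded_vec r d R n u \<bullet> (B j *\<^sub>v graded_vec r d R n u)" for n u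
  define F where "F n u = graded_vec r d R n u \<bullet> (Bdet S j n *\<^sub>v graded_vec r d R n u)" for n u
  have "\<exists>Z \<gamma>. diagonal_asymp r \<eta> d F0 Z \<gamma>"
  proof -
    have LL: "pos_def r (transpose_mat L * L)" using A L by simp
    from cases show ?thesis
    proof
      assume st: "strict_mono_on {1..rdim S} (hexp S)"
      have "(\<lambda>n. d n i / d n k) \<in> O(\<eta>)" if ik: "i < k" "k < r" for i k
      proof -
        have "hexp S k < hexp S (k + 1)" using st ik by (auto simp: strict_mono_on_def r_def)
        then have "w \<le> hexp S (k + 1) - hexp S k" using w_bounds(4)[of "k + 1"] ik by (simp add: r_def)
        moreover have "hexp S (i + 1) \<le> hexp S k" using factor_model_D(6)[OF S, of "i + 1" k] ik by (simp add: r_def)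
        ultimately have "h i + 1 / 2 - (h k + 1 / 2) \<le> - w" by (simp add: h_def)
        then have "d n i / d n k \<le> \<eta> n" for n
          using a1[of n] a0[of n] unfolding d_def \<eta>_def by (simp flip: powr_diff) (intro powr_mono; simp)
        moreover have "0 \<le> d n i / d n k" for n using d0[of n i] d0[of n k] by simp
        ultimately show ?thesis using \<eta>0(1)
          by (intro bigoI[of _ 1] always_eventually allI) (simp only: real_norm_def abs_of_nonneg mult_1)
      qed
      then show ?thesis unfolding F0_def using graded_form_separated_scales[OF Rapp \<eta>0(1) \<eta>lim Bpd LL d0] by simp
    next
      assume eq: "\<forall>q\<in>{1..rdim S}. hexp S q = hexp S 1"
      have "\<eta> \<in> O(\<lambda>_. 1)" using \<eta>lim by (intro bigoI_tendsto[where c = 0]) auto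
      moreover have "d n i = a n powr (hexp S 1 + 1 / 2)" if "i < r" for n i
      proof -
        have "hexp S (i + 1) = hexp S 1" using that by (intro eq[THEN bspec]) (simp add: r_def)
        then show ?thesis by (simp add: d_def h_def)
      qed
      ultimately show ?thesis unfolding F0_def
        using graded_form_equal_scales[OF Rapp \<eta>0(1) _ Bpd LL, where d = d and s = "\<lambda>n. a n powr (hexp S 1 + 1 / 2)"] by simp
    qed
  qed
  then obtain Z \<gamma> where dia0: "diagonal_asymp r \<eta> d F0 Z \<gamma>" by blast
  have "form_equiv r \<eta> F F0"
    unfolding F_def F0_def by (rule approx_pos_def_form_equiv[OF Bapp Bpd \<eta>0(1)]) (simp add: graded_vec_def)
  then have dia: "diagonal_asymp r \<eta> d F Z \<gamma>"
    by (rule diagonal_asymp_cong[OF dia0]) (use \<eta>0 \<eta>1 in auto)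
  obtain C0 where C0: "\<forall>\<^sub>F n in sequentially. op_norm (mat_expectation (prb S) (pdim S n) (pdim S n) (WZ S j n)) \<le> C0"
    using cond_A2_noise_bound[OF factor_model_D(1)[OF S] A2 j] by blast
  define C where "C = max C0 0"
  have C: "0 \<le> C" "\<forall>\<^sub>F n in sequentially. op_norm (mat_expectation (prb S) (pdim S n) (pdim S n) (WZ S j n)) \<le> C"
    using C0 by (auto simp: C_def elim: eventually_mono)
  (* splitting off the noise with \<epsilon> = \<eta> costs this absolute error, of order 1 / \<eta> *)
  define e where "e n = (1 + 1 / \<eta> n) * C" for n
  have e0: "0 \<le> e n" for n using \<eta>0(2)[of n] C(1) by (simp add: e_def)
  have eO: "(\<lambda>n. e n / (d n i)\<^sup>2) \<in> O(\<eta>)" if i: "i < r" for i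
  proof -
    have "norm (e n / (d n i)\<^sup>2) \<le> (2 * C) * norm (\<eta> n)" for n
    proof -
      have "hexp S 1 \<le> h i" using factor_model_D(6)[OF S, of 1 "i + 1"] i by (simp add: h_def r_def)
      then have "2 * w \<le> 2 * h i + 1" using w_bounds(1,3) by linarith
      then have "a n powr (2 * w) \<le> a n powr (2 * h i + 1)" using a1[of n] by (rule powr_mono)
      also have "a n powr (2 * h i + 1) = (d n i)\<^sup>2"
        unfolding d_def power2_eq_square by (simp flip: powr_add)
      also have "a n powr (2 * w) = 1 / (\<eta> n * \<eta> n)"
        using a0[of n] unfolding \<eta>_def by (simp add: powr_minus field_simps flip: powr_add)
      finally have "1 \<le> (d n i)\<^sup>2 * (\<eta> n * \<eta> n)" using \<eta>0(2)[of n] by (simp add: field_simps)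
      then have dd: "1 / \<eta> n \<le> \<eta> n * (d n i)\<^sup>2" using \<eta>0(2)[of n] by (simp add: field_simps)
      have "1 \<le> 1 / \<eta> n" using \<eta>0(2)[of n] \<eta>1[of n] by simp
      then have "e n \<le> (2 * (1 / \<eta> n)) * C" unfolding e_def using C(1) by (intro mult_right_mono) auto
      also have "\<dots> \<le> (2 * (\<eta> n * (d n i)\<^sup>2)) * C" using dd C(1) by (intro mult_right_mono) auto
      finally have "e n \<le> 2 * C * \<eta> n * (d n i)\<^sup>2" by (simp add: mult_ac)
      then have "e n / (d n i)\<^sup>2 \<le> 2 * C * \<eta> n" using d0[of n i] by (simp add: divide_le_eq)
      then show ?thesis using e0[of n] \<eta>0(1)[of n] by simp
    qed
    then show ?thesis by (intro bigoI[of _ "2 * C"]) simp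
  qed
  define EXn where "EXn n = mat_expectation (prb S) r r (WX S j n)" for n
  define EZn where "EZn n = mat_expectation (prb S) (pdim S n) (pdim S n) (WZ S j n)" for n
  have Fx: "(transpose_mat (Pmat S n) *\<^sub>v v) \<bullet> (EXn n *\<^sub>v (transpose_mat (Pmat S n) *\<^sub>v v)) = F n (transpose_mat (Q n) *\<^sub>v v)"
    if n: "1 \<le> n" and v: "v \<in> carrier_vec (pdim S n)" for n v
  proof -
    define x where "x = transpose_mat (Pmat S n) *\<^sub>v v"
    have P: "Pmat S n \<in> carrier_mat (pdim S n) r" "PH S \<in> carrier_mat r r"
      using factor_model_D(3,8)[OF S] n by (simp_all add: r_def)
    have x: "x \<in> carrier_vec r" using P v by (simp add: x_def)
    have "transpose_mat (PH S) *\<^sub>v x = transpose_mat (Pmat S n * PH S) *\<^sub>v v"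
      unfolding x_def transpose_mult[OF P] using P v by (simp add: assoc_mult_mat_vec[of _ r r _ "pdim S n"])
    also have "\<dots> = transpose_mat (R n) *\<^sub>v (transpose_mat (Q n) *\<^sub>v v)"
      unfolding QR(4)[OF n] transpose_mult[OF QR(1)[OF n] QR(3)[OF n]] using QR(1,3)[OF n] v
      by (simp add: assoc_mult_mat_vec[of _ r r _ "pdim S n"])
    finally have "Matrix.vec (rdim S) (\<lambda>i. real (ascale S n) powr (hexp S (i + 1) + 1 / 2) * (transpose_mat (PH S) *\<^sub>v x) $ i)
        = graded_vec r d R n (transpose_mat (Q n) *\<^sub>v v)"
      by (simp add: graded_vec_def d_def r_def a_def h_def)
    then show ?thesis using Bdet_form[OF S W2, of x n j] x by (simp add: F_def EXn_def r_def x_def)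
  qed
  have EZb: "v \<bullet> (EZn n *\<^sub>v v) \<le> C * (v \<bullet> v)" if "op_norm (EZn n) \<le> C" "v \<in> carrier_vec (pdim S n)" for n v
  proof -
    have "v \<bullet> (EZn n *\<^sub>v v) \<le> op_norm (EZn n) * (v \<bullet> v)"
      using that by (intro form_le_op_norm[of _ "pdim S n"]) (auto simp: EZn_def mat_expectation_def)
    also have "\<dots> \<le> C * (v \<bullet> v)" using that(1) scalar_prod_self_nonneg by (intro mult_right_mono)
    finally show ?thesis .
  qed
  have upper: "\<forall>\<^sub>F n in sequentially. \<forall>v\<in>carrier_vec (pdim S n).
        v \<bullet> (EW S j n *\<^sub>v v) \<le> (1 + 1 * \<eta> n) * F n (transpose_mat (Q n) *\<^sub>v v) + e n * (v \<bullet> v)"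
    using C(2)[folded EZn_def] eventually_ge_at_top[of 1]
  proof eventually_elim
    case (elim n)
    show ?case
    proof
      fix v :: rvec assume v: "v \<in> carrier_vec (pdim S n)"
      have "v \<bullet> (EW S j n *\<^sub>v v) \<le> (1 + \<eta> n) * F n (transpose_mat (Q n) *\<^sub>v v) + (1 + 1 / \<eta> n) * (v \<bullet> (EZn n *\<^sub>v v))"
        using EW_form_bounds(1)[OF S W2 elim(2) \<eta>0(2)[of n] v, of j] Fx[OF elim(2) v]
        by (simp add: EXn_def EZn_def r_def)
      also have "(1 + 1 / \<eta> n) * (v \<bullet> (EZn n *\<^sub>v v)) \<le> (1 + 1 / \<eta> n) * (C * (v \<bullet> v))"
        using EZb[OF elim(1) v] \<eta>0(2)[of n] by (intro mult_left_mono) auto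
      finally show "v \<bullet> (EW S j n *\<^sub>v v) \<le> (1 + 1 * \<eta> n) * F n (transpose_mat (Q n) *\<^sub>v v) + e n * (v \<bullet> v)"
        by (simp add: e_def)
    qed
  qed
  have lower: "\<forall>\<^sub>F n in sequentially. \<forall>u\<in>carrier_vec r.
        (1 - 1 * \<eta> n) * F n u - e n * (u \<bullet> u) \<le> (Q n *\<^sub>v u) \<bullet> (EW S j n *\<^sub>v (Q n *\<^sub>v u))"
    using C(2)[folded EZn_def] eventually_ge_at_top[of 1]
  proof eventually_elim
    case (elim n)
    show ?case
    proof
      fix u :: rvec assume u: "u \<in> carrier_vec r"
      define v where "v = Q n *\<^sub>v u"
      have Qn: "Q n \<in> carrier_mat (pdim S n) r" "transpose_mat (Q n) * Q n = 1\<^sub>m r" using QR(1,2) elim(2) by auto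
      have v: "v \<in> carrier_vec (pdim S n)" using Qn(1) u by (simp add: v_def)
      have vv: "v \<bullet> v = u \<bullet> u" using gram_form[OF Qn(1) u] Qn(2) u by (simp add: v_def)
      have Qv: "transpose_mat (Q n) *\<^sub>v v = u"
        unfolding v_def using assoc_mult_mat_vec[of "transpose_mat (Q n)" r "pdim S n" "Q n" r u] Qn u by simp
      have 1: "(1 - \<eta> n) * F n u - 1 / \<eta> n * (v \<bullet> (EZn n *\<^sub>v v)) \<le> v \<bullet> (EW S j n *\<^sub>v v)"
        using EW_form_bounds(2)[OF S W2 elim(2) \<eta>0(2)[of n] v, of j] Fx[OF elim(2) v] unfolding Qv
        by (simp add: EXn_def EZn_def r_def)
      have "1 / \<eta> n * (v \<bullet> (EZn n *\<^sub>v v)) \<le> 1 / \<eta> n * (C * (u \<bullet> u))"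
        using EZb[OF elim(1) v] \<eta>0(2)[of n] unfolding vv by (intro mult_left_mono) auto
      also have "\<dots> \<le> (1 + 1 / \<eta> n) * (C * (u \<bullet> u))"
        using C(1) scalar_prod_self_nonneg[of u] by (intro mult_right_mono) auto
      finally have 2: "1 / \<eta> n * (v \<bullet> (EZn n *\<^sub>v v)) \<le> e n * (u \<bullet> u)" by (simp add: e_def mult.assoc)
      show "(1 - 1 * \<eta> n) * F n u - e n * (u \<bullet> u) \<le> (Q n *\<^sub>v u) \<bullet> (EW S j n *\<^sub>v (Q n *\<^sub>v u))"
        using order_trans[OF diff_left_mono[OF 2] 1] by (simp add: v_def)
    qed
  qed
  have Qev: "\<forall>\<^sub>F n in sequentially. Q n \<in> carrier_mat (pdim S n) r \<and> transpose_mat (Q n) * Q n = 1\<^sub>m r \<and> r \<le> pdim S n"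
    using eventually_ge_at_top[of 1]
  proof eventually_elim
    case (elim n)
    then show ?case using QR(1,2) more_rows_than_columns[of "Q n" "pdim S n" r] by blast
  qed
  have Sev: "\<forall>\<^sub>F n in sequentially. EW S j n \<in> carrier_mat (pdim S n) (pdim S n) \<and> transpose_mat (EW S j n) = EW S j n"
    by (intro always_eventually allI conjI EW_symmetric)
  have "0 < \<gamma> (q - 1) \<and> (\<lambda>n. top_eig S n q (EW S j n) / a n powr (2 * hexp S q + 1) - \<gamma> (q - 1)) \<in> O(\<eta>)"
    if q: "q \<in> {1..r}" for q
  proof
    show "0 < \<gamma> (q - 1)" using dia q by (auto simp: diagonal_asymp_def)
    have "(d n (q - 1))\<^sup>2 = a n powr (2 * hexp S q + 1)" for n
      unfolding d_def power2_eq_square using q by (simp add: h_def flip: powr_add)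
    then show "(\<lambda>n. top_eig S n q (EW S j n) / a n powr (2 * hexp S q + 1) - \<gamma> (q - 1)) \<in> O(\<eta>)"
      using top_eigenvalue_asymptotics[OF dia \<eta>0(1) \<eta>lim Sev Qev upper lower _ d0 e0 eO, of q] q
      by (simp add: top_eig_def r_def)
  qed
  then show ?thesis by (intro exI[of _ "\<lambda>q. \<gamma> (q - 1)"]) (simp add: r_def a_def \<eta>_def[abs_def] w_def)
qed

section \<open>Weak convergence under affine maps\<close>

lemma measurable_coords:
  assumes "random_vec M d V"
  shows "(\<lambda>\<omega>. coords d (V \<omega>)) \<in> measurable M (PiM {..<d} (\<lambda>_. borel))"
  using assms unfolding random_vec_def coords_def by (intro measurable_restrict) auto

lemma continuous_on_restricted:
  fixes f :: "(nat \<Rightarrow> real) \<Rightarrow> real"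
  assumes f: "continuous_map (powertop_real {..<d}) euclideanreal f"
  shows "continuous_on UNIV (\<lambda>x. f (restrict x {..<d}))"
proof -
  have "continuous_map (product_topology (\<lambda>_. euclideanreal) UNIV) (powertop_real {..<d}) (\<lambda>x::nat \<Rightarrow> real. restrict x {..<d})"
    unfolding continuous_map_componentwise
    by (auto intro!: continuous_map_product_projection[of _ UNIV "\<lambda>_. euclideanreal"])
  then have "continuous_map (product_topology (\<lambda>_. euclideanreal) UNIV) euclideanreal (f \<circ> (\<lambda>x. restrict x {..<d}))"
    using f by (rule continuous_map_compose)
  then show ?thesis by (simp add: euclidean_product_topology o_def)
qed

text \<open>
  On the full space \<open>nat \<Rightarrow> real\<close> the product and Borel \<open>\<sigma>\<close>-algebras agree; the finite product is
  embedded there by extending with zeros.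
\<close>

lemma continuous_map_measurable_PiM:
  fixes f :: "(nat \<Rightarrow> real) \<Rightarrow> real"
  assumes f: "continuous_map (powertop_real {..<d}) euclideanreal f"
  shows "f \<in> borel_measurable (PiM {..<d} (\<lambda>_. borel))"
proof -
  define g where "g x = f (restrict x {..<d})" for x :: "nat \<Rightarrow> real"
  have "g \<in> borel_measurable borel"
    unfolding g_def by (rule borel_measurable_continuous_onI[OF continuous_on_restricted[OF f]])
  then have g: "g \<in> borel_measurable (PiM UNIV (\<lambda>_. borel))"
    using measurable_cong_sets[OF sets_PiM_equal_borel refl] by blast
  have "(\<lambda>x i. if i < d then x i else 0) \<in> measurable (PiM {..<d} (\<lambda>_. borel)) (PiM UNIV (\<lambda>_. borel :: real measure))"
  proof (rule measurable_PiM_single')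
    show "(\<lambda>x. if i < d then x i else 0) \<in> borel_measurable (PiM {..<d} (\<lambda>_. borel :: real measure))" for i
      by (cases "i < d") (simp_all add: measurable_component_singleton)
  qed auto
  then have "(\<lambda>x. g (\<lambda>i. if i < d then x i else 0)) \<in> borel_measurable (PiM {..<d} (\<lambda>_. borel))"
    using g by (rule measurable_compose)
  moreover have "g (\<lambda>i. if i < d then x i else 0) = f x" if "x \<in> space (PiM {..<d} (\<lambda>_. borel))" for x
  proof -
    have "restrict (\<lambda>i. if i < d then x i else 0) {..<d} = x"
      using that by (auto simp: space_PiM PiE_def extensional_def restrict_def fun_eq_iff)
    then show ?thesis by (simp add: g_def)
  qed
  ultimately show ?thesis by (subst measurable_cong) auto
qed

text \<open>
  The metric on functions is a sum of coordinate distances with weights \<open>2\<^bsup>-i\<^esup>\<close>.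
\<close>

lemma fun_dist_le:
  fixes x y :: "nat \<Rightarrow> real"
  assumes "\<And>i. \<bar>x i - y i\<bar> \<le> \<delta>"
  shows "dist x y \<le> 2 * \<delta>"
proof (rule LIMSEQ_le_const)
  show "(\<lambda>N. 2 * \<delta> + (1 / 2) ^ N) \<longlonglongrightarrow> 2 * \<delta>"
    using tendsto_add[OF tendsto_const LIMSEQ_realpow_zero[of "1 / 2 :: real"], of "2 * \<delta>"] by simp
  have "dist x y \<le> 2 * \<delta> + (1 / 2) ^ N" for N
  proof -
    have "Max {dist (x (from_nat n)) (y (from_nat n)) | n. n \<le> N} \<le> \<delta>"
    proof (subst Max_le_iff)
      have "{dist (x (from_nat n)) (y (from_nat n)) | n. n \<le> N} = (\<lambda>n. dist (x (from_nat n)) (y (from_nat n))) ` {..N}" by auto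
      then show "finite {dist (x (from_nat n)) (y (from_nat n)) | n. n \<le> N}" by simp
    qed (use assms in \<open>auto simp: dist_real_def\<close>)
    then show ?thesis using dist_fun_le_dist_first_terms[of x y N] by linarith
  qed
  then show "\<exists>N. \<forall>n\<ge>N. dist x y \<le> 2 * \<delta> + (1 / 2) ^ n" by blast
qed

text \<open>
  Test the weak convergence with a continuous ramp that dominates the indicator of leaving a
  cube and whose integral under the limit law is small by dominated convergence.
\<close>

lemma weak_conv_vec_tight:
  assumes M: "prob_space M" and \<mu>: "prob_space \<mu>" "sets \<mu> = sets (PiM {..<d} (\<lambda>_. borel))"
    and V: "weak_conv_vec d M V \<mu>" and \<epsilon>: "0 < \<epsilon>"
  shows "\<exists>K>0. \<forall>\<^sub>F n in sequentially. measure M {\<omega>\<in>space M. \<exists>k<d. K < \<bar>V n \<omega> $ k\<bar>} < \<epsilon>"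
proof -
  interpret M: prob_space M by (rule M)
  interpret \<mu>: prob_space \<mu> by (rule \<mu>(1))
  define \<phi> where "\<phi> K x = min 1 (\<Sum>k<d. max 0 (\<bar>x k\<bar> - real K))" for K and x :: "nat \<Rightarrow> real"
  have \<phi>01: "0 \<le> \<phi> K x" "\<phi> K x \<le> 1" for K x by (auto simp: \<phi>_def intro!: sum_nonneg)
  have \<phi>c: "continuous_map (powertop_real {..<d}) euclideanreal (\<phi> K)" for K
    unfolding \<phi>_def by (intro continuous_intros) auto
  have \<phi>m: "\<phi> K \<in> borel_measurable \<mu>" for K
    using continuous_map_measurable_PiM[OF \<phi>c] measurable_cong_sets[OF \<mu>(2) refl] by blast
  have "(\<lambda>K. LINT x|\<mu>. \<phi> K x) \<longlonglongrightarrow> (LINT x|\<mu>. 0)"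
  proof (rule integral_dominated_convergence[where w = "\<lambda>_. 1"])
    show "AE x in \<mu>. (\<lambda>K. \<phi> K x) \<longlonglongrightarrow> 0"
    proof (rule AE_I2)
      fix x
      have "\<forall>\<^sub>F K in sequentially. \<phi> K x = 0"
      proof (rule eventually_sequentiallyI)
        fix K assume K: "nat \<lceil>\<Sum>k<d. \<bar>x k\<bar>\<rceil> \<le> K"
        have "\<bar>x k\<bar> \<le> real K" if "k < d" for k
        proof -
          have "\<bar>x k\<bar> \<le> (\<Sum>k<d. \<bar>x k\<bar>)" using that by (intro member_le_sum) auto
          also have "\<dots> \<le> real K" using K by linarith
          finally show ?thesis .
        qed
        then have "(\<Sum>k<d. max 0 (\<bar>x k\<bar> - real K)) = 0" by (intro sum.neutral) auto
        then show "\<phi> K x = 0" by (simp add: \<phi>_def)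
      qed
      then show "(\<lambda>K. \<phi> K x) \<longlonglongrightarrow> 0" by (rule tendsto_eventually)
    qed
    show "AE x in \<mu>. norm (\<phi> K x) \<le> 1" for K using \<phi>01 by auto
  qed (use \<phi>m in auto)
  then have "\<forall>\<^sub>F K in sequentially. (LINT x|\<mu>. \<phi> K x) < \<epsilon>" using \<epsilon> by (intro order_tendstoD(2)) auto
  then obtain K where K: "(LINT x|\<mu>. \<phi> K x) < \<epsilon>" by (auto simp: eventually_sequentially)
  have "bounded (\<phi> K ` topspace (powertop_real {..<d}))"
    using \<phi>01 by (intro boundedI[of _ 1]) auto
  then have "(\<lambda>n. LINT \<omega>|M. \<phi> K (coords d (V n \<omega>))) \<longlonglongrightarrow> (LINT x|\<mu>. \<phi> K x)"
    using V \<phi>c unfolding weak_conv_vec_def by blast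
  then have "\<forall>\<^sub>F n in sequentially. (LINT \<omega>|M. \<phi> K (coords d (V n \<omega>))) < \<epsilon>" using K by (rule order_tendstoD(2))
  moreover have "\<forall>\<^sub>F n in sequentially. random_vec M d (V n)" using V by (simp add: weak_conv_vec_def)
  ultimately have "\<forall>\<^sub>F n in sequentially. measure M {\<omega>\<in>space M. \<exists>k<d. real (K + 1) < \<bar>V n \<omega> $ k\<bar>} < \<epsilon>"
  proof eventually_elim
    case (elim n)
    define E where "E = {\<omega>\<in>space M. \<exists>k<d. real (K + 1) < \<bar>V n \<omega> $ k\<bar>}"
    have [measurable]: "(\<lambda>\<omega>. V n \<omega> $ k) \<in> borel_measurable M" if "k < d" for k
      using elim(2) that by (simp add: random_vec_def)
    have "E = (\<Union>k\<in>{..<d}. {\<omega>\<in>space M. real (K + 1) < \<bar>V n \<omega> $ k\<bar>})" by (auto simp: E_def)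
    also have "\<dots> \<in> sets M" by (intro sets.finite_UN) auto
    finally have E: "E \<in> sets M" .
    have \<phi>V: "(\<lambda>\<omega>. \<phi> K (coords d (V n \<omega>))) \<in> borel_measurable M"
      using measurable_coords[OF elim(2)] continuous_map_measurable_PiM[OF \<phi>c] by (rule measurable_compose)
    have "measure M E = (LINT \<omega>|M. indicator E \<omega>)" using E by simp
    also have "\<dots> \<le> (LINT \<omega>|M. \<phi> K (coords d (V n \<omega>)))"
    proof (rule integral_mono)
      show "integrable M (indicator E :: _ \<Rightarrow> real)"
        by (rule M.integrable_const_bound[where B = 1]) (use E in \<open>auto simp: indicator_def\<close>)
      show "integrable M (\<lambda>\<omega>. \<phi> K (coords d (V n \<omega>)))"
        by (rule M.integrable_const_bound[where B = 1]) (use \<phi>01 \<phi>V in auto)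
      fix \<omega> assume "\<omega> \<in> space M"
      show "indicator E \<omega> \<le> \<phi> K (coords d (V n \<omega>))"
      proof (cases "\<omega> \<in> E")
        case True
        then obtain k where k: "k < d" "real (K + 1) < \<bar>V n \<omega> $ k\<bar>" by (auto simp: E_def)
        have "1 \<le> max 0 (\<bar>coords d (V n \<omega>) k\<bar> - real K)" using k by (simp add: coords_def)
        also have "\<dots> \<le> (\<Sum>k<d. max 0 (\<bar>coords d (V n \<omega>) k\<bar> - real K))" using k by (intro member_le_sum) auto
        finally show ?thesis using True by (simp add: \<phi>_def)
      qed (use \<phi>01 in simp)
    qed
    finally show ?case using elim(1) by (simp add: E_def)
  qed
  then show ?thesis by (intro exI[of _ "real (K + 1)"]) auto
qed

text \<open>
  Slutsky's theorem for deterministic affine maps \<open>x \<mapsto> A\<^sub>n x + b\<^sub>n\<close> with \<open>A\<^sub>n \<rightarrow> W\<close> and \<open>b\<^sub>n \<rightarrow> 0\<close>. On a cube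
  that carries almost all mass of every law, \<open>f (A\<^sub>n x + b\<^sub>n) \<rightarrow> f (W x)\<close> uniformly, by uniform
  continuity of \<open>f\<close> on compact sets; the law of \<open>W x\<close> is identified by its characteristic function.
\<close>

lemma conv_dist_normal_affine:
  assumes M: "prob_space M" and conv: "conv_dist_normal d M V \<Sigma>" and \<Sigma>: "\<Sigma> \<in> carrier_mat d d"
    and W: "W \<in> carrier_mat r d"
    and A: "\<And>i k. i < r \<Longrightarrow> k < d \<Longrightarrow> (\<lambda>n. A n i k) \<longlonglongrightarrow> W $$ (i, k)"
    and b: "\<And>i. i < r \<Longrightarrow> (\<lambda>n. b n i) \<longlonglongrightarrow> 0"
    and U: "\<forall>\<^sub>F n in sequentially. \<forall>\<omega>\<in>space M. U n \<omega> = Matrix.vec r (\<lambda>i. (\<Sum>k<d. A n i k * V n \<omega> $ k) + b n i)"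
  shows "conv_dist_normal r M U (W * \<Sigma> * transpose_mat W)"
proof -
  interpret M: prob_space M by (rule M)
  obtain \<mu> where cn: "centered_normal d \<Sigma> \<mu>" and wc: "weak_conv_vec d M V \<mu>" using conv by (auto simp: conv_dist_normal_def)
  have \<mu>: "prob_space \<mu>" "sets \<mu> = sets (PiM {..<d} (\<lambda>_. borel))"
    and char: "\<And>t. t \<in> carrier_vec d \<Longrightarrow> (LINT x|\<mu>. iexp (\<Sum>i<d. t $ i * x i)) = complex_of_real (exp (- scalar_prod t (\<Sigma> *\<^sub>v t) / 2))"
    using cn by (auto simp: centered_normal_def)
  interpret \<mu>: prob_space \<mu> by (rule \<mu>(1))
  define T where "T x = restrict (\<lambda>i. \<Sum>k<d. W $$ (i, k) * x k) {..<r}" for x :: "nat \<Rightarrow> real"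
  define Tn where "Tn n x = restrict (\<lambda>i. (\<Sum>k<d. A n i k * x k) + b n i) {..<r}" for n and x :: "nat \<Rightarrow> real"
  have Tm: "T \<in> measurable \<mu> (PiM {..<r} (\<lambda>_. borel))"
  proof -
    have "T \<in> measurable (PiM {..<d} (\<lambda>_. borel)) (PiM {..<r} (\<lambda>_. borel))"
      unfolding T_def by (intro measurable_restrict) measurable
    then show ?thesis using measurable_cong_sets[OF \<mu>(2) refl] by blast
  qed
  define \<nu> where "\<nu> = distr \<mu> (PiM {..<r} (\<lambda>_. borel)) T"
  have rvV: "\<forall>\<^sub>F n in sequentially. random_vec M d (V n)" using wc by (simp add: weak_conv_vec_def)
  have cT: "continuous_map (powertop_real {..<d}) (powertop_real {..<r}) T"
    unfolding continuous_map_componentwise T_def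
    by (auto intro!: continuous_intros)
  have "centered_normal r (W * \<Sigma> * transpose_mat W) \<nu>"
    unfolding centered_normal_def
  proof (intro conjI ballI)
    show "prob_space \<nu>" unfolding \<nu>_def by (rule \<mu>.prob_space_distr[OF Tm])
    show "sets \<nu> = sets (PiM {..<r} (\<lambda>_. borel))" by (simp add: \<nu>_def)
    fix t :: rvec assume t: "t \<in> carrier_vec r"
    define s where "s = transpose_mat W *\<^sub>v t"
    have s: "s \<in> carrier_vec d" using W t by (simp add: s_def)
    have "(LINT x|\<nu>. iexp (\<Sum>i<r. t $ i * x i)) = (LINT x|\<mu>. iexp (\<Sum>i<r. t $ i * T x i))"
      unfolding \<nu>_def by (rule integral_distr[OF Tm]) measurable
    also have "\<dots> = (LINT x|\<mu>. iexp (\<Sum>k<d. s $ k * x k))"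
    proof -
      have "(\<Sum>i<r. t $ i * T x i) = (\<Sum>k<d. s $ k * x k)" for x
      proof -
        have "(\<Sum>i<r. t $ i * T x i) = (\<Sum>i<r. \<Sum>k<d. t $ i * W $$ (i, k) * x k)"
          by (simp add: T_def sum_distrib_left mult.assoc)
        also have "\<dots> = (\<Sum>k<d. \<Sum>i<r. t $ i * W $$ (i, k) * x k)" by (rule sum.swap)
        also have "\<dots> = (\<Sum>k<d. s $ k * x k)"
          using W carrier_vecD[OF t] by (simp add: s_def scalar_prod_def atLeast0LessThan sum_distrib_left mult_ac)
        finally show ?thesis .
      qed
      then show ?thesis by simp
    qed
    also have "\<dots> = complex_of_real (exp (- scalar_prod s (\<Sigma> *\<^sub>v s) / 2))" by (rule char[OF s])
    also have "scalar_prod s (\<Sigma> *\<^sub>v s) = t \<bullet> ((W * \<Sigma> * transpose_mat W) *\<^sub>v t)"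
    proof -
      have WT: "transpose_mat W \<in> carrier_mat d r" using W by simp
      have "(W * \<Sigma> * transpose_mat W) *\<^sub>v t = W *\<^sub>v (\<Sigma> *\<^sub>v s)"
        using assoc_mult_mat_vec[OF mult_carrier_mat[OF W \<Sigma>] WT t] assoc_mult_mat_vec[OF W \<Sigma> s] by (simp add: s_def)
      then show ?thesis using transpose_vec_mult_scalar[OF W mult_mat_vec_carrier[OF \<Sigma> s] t] by (simp add: s_def)
    qed
    finally show "(LINT x|\<nu>. iexp (\<Sum>i<r. t $ i * x i)) = complex_of_real (exp (- (t \<bullet> (W * \<Sigma> * transpose_mat W *\<^sub>v t)) / 2))" .
  qed
  moreover have "weak_conv_vec r M U \<nu>"
    unfolding weak_conv_vec_def
  proof (intro conjI allI impI)
    show rvU: "\<forall>\<^sub>F n in sequentially. random_vec M r (U n)"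
      using U rvV
    proof eventually_elim
      case (elim n)
      have [measurable]: "(\<lambda>\<omega>. V n \<omega> $ k) \<in> borel_measurable M" if "k < d" for k
        using elim(2) that by (simp add: random_vec_def)
      have "(\<lambda>\<omega>. U n \<omega> $ i) \<in> borel_measurable M" if i: "i < r" for i
      proof -
        have "(\<lambda>\<omega>. (\<Sum>k<d. A n i k * V n \<omega> $ k) + b n i) \<in> borel_measurable M" by measurable
        then show ?thesis using elim(1) i by (subst measurable_cong[where g = "\<lambda>\<omega>. (\<Sum>k<d. A n i k * V n \<omega> $ k) + b n i"]) auto
      qed
      then show ?case using elim(1) by (auto simp: random_vec_def)
    qed
    fix f :: "(nat \<Rightarrow> real) \<Rightarrow> real"
    assume f: "continuous_map (powertop_real {..<r}) euclideanreal f \<and> bounded (f ` topspace (powertop_real {..<r}))"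
    then have fc: "continuous_map (powertop_real {..<r}) euclideanreal f" by simp
    obtain C where C: "\<And>x. x \<in> topspace (powertop_real {..<r}) \<Longrightarrow> \<bar>f x\<bar> \<le> C"
      using f unfolding bounded_iff by auto
    have CT: "\<bar>f (T x)\<bar> \<le> C" "\<bar>f (Tn n x)\<bar> \<le> C" for n x by (auto intro!: C simp: T_def Tn_def)
    have C0: "0 \<le> C" using CT(1)[of "\<lambda>_. 0"] by linarith
    have fm: "f \<in> borel_measurable (PiM {..<r} (\<lambda>_. borel))" by (rule continuous_map_measurable_PiM[OF fc])
    have "continuous_map (powertop_real {..<d}) euclideanreal (f \<circ> T)" using cT fc by (rule continuous_map_compose)
    moreover have "bounded ((f \<circ> T) ` topspace (powertop_real {..<d}))"
      using CT by (intro boundedI[of _ C]) auto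
    ultimately have lim: "(\<lambda>n. LINT \<omega>|M. f (T (coords d (V n \<omega>)))) \<longlonglongrightarrow> (LINT x|\<mu>. f (T x))"
      using wc unfolding weak_conv_vec_def by (auto simp: o_def dest: spec[of _ "f \<circ> T"])
    have uniform: "\<forall>\<^sub>F n in sequentially. \<forall>x. (\<forall>k<d. \<bar>x k\<bar> \<le> K) \<longrightarrow> \<bar>f (Tn n x) - f (T x)\<bar> < \<epsilon>"
      if K: "0 < K" and \<epsilon>: "0 < \<epsilon>" for K \<epsilon> :: real
    proof -
      define \<delta> where "\<delta> n = (\<Sum>i<r. (\<Sum>k<d. \<bar>A n i k - W $$ (i, k)\<bar> * K) + \<bar>b n i\<bar>)" for n
      have \<delta>lim: "\<delta> \<longlonglongrightarrow> 0"
      proof -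
        have "(\<lambda>n. \<bar>A n i k - W $$ (i, k)\<bar> * K) \<longlonglongrightarrow> 0" if "i < r" "k < d" for i k
          using tendsto_mult_right[OF tendsto_rabs[OF tendsto_diff[OF A[OF that] tendsto_const[of "W $$ (i, k)"]]], of K] by simp
        moreover have "(\<lambda>n. \<bar>b n i\<bar>) \<longlonglongrightarrow> 0" if "i < r" for i using tendsto_rabs[OF b[OF that]] by simp
        ultimately have "\<delta> \<longlonglongrightarrow> (\<Sum>i<r. (\<Sum>k<d. 0) + 0)"
          unfolding \<delta>_def by (intro tendsto_sum tendsto_add) auto
        then show ?thesis by simp
      qed
      define S where "S = (\<Sum>i<r. \<Sum>k<d. \<bar>W $$ (i, k)\<bar> * K) + 1"
      define Cs where "Cs = PiE UNIV (\<lambda>_::nat. {-S..S})"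
      have Cs: "compact Cs" unfolding Cs_def
        using compactin_PiE[of "\<lambda>_. euclideanreal" UNIV "\<lambda>_::nat. {-S..S}"] by (auto simp: euclidean_product_topology)
      have "uniformly_continuous_on Cs (\<lambda>x. f (restrict x {..<r}))"
        by (rule compact_uniformly_continuous[OF continuous_on_subset[OF continuous_on_restricted[OF fc]] Cs]) simp
      then obtain \<rho> where \<rho>: "0 < \<rho>" "\<And>x y. x \<in> Cs \<Longrightarrow> y \<in> Cs \<Longrightarrow> dist y x < \<rho> \<Longrightarrow> dist (f (restrict y {..<r})) (f (restrict x {..<r})) < \<epsilon>"
        unfolding uniformly_continuous_on_def using \<epsilon> by blast
      have "\<forall>\<^sub>F n in sequentially. \<delta> n < min 1 (\<rho> / 2)" using \<rho>(1) by (intro order_tendstoD(2)[OF \<delta>lim]) auto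
      then show ?thesis
      proof eventually_elim
        case (elim n)
        show ?case
        proof (intro allI impI)
          fix x :: "nat \<Rightarrow> real" assume x: "\<forall>k<d. \<bar>x k\<bar> \<le> K"
          define y where "y i = (if i < r then \<Sum>k<d. W $$ (i, k) * x k else 0)" for i
          define z where "z i = (if i < r then (\<Sum>k<d. A n i k * x k) + b n i else 0)" for i
          have \<delta>0: "0 \<le> \<delta> n" unfolding \<delta>_def using K by (intro sum_nonneg add_nonneg_nonneg) auto
          have zy: "\<bar>z i - y i\<bar> \<le> \<delta> n" for i
          proof (cases "i < r")
            case True
            have "\<bar>z i - y i\<bar> = \<bar>(\<Sum>k<d. (A n i k - W $$ (i, k)) * x k) + b n i\<bar>"
              using True by (simp add: z_def y_def left_diff_distrib sum_subtractf)
            also have "\<dots> \<le> (\<Sum>k<d. \<bar>(A n i k - W $$ (i, k)) * x k\<bar>) + \<bar>b n i\<bar>"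
              by (intro order_trans[OF abs_triangle_ineq] add_right_mono sum_abs)
            also have "\<dots> \<le> (\<Sum>k<d. \<bar>A n i k - W $$ (i, k)\<bar> * K) + \<bar>b n i\<bar>"
              unfolding abs_mult using x by (intro add_right_mono sum_mono mult_left_mono) auto
            also have "\<dots> \<le> \<delta> n" unfolding \<delta>_def
              using True K by (intro member_le_sum[where f = "\<lambda>i. (\<Sum>k<d. \<bar>A n i k - W $$ (i, k)\<bar> * K) + \<bar>b n i\<bar>"]) (auto intro!: add_nonneg_nonneg sum_nonneg)
            finally show ?thesis .
          qed (use \<delta>0 in \<open>simp add: z_def y_def\<close>)
          have yS: "\<bar>y i\<bar> \<le> S - 1" for i
          proof (cases "i < r")
            case True
            have "\<bar>y i\<bar> \<le> (\<Sum>k<d. \<bar>W $$ (i, k) * x k\<bar>)" using True by (simp add: y_def)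
            also have "\<dots> \<le> (\<Sum>k<d. \<bar>W $$ (i, k)\<bar> * K)"
              unfolding abs_mult using x by (intro sum_mono mult_left_mono) auto
            also have "\<dots> \<le> (\<Sum>i<r. \<Sum>k<d. \<bar>W $$ (i, k)\<bar> * K)"
              using True K by (intro member_le_sum[where f = "\<lambda>i. \<Sum>k<d. \<bar>W $$ (i, k)\<bar> * K"]) (auto intro!: sum_nonneg)
            also have "\<dots> = S - 1" by (simp add: S_def)
            finally show ?thesis .
          next
            case False
            then show ?thesis unfolding S_def using K by (auto simp: y_def intro!: sum_nonneg)
          qed
          have "y \<in> Cs" "z \<in> Cs"
          proof -
            have "\<bar>y i\<bar> \<le> S" "\<bar>z i\<bar> \<le> S" for i using yS[of i] zy[of i] elim by (auto simp: abs_le_iff) 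
            then show "y \<in> Cs" "z \<in> Cs" by (auto simp: Cs_def abs_le_iff minus_le_iff)
          qed
          moreover have "dist z y < \<rho>" using fun_dist_le[of z y "\<delta> n", OF zy] elim by simp
          ultimately have "dist (f (restrict z {..<r})) (f (restrict y {..<r})) < \<epsilon>" by (intro \<rho>(2))
          moreover have "restrict z {..<r} = Tn n x" "restrict y {..<r} = T x"
            by (auto simp: z_def y_def Tn_def T_def restrict_def fun_eq_iff)
          ultimately show "\<bar>f (Tn n x) - f (T x)\<bar> < \<epsilon>" by (simp add: dist_real_def)
        qed
      qed
    qed
    have diff: "(\<lambda>n. (LINT \<omega>|M. f (coords r (U n \<omega>))) - (LINT \<omega>|M. f (T (coords d (V n \<omega>))))) \<longlonglongrightarrow> 0"
    proof (rule tendstoI)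
      fix e :: real assume e: "0 < e"
      define \<epsilon> where "\<epsilon> = e / (2 * (2 * C + 1))"
      have \<epsilon>: "0 < \<epsilon>" using e C0 by (simp add: \<epsilon>_def)
      obtain K where K: "0 < K" "\<forall>\<^sub>F n in sequentially. measure M {\<omega>\<in>space M. \<exists>k<d. K < \<bar>V n \<omega> $ k\<bar>} < \<epsilon>"
        using weak_conv_vec_tight[OF M \<mu> wc \<epsilon>] by blast
      have "0 < e / 2" using e by simp
      note unif = uniform[OF K(1) this]
      show "\<forall>\<^sub>F n in sequentially. dist ((LINT \<omega>|M. f (coords r (U n \<omega>))) - (LINT \<omega>|M. f (T (coords d (V n \<omega>))))) 0 < e"
        using K(2) unif U rvU rvV
      proof eventually_elim
        case (elim n)
        define E where "E = {\<omega>\<in>space M. \<exists>k<d. K < \<bar>V n \<omega> $ k\<bar>}"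
        have [measurable]: "(\<lambda>\<omega>. V n \<omega> $ k) \<in> borel_measurable M" if "k < d" for k
          using elim(5) that by (simp add: random_vec_def)
        have "E = (\<Union>k\<in>{..<d}. {\<omega>\<in>space M. K < \<bar>V n \<omega> $ k\<bar>})" by (auto simp: E_def)
        also have "\<dots> \<in> sets M" by (intro sets.finite_UN) auto
        finally have E: "E \<in> sets M" .
        have UT: "coords r (U n \<omega>) = Tn n (coords d (V n \<omega>))" if "\<omega> \<in> space M" for \<omega>
          using elim(3) that by (auto simp: coords_def Tn_def restrict_def fun_eq_iff)
        have mU: "(\<lambda>\<omega>. f (coords r (U n \<omega>))) \<in> borel_measurable M"
          using measurable_coords[OF elim(4)] fm by (rule measurable_compose)
        have mV: "(\<lambda>\<omega>. f (T (coords d (V n \<omega>)))) \<in> borel_measurable M"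
        proof -
          have "T \<in> measurable (PiM {..<d} (\<lambda>_. borel)) (PiM {..<r} (\<lambda>_. borel))"
            using Tm measurable_cong_sets[OF \<mu>(2) refl] by blast
          then show ?thesis using measurable_compose[OF measurable_compose[OF measurable_coords[OF elim(5)]] fm] by blast
        qed
        have iU: "integrable M (\<lambda>\<omega>. f (coords r (U n \<omega>)))"
          by (rule M.integrable_const_bound[where B = C]) (use mU CT UT in auto)
        have iV: "integrable M (\<lambda>\<omega>. f (T (coords d (V n \<omega>))))"
          by (rule M.integrable_const_bound[where B = C]) (use mV CT in auto)
        have iE: "integrable M (indicator E :: _ \<Rightarrow> real)"
          by (rule M.integrable_const_bound[where B = 1]) (use E in \<open>auto simp: indicator_def\<close>)
        have "\<bar>(LINT \<omega>|M. f (coords r (U n \<omega>))) - (LINT \<omega>|M. f (T (coords d (V n \<omega>))))\<bar> =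
            \<bar>LINT \<omega>|M. f (coords r (U n \<omega>)) - f (T (coords d (V n \<omega>)))\<bar>"
          using iU iV by simp
        also have "\<dots> \<le> (LINT \<omega>|M. \<bar>f (coords r (U n \<omega>)) - f (T (coords d (V n \<omega>)))\<bar>)"
          by (rule integral_abs_bound)
        also have "\<dots> \<le> (LINT \<omega>|M. e / 2 + 2 * C * indicator E \<omega>)"
        proof (rule integral_mono)
          show "integrable M (\<lambda>\<omega>. \<bar>f (coords r (U n \<omega>)) - f (T (coords d (V n \<omega>)))\<bar>)" using iU iV by simp
          show "integrable M (\<lambda>\<omega>. e / 2 + 2 * C * indicator E \<omega>)"
            by (intro Bochner_Integration.integrable_add integrable_mult_right iE) simp
          fix \<omega> assume \<omega>: "\<omega> \<in> space M"
          show "\<bar>f (coords r (U n \<omega>)) - f (T (coords d (V n \<omega>)))\<bar> \<le> e / 2 + 2 * C * indicator E \<omega>"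
          proof (cases "\<omega> \<in> E")
            case True
            then show ?thesis using CT(2)[of n "coords d (V n \<omega>)"] CT(1)[of "coords d (V n \<omega>)"] e unfolding UT[OF \<omega>] by auto
          next
            case False
            then have "\<forall>k<d. \<bar>coords d (V n \<omega>) k\<bar> \<le> K" using \<omega> by (auto simp: E_def coords_def)
            then have "\<bar>f (Tn n (coords d (V n \<omega>))) - f (T (coords d (V n \<omega>)))\<bar> < e / 2" using elim(2) by blast
            then show ?thesis using False unfolding UT[OF \<omega>] by simp
          qed
        qed
        also have "\<dots> = e / 2 + 2 * C * measure M E" using E iE M.prob_space by simp
        also have "\<dots> < e"
        proof -
          have "2 * C * measure M E \<le> 2 * C * \<epsilon>" using elim(1) C0 by (intro mult_left_mono) (auto simp: E_def)
          also have "\<dots> < (2 * C + 1) * \<epsilon>" using \<epsilon> by (simp add: algebra_simps)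
          also have "\<dots> = e / 2" using C0 by (simp add: \<epsilon>_def field_simps)
          finally show ?thesis by simp
        qed
        finally show ?case by (simp add: dist_real_def)
      qed
    qed
    have "(LINT x|\<nu>. f x) = (LINT x|\<mu>. f (T x))" unfolding \<nu>_def by (rule integral_distr[OF Tm fm])
    then show "(\<lambda>n. LINT \<omega>|M. f (coords r (U n \<omega>))) \<longlonglongrightarrow> (LINT x|\<nu>. f x)"
      using tendsto_add[OF diff lim] by simp
  qed
  ultimately show ?thesis unfolding conv_dist_normal_def by blast
qed

section \<open>Asymptotic normality of the estimator\<close>

lemma nth_concat_blocks:
  assumes "\<And>x. x \<in> set xs \<Longrightarrow> length (f x) = r" "m < length xs" "i < r"
  shows "concat (map f xs) ! (m * r + i) = f (xs ! m) ! i"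
  using assms
proof (induction xs arbitrary: m)
  case (Cons x xs)
  have l: "length (f x) = r" using Cons.prems by simp
  show ?case
  proof (cases m)
    case 0
    then show ?thesis using l Cons.prems by (simp add: nth_append)
  next
    case (Suc m')
    have "concat (map f xs) ! (m' * r + i) = f (xs ! m') ! i" using Cons.IH[of m'] Cons.prems Suc by simp
    then show ?thesis using l Suc by (simp add: nth_append add.assoc)
  qed
qed simp

lemma log_eig_fluct_nth:
  assumes "m \<le> j2 - j1" "j1 \<le> j2" "i < rdim S"
  shows "log_eig_fluct S j1 j2 n \<omega> $ (m * rdim S + i) = sqrt (real (neff S (j1 + m) n)) *
     (ln (top_eig S n (i + 1) (Wmat S (j1 + m) n \<omega>)) - ln (top_eig S n (i + 1) (EW S (j1 + m) n)))"
proof -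
  have nth: "[j1..<j2 + 1] ! m = j1 + m" using assms by (intro nth_upt) simp
  show ?thesis
    unfolding log_eig_fluct_def vec_of_list_index
    by (subst nth_concat_blocks[where r = "rdim S"]) (use assms nth in \<open>auto simp del: upt_Suc\<close>)
qed

lemma sum_blocks:
  fixes g :: "nat \<Rightarrow> real"
  shows "(\<Sum>c<m * r. g c) = (\<Sum>l<m. \<Sum>i<r. g (l * r + i))"
proof -
  have "(\<Sum>c<m * r. g c) = (\<Sum>l<m. sum g {l * r..<l * r + r})" by (rule sum.nat_group[symmetric])
  also have "\<dots> = (\<Sum>l<m. \<Sum>i<r. g (l * r + i))"
  proof (rule sum.cong[OF refl])
    show "sum g {l * r..<l * r + r} = (\<Sum>i<r. g (l * r + i))" for l
      using sum.shift_bounds_nat_ivl[of g 0 "l * r" r] by (simp add: atLeast0LessThan add.commute)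
  qed
  finally show ?thesis .
qed

lemma ln_rate:
  fixes g \<eta> :: "nat \<Rightarrow> real"
  assumes g: "(\<lambda>n. g n - c) \<in> O(\<eta>)" and c: "0 < c" and \<eta>: "\<eta> \<longlonglongrightarrow> 0"
  shows "(\<lambda>n. ln (g n) - ln c) \<in> O(\<eta>)" and "g \<longlonglongrightarrow> c"
proof -
  have "(\<lambda>n. g n - c) \<longlonglongrightarrow> 0"
    using smalloD_tendsto[OF landau_o.big_small_trans[OF g smalloI_tendsto[of \<eta> "\<lambda>_. 1"]]] \<eta> by simp
  then have gc: "(\<lambda>n. g n) \<longlonglongrightarrow> c" by (simp add: Lim_null[of g])
  then show "g \<longlonglongrightarrow> c" .
  have "\<forall>\<^sub>F n in sequentially. c / 2 < g n" using order_tendstoD(1)[OF gc, of "c / 2"] c by simp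
  then have "\<forall>\<^sub>F n in sequentially. norm (ln (g n) - ln c) \<le> 2 / c * norm (g n - c)"
  proof eventually_elim
    case (elim n)
    then have gp: "0 < g n" using c by linarith
    have "ln (g n) - ln c = ln (g n / c)" using gp c by (simp add: ln_div)
    also have "\<dots> \<le> g n / c - 1" using gp c by (intro ln_le_minus_one) simp
    also have "\<dots> = (g n - c) / c" using c by (simp add: field_simps)
    also have "\<dots> \<le> 2 / c * \<bar>g n - c\<bar>"
    proof -
      have "(g n - c) / c \<le> \<bar>g n - c\<bar> / c" using c by (intro divide_right_mono) auto
      moreover have "0 \<le> \<bar>g n - c\<bar> / c" using c by simp
      ultimately have "(g n - c) / c \<le> 2 * (\<bar>g n - c\<bar> / c)" by linarith
      then show ?thesis by simp
    qed
    finally have 1: "ln (g n) - ln c \<le> 2 / c * \<bar>g n - c\<bar>" .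
    have "ln c - ln (g n) = ln (c / g n)" using gp c by (simp add: ln_div)
    also have "\<dots> \<le> c / g n - 1" using gp c by (intro ln_le_minus_one) simp
    also have "\<dots> = (c - g n) / g n" using gp by (simp add: field_simps)
    also have "\<dots> \<le> \<bar>g n - c\<bar> / g n" using gp by (intro divide_right_mono) auto
    also have "\<dots> \<le> \<bar>g n - c\<bar> / (c / 2)" using elim c gp by (intro divide_left_mono) auto
    finally have 2: "ln c - ln (g n) \<le> 2 / c * \<bar>g n - c\<bar>" by (simp add: mult.commute)
    show ?case using 1 2 unfolding real_norm_def by linarith
  qed
  then have "(\<lambda>n. ln (g n) - ln c) \<in> O(\<lambda>n. g n - c)" by (rule bigoI)
  then show "(\<lambda>n. ln (g n) - ln c) \<in> O(\<eta>)" using g by (rule landau_o.big_trans)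
qed

text \<open>
  Rounding \<open>n / (a 2\<^sup>j)\<close> down to an integer changes the ratio to \<open>n/a\<close> by at most \<open>a/n\<close>.
\<close>

lemma sqrt_neff_ratio:
  assumes S: "factor_model S" and lim: "(\<lambda>n. real (ascale S n) / real n) \<longlonglongrightarrow> 0"
  shows "(\<lambda>n. sqrt (real n / real (ascale S n)) / sqrt (real (neff S j n))) \<longlonglongrightarrow> 2 powr (real j / 2)"
    and "(\<lambda>n. 1 / sqrt (real (neff S j n))) \<longlonglongrightarrow> 0"
proof -
  define a where "a n = real (ascale S n)" for n
  have a: "1 \<le> a n" for n using factor_model_D(7)[OF S, of n] by (simp add: a_def)
  define y where "y n = real (neff S j n) / (real n / a n)" for n
  have "(\<lambda>n. y n - 1 / 2 ^ j) \<longlonglongrightarrow> 0"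
  proof (rule Lim_null_comparison)
    show "(\<lambda>n. a n / real n) \<longlonglongrightarrow> 0" using lim by (simp add: a_def)
    show "\<forall>\<^sub>F n in sequentially. norm (y n - 1 / 2 ^ j) \<le> a n / real n"
      using eventually_gt_at_top[of 0]
    proof eventually_elim
      case (elim n)
      define k where "k = ascale S n * 2 ^ j"
      have k: "real k = a n * 2 ^ j" by (simp add: k_def a_def)
      have b: "\<bar>real (n div k) - real n / real k\<bar> \<le> 1"
        using floor_divide_of_nat_eq[of n k, where 'a = real] by linarith
      have eq: "y n - 1 / 2 ^ j = (real (n div k) - real n / real k) * (a n / real n)"
        unfolding y_def neff_def k_def[symmetric] k using elim a[of n] by (simp add: field_simps)
      have "0 \<le> a n / real n" using a[of n] by simp
      then have "\<bar>y n - 1 / 2 ^ j\<bar> \<le> 1 * (a n / real n)"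
        unfolding eq abs_mult using b by (intro mult_mono) auto
      then show ?case by simp
    qed
  qed
  then have y: "y \<longlonglongrightarrow> 1 / 2 ^ j" by (simp add: Lim_null[of y])
  have "(\<lambda>n. sqrt (1 / y n)) \<longlonglongrightarrow> sqrt (1 / (1 / 2 ^ j))"
    by (intro tendsto_real_sqrt tendsto_divide tendsto_const y) simp
  also have "sqrt (1 / (1 / 2 ^ j)) = 2 powr (real j / 2)"
    by (simp add: powr_half_sqrt[symmetric] powr_realpow[symmetric] powr_powr)
  also have "(\<lambda>n. sqrt (1 / y n)) = (\<lambda>n. sqrt (real n / a n) / sqrt (real (neff S j n)))"
    by (simp add: y_def real_sqrt_divide real_sqrt_mult mult.commute)
  finally have 1: "(\<lambda>n. sqrt (real n / a n) / sqrt (real (neff S j n))) \<longlonglongrightarrow> 2 powr (real j / 2)" .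
  then show "(\<lambda>n. sqrt (real n / real (ascale S n)) / sqrt (real (neff S j n))) \<longlonglongrightarrow> 2 powr (real j / 2)"
    by (simp add: a_def)
  have "(\<lambda>n. sqrt (a n / real n)) \<longlonglongrightarrow> sqrt 0" using lim by (intro tendsto_real_sqrt) (simp add: a_def)
  from tendsto_mult[OF 1 this]
  have 2: "(\<lambda>n. sqrt (real n / a n) / sqrt (real (neff S j n)) * sqrt (a n / real n)) \<longlonglongrightarrow> 0" by simp
  have "\<forall>\<^sub>F n in sequentially. sqrt (real n / a n) / sqrt (real (neff S j n)) * sqrt (a n / real n) = 1 / sqrt (real (neff S j n))"
    using eventually_gt_at_top[of 0]
  proof eventually_elim
    case (elim n)
    then show ?case using a[of n] by (simp add: real_sqrt_divide)
  qed
  then show "(\<lambda>n. 1 / sqrt (real (neff S j n))) \<longlonglongrightarrow> 0" by (rule Lim_transform_eventually[OF 2])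
qed

text \<open>
  For large \<open>n\<close> the events that \<open>\<lambda>\<^sub>q(W) / a\<^bsup>2 h\<^sub>q + 1\<^esup>\<close> is far from \<open>x\<close> and that the fluctuation exceeds \<open>K\<close>
  both have probability below 1/2, so some outcome avoids both. At that outcome \<open>log x\<close> is close
  to \<open>log g\<close>, as the two logarithms of eigenvalues differ by at most \<open>K / \<surd>(n\<^sub>a\<^sub>,\<^sub>j)\<close>.
\<close>

lemma eigenvalue_limits_agree:
  assumes S: "factor_model S" and j: "j1 \<le> j2" "j \<in> {j1..j2}" and q: "q \<in> {1..rdim S}"
    and lim: "(\<lambda>n. real (ascale S n) / real n) \<longlonglongrightarrow> 0"
    and \<xi>: "tendsto_in_prob (prb S) (\<lambda>n \<omega>. top_eig S n q (Wmat S j n \<omega>) / real (ascale S n) powr (2 * hexp S q + 1)) x" "0 < x"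
    and fluct: "is_log_eig_cov S j1 j2 \<Sigma>"
    and \<gamma>: "(\<lambda>n. top_eig S n q (EW S j n) / real (ascale S n) powr (2 * hexp S q + 1)) \<longlonglongrightarrow> g" "0 < g"
  shows "x = g"
proof -
  interpret prob_space "prb S" using factor_model_D(1)[OF S] .
  define D where "D = (j2 - j1 + 1) * rdim S"
  define c where "c = (j - j1) * rdim S + (q - 1)"
  have c: "c < D"
  proof -
    have "q - 1 < rdim S" using q by auto
    then have "c < (j - j1) * rdim S + rdim S" by (simp add: c_def)
    also have "\<dots> = (j - j1 + 1) * rdim S" by simp
    also have "\<dots> \<le> D" unfolding D_def using j by (intro mult_right_mono) auto
    finally show ?thesis .
  qed
  define s where "s n = real (ascale S n) powr (2 * hexp S q + 1)" for n
  have s: "0 < s n" for n using factor_model_D(7)[OF S, of n] by (simp add: s_def)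
  define l where "l n \<omega> = top_eig S n q (Wmat S j n \<omega>)" for n \<omega>
  define m where "m n = top_eig S n q (EW S j n)" for n
  have Vc: "log_eig_fluct S j1 j2 n \<omega> $ c = sqrt (real (neff S j n)) * (ln (l n \<omega>) - ln (m n))" for n \<omega>
    using log_eig_fluct_nth[of "j - j1" j2 j1 "q - 1" S n \<omega>] j q by (auto simp: c_def l_def m_def)
  obtain \<mu> where cn: "centered_normal D \<Sigma> \<mu>" and wc: "weak_conv_vec D (prb S) (log_eig_fluct S j1 j2) \<mu>"
    using fluct by (auto simp: is_log_eig_cov_def conv_dist_normal_def D_def)
  have \<mu>: "prob_space \<mu>" "sets \<mu> = sets (PiM {..<D} (\<lambda>_. borel))" using cn by (auto simp: centered_normal_def)
  obtain K where K: "0 < K" "\<forall>\<^sub>F n in sequentially. measure (prb S) {\<omega>\<in>space (prb S). \<exists>k<D. K < \<bar>log_eig_fluct S j1 j2 n \<omega> $ k\<bar>} < 1 / 2"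
    using weak_conv_vec_tight[OF prob_space_axioms \<mu> wc, of "1 / 2"] by auto
  have close: "\<bar>ln x - ln g\<bar> \<le> 3 * \<epsilon>" if \<epsilon>: "0 < \<epsilon>" for \<epsilon> :: real
  proof -
    have "isCont ln x" using \<xi>(2) by (intro isCont_ln) auto
    then obtain \<delta>0 where \<delta>0: "0 < \<delta>0" "\<And>y. \<bar>y - x\<bar> < \<delta>0 \<Longrightarrow> \<bar>ln y - ln x\<bar> < \<epsilon>"
      using \<epsilon> unfolding continuous_at_eps_delta dist_real_def by metis
    define \<delta> where "\<delta> = min (\<delta>0 / 2) (x / 2)"
    have \<delta>: "0 < \<delta>" "\<delta> < \<delta>0" "\<delta> < x" using \<delta>0 \<xi>(2) by (auto simp: \<delta>_def min_def)
    have p1: "\<forall>\<^sub>F n in sequentially. measure (prb S) {\<omega>\<in>space (prb S). \<bar>l n \<omega> / s n - x\<bar> > \<delta>} < 1 / 2"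
      using \<xi>(1) \<delta>(1) unfolding tendsto_in_prob_def l_def s_def by (intro order_tendstoD(2)[of _ 0]) auto
    have meas: "\<forall>\<^sub>F n in sequentially. (\<lambda>\<omega>. l n \<omega> / s n) \<in> borel_measurable (prb S)"
      using \<xi>(1) unfolding tendsto_in_prob_def l_def s_def by simp
    have rv: "\<forall>\<^sub>F n in sequentially. random_vec (prb S) D (log_eig_fluct S j1 j2 n)" using wc by (simp add: weak_conv_vec_def)
    have "(\<lambda>n. K * (1 / sqrt (real (neff S j n)))) \<longlonglongrightarrow> K * 0" by (intro tendsto_mult tendsto_const sqrt_neff_ratio(2)[OF S lim])
    then have p2: "\<forall>\<^sub>F n in sequentially. K * (1 / sqrt (real (neff S j n))) < \<epsilon>" using \<epsilon> by (intro order_tendstoD(2)) auto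
    have npos: "\<forall>\<^sub>F n in sequentially. 0 < sqrt (real (neff S j n))"
    proof -
      have "0 < 2 powr (real j / 2)" by simp
      from order_tendstoD(1)[OF sqrt_neff_ratio(1)[OF S lim, of j] this]
      show ?thesis by eventually_elim (auto simp: zero_less_divide_iff intro!: Nat.gr0I)
    qed
    have "(\<lambda>n. ln (m n / s n)) \<longlonglongrightarrow> ln g" using \<gamma> unfolding m_def s_def by (intro tendsto_ln) auto
    then have p3: "\<forall>\<^sub>F n in sequentially. \<bar>ln (m n / s n) - ln g\<bar> < \<epsilon>" using \<epsilon> by (auto dest: tendstoD simp: dist_real_def)
    have p4: "\<forall>\<^sub>F n in sequentially. 0 < m n / s n" using order_tendstoD(1)[OF \<gamma>] by (simp add: m_def s_def)
    have "\<forall>\<^sub>F n in sequentially. \<bar>ln x - ln g\<bar> \<le> 3 * \<epsilon>"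
      using p1 K(2) meas rv p2 npos p3 p4
    proof eventually_elim
      case (elim n)
      define E1 where "E1 = {\<omega>\<in>space (prb S). \<bar>l n \<omega> / s n - x\<bar> > \<delta>}"
      define E2 where "E2 = {\<omega>\<in>space (prb S). \<exists>k<D. K < \<bar>log_eig_fluct S j1 j2 n \<omega> $ k\<bar>}"
      have [measurable]: "(\<lambda>\<omega>. l n \<omega> / s n) \<in> borel_measurable (prb S)" using elim by simp
      have [measurable]: "(\<lambda>\<omega>. log_eig_fluct S j1 j2 n \<omega> $ k) \<in> borel_measurable (prb S)" if "k < D" for k
        using elim(4) that by (simp add: random_vec_def)
      have E1: "E1 \<in> sets (prb S)" unfolding E1_def by measurable
      have "E2 = (\<Union>k\<in>{..<D}. {\<omega>\<in>space (prb S). K < \<bar>log_eig_fluct S j1 j2 n \<omega> $ k\<bar>})" by (auto simp: E2_def)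
      also have "\<dots> \<in> sets (prb S)" by (intro sets.finite_UN) auto
      finally have E2: "E2 \<in> sets (prb S)" .
      have "measure (prb S) (E1 \<union> E2) \<le> measure (prb S) E1 + measure (prb S) E2" using E1 E2 by (rule measure_Un_le)
      also have "\<dots> < 1" using elim(1,2) by (simp add: E1_def E2_def)
      finally have "E1 \<union> E2 \<noteq> space (prb S)" using prob_space by auto
      moreover have "E1 \<union> E2 \<subseteq> space (prb S)" by (auto simp: E1_def E2_def)
      ultimately obtain \<omega> where \<omega>: "\<omega> \<in> space (prb S)" "\<omega> \<notin> E1" "\<omega> \<notin> E2" by auto
      have lx: "\<bar>l n \<omega> / s n - x\<bar> \<le> \<delta>" using \<omega> by (auto simp: E1_def)
      then have "0 < l n \<omega> / s n" using \<delta> by linarith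
      then have lpos: "0 < l n \<omega>" using s[of n] by (simp add: zero_less_divide_iff)
      have mpos: "0 < m n" using elim(8) s[of n] by (simp add: zero_less_divide_iff)
      have 1: "\<bar>ln (l n \<omega> / s n) - ln x\<bar> < \<epsilon>" using \<delta>0(2) lx \<delta> by simp
      have "\<bar>log_eig_fluct S j1 j2 n \<omega> $ c\<bar> \<le> K" using \<omega> c by (auto simp: E2_def)
      then have "sqrt (real (neff S j n)) * \<bar>ln (l n \<omega>) - ln (m n)\<bar> \<le> K" unfolding Vc abs_mult using elim(6) by simp
      then have "\<bar>ln (l n \<omega>) - ln (m n)\<bar> \<le> K * (1 / sqrt (real (neff S j n)))" using elim(6) by (simp add: field_simps)
      then have 2: "\<bar>ln (l n \<omega>) - ln (m n)\<bar> < \<epsilon>" using elim(5) by linarith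
      have "ln (l n \<omega> / s n) - ln (m n / s n) = ln (l n \<omega>) - ln (m n)"
        using lpos mpos s[of n] by (simp add: ln_div)
      then show ?case using 1 2 elim(7) by linarith
    qed
    then show ?thesis by simp
  qed
  have "\<bar>ln x - ln g\<bar> \<le> 0 + e" if "0 < e" for e :: real
    using close[of "e / 3"] that by simp
  then have "\<bar>ln x - ln g\<bar> \<le> 0" by (rule field_le_epsilon)
  then show ?thesis using \<xi>(2) \<gamma>(2) by simp
qed


theorem theorem3p2:
  fixes S :: "'a wav_model"
    and j1 j2 N :: nat
    and \<beta> :: real
    and B :: "nat \<Rightarrow> real Matrix.mat"
    and w :: "nat \<Rightarrow> real"
    and \<xi> :: "nat \<Rightarrow> nat \<Rightarrow> real"
    and \<Sigma>\<^sub>L :: "real Matrix.mat"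
  assumes "j1 < j2"
    and "factor_model S"
    and "multiresolution (phi S) (psi S)"
    and "cond_W1 (psi S) N" and "cond_W2 (phi S) (psi S)" and "cond_W3 (psi S)"
    and "cond_W4 (phi S) N"
    and "cond_A1 S j1 j2" and "cond_A2 S j1 j2" and "cond_A3 S j1 j2 \<beta> B"
    and "cond_A4 S j2 \<beta>" and "cond_A5 S \<beta>"
    and "(\<Sum>j=j1..j2. w j) = 0" and "(\<Sum>j=j1..j2. real j * w j) = 1"
    and "is_eig_limit S j1 j2 \<xi>"
    and "is_log_eig_cov S j1 j2 \<Sigma>\<^sub>L"
    and "strict_mono_on {1..rdim S} (hexp S) \<or>
         (\<forall>q\<in>{1..rdim S}. hexp S q = hexp S 1) \<and>
         (\<forall>q1\<in>{1..rdim S}. \<forall>q2\<in>{1..rdim S}. q1 \<noteq> q2 \<longrightarrow> \<xi> q1 1 \<noteq> \<xi> q2 1)"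
  shows "conv_dist_normal (rdim S) (prb S)
           (\<lambda>n \<omega>. Matrix.vec (rdim S) (\<lambda>i. sqrt (real n / real (ascale S n)) *
              (hhat S j1 j2 w n (i + 1) \<omega> - hexp S (i + 1))))
           (weight_mat (rdim S) j1 j2 w * \<Sigma>\<^sub>L * transpose_mat (weight_mat (rdim S) j1 j2 w))"
proof -
  note j12 = \<open>j1 < j2\<close> and S = \<open>factor_model S\<close> and A4 = \<open>cond_A4 S j2 \<beta>\<close>
  define r where "r = rdim S"
  define m where "m = j2 - j1 + 1"
  define a where "a n = real (ascale S n)" for n
  define \<eta> where "\<eta> n = a n powr (- varpi S \<beta>)" for n
  define rt where "rt n = sqrt (real n / a n)" for n
  have \<beta>: "0 < \<beta>" using \<open>cond_A3 S j1 j2 \<beta> B\<close> by (simp add: cond_A3_def)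
  have a: "0 < a n" for n using factor_model_D(7)[OF S, of n] by (simp add: a_def)
  have lim: "(\<lambda>n. real (ascale S n) / real n) \<longlonglongrightarrow> 0" using scale_rates(1)[OF S \<beta> A4] .
  have \<eta>lim: "\<eta> \<longlonglongrightarrow> 0" and rt\<eta>: "(\<lambda>n. rt n * \<eta> n) \<longlonglongrightarrow> 0"
    using scale_rates(2,3)[OF S \<beta> A4] by (simp_all add: \<eta>_def[abs_def] rt_def a_def)
  have sw0: "(\<Sum>j=j1..j2. w j) = 0" and sw1: "(\<Sum>j=j1..j2. real j * w j) = 1" by fact+
  define g where "g j q n = top_eig S n q (EW S j n) / a n powr (2 * hexp S q + 1)" for j q n
  have rate: "0 < \<xi> q (2 ^ j)" "(\<lambda>n. g j q n - \<xi> q (2 ^ j)) \<in> O(\<eta>)" "\<xi> q (2 ^ j) = 2 powr (real j * (2 * hexp S q + 1)) * \<xi> q 1"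
    if j: "j \<in> {j1..j2}" and q: "q \<in> {1..r}" for j q
  proof -
    have \<xi>: "tendsto_in_prob (prb S) (\<lambda>n \<omega>. top_eig S n q (Wmat S j n \<omega>) / real (ascale S n) powr (2 * hexp S q + 1)) (\<xi> q (2 ^ j))"
      "0 < \<xi> q (2 ^ j)" "\<xi> q (2 ^ j) = 2 powr (real j * (2 * hexp S q + 1)) * \<xi> q 1"
      using \<open>is_eig_limit S j1 j2 \<xi>\<close> j q unfolding is_eig_limit_def r_def by blast+
    have "strict_mono_on {1..rdim S} (hexp S) \<or> (\<forall>q\<in>{1..rdim S}. hexp S q = hexp S 1)" using assms(17) by blast
    then obtain \<gamma> where \<gamma>: "0 < \<gamma> q" "(\<lambda>n. g j q n - \<gamma> q) \<in> O(\<eta>)"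
      using EW_eigenvalue_rate[OF S assms(5) assms(9,10) A4 assms(12) j] q
      unfolding g_def \<eta>_def a_def r_def by blast
    have "g j q \<longlonglongrightarrow> \<gamma> q" by (rule ln_rate(2)[OF \<gamma>(2,1) \<eta>lim])
    then have "\<xi> q (2 ^ j) = \<gamma> q"
      using eigenvalue_limits_agree[OF S less_imp_le[OF j12] j _ lim \<xi>(1,2) assms(16), of "\<gamma> q"] q \<gamma>(1)
      by (simp add: g_def[abs_def] a_def r_def)
    then show "0 < \<xi> q (2 ^ j)" "(\<lambda>n. g j q n - \<xi> q (2 ^ j)) \<in> O(\<eta>)" "\<xi> q (2 ^ j) = 2 powr (real j * (2 * hexp S q + 1)) * \<xi> q 1"
      using \<xi> \<gamma> by simp_all
  qed
  (* the deterministic bias, and the coefficients of the fluctuations in the estimation error *)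
  define b where "b n i = rt n * (1 / 2 * ((\<Sum>j=j1..j2. w j * (ln (top_eig S n (i + 1) (EW S j n)) / ln 2)) - 1) - hexp S (i + 1))" for n i
  define cf where "cf n j = rt n / sqrt (real (neff S j n)) * (w j / (2 * ln 2))" for n j
  define A where "A n i c = (if c mod r = i then cf n (j1 + c div r) else 0)" for n i c
  have blim: "(\<lambda>n. b n i) \<longlonglongrightarrow> 0" if i: "i < r" for i
  proof -
    define q where "q = i + 1"
    have q: "q \<in> {1..r}" using i by (simp add: q_def)
    define H where "H = 2 * hexp S q + 1"
    have \<xi>1: "0 < \<xi> q 1" using rate(1,3)[OF _ q, of j1] j12 by (simp add: zero_less_mult_iff)
    have "(\<lambda>n. 1 / (2 * ln 2) * (\<Sum>j=j1..j2. w j * (rt n * (ln (g j q n) - ln (\<xi> q (2 ^ j)))))) \<longlonglongrightarrow> 1 / (2 * ln 2) * (\<Sum>j=j1..j2. w j * 0)"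
    proof (intro tendsto_mult tendsto_const tendsto_sum)
      fix j assume j: "j \<in> {j1..j2}"
      have "(\<lambda>n. ln (g j q n) - ln (\<xi> q (2 ^ j))) \<in> O(\<eta>)" by (rule ln_rate(1)[OF rate(2,1)[OF j q] \<eta>lim])
      then have "(\<lambda>n. rt n * (ln (g j q n) - ln (\<xi> q (2 ^ j)))) \<in> O(\<lambda>n. rt n * \<eta> n)" by (rule landau_o.big.mult_left)
      from landau_o.big_small_trans[OF this smalloI_tendsto[of _ "\<lambda>_. 1"]]
      have "(\<lambda>n. rt n * (ln (g j q n) - ln (\<xi> q (2 ^ j)))) \<in> o(\<lambda>_. 1)" using rt\<eta> by simp
      then show "(\<lambda>n. rt n * (ln (g j q n) - ln (\<xi> q (2 ^ j)))) \<longlonglongrightarrow> 0" by (auto dest: smalloD_tendsto)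
    qed
    then have lim0: "(\<lambda>n. 1 / (2 * ln 2) * (\<Sum>j=j1..j2. w j * (rt n * (ln (g j q n) - ln (\<xi> q (2 ^ j)))))) \<longlonglongrightarrow> 0" by simp
    have gpos: "\<forall>\<^sub>F n in sequentially. \<forall>j\<in>{j1..j2}. 0 < g j q n"
    proof (intro eventually_ball_finite ballI)
      fix j assume j: "j \<in> {j1..j2}"
      show "\<forall>\<^sub>F n in sequentially. 0 < g j q n"
        using order_tendstoD(1)[OF ln_rate(2)[OF rate(2,1)[OF j q] \<eta>lim] rate(1)[OF j q]] .
    qed simp
    have ln\<xi>: "(\<Sum>j=j1..j2. w j * ln (\<xi> q (2 ^ j))) = H * ln 2"
    proof -
      have "(\<Sum>j=j1..j2. w j * ln (\<xi> q (2 ^ j))) = (\<Sum>j=j1..j2. (H * ln 2) * (real j * w j) + ln (\<xi> q 1) * w j)"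
      proof (rule sum.cong[OF refl])
        fix j assume j: "j \<in> {j1..j2}"
        have "ln (\<xi> q (2 ^ j)) = real j * H * ln 2 + ln (\<xi> q 1)"
          unfolding rate(3)[OF j q] using \<xi>1 by (simp add: ln_mult ln_powr H_def)
        then show "w j * ln (\<xi> q (2 ^ j)) = (H * ln 2) * (real j * w j) + ln (\<xi> q 1) * w j" by (simp add: algebra_simps)
      qed
      also have "\<dots> = (H * ln 2) * (\<Sum>j=j1..j2. real j * w j) + ln (\<xi> q 1) * (\<Sum>j=j1..j2. w j)"
        by (simp add: sum.distrib sum_distrib_left)
      finally show ?thesis by (simp add: sw0 sw1)
    qed
    have "\<forall>\<^sub>F n in sequentially. 1 / (2 * ln 2) * (\<Sum>j=j1..j2. w j * (rt n * (ln (g j q n) - ln (\<xi> q (2 ^ j))))) = b n i"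
      using gpos
    proof eventually_elim
      case (elim n)
      have "ln (top_eig S n q (EW S j n)) = ln (g j q n) + H * ln (a n)" if "j \<in> {j1..j2}" for j
      proof -
        have "top_eig S n q (EW S j n) = g j q n * a n powr H" using a[of n] by (simp add: g_def H_def)
        moreover have "0 < g j q n" using elim that by blast
        ultimately show ?thesis using a[of n] by (simp add: ln_mult ln_powr)
      qed
      then have "(\<Sum>j=j1..j2. w j * ln (top_eig S n q (EW S j n))) = (\<Sum>j=j1..j2. w j * ln (g j q n) + (H * ln (a n)) * w j)"
        by (intro sum.cong refl) (simp add: algebra_simps)
      also have "\<dots> = (\<Sum>j=j1..j2. w j * ln (g j q n))"
        by (simp add: sum.distrib sw0 flip: sum_distrib_left)
      finally have e1: "(\<Sum>j=j1..j2. w j * ln (top_eig S n q (EW S j n))) = (\<Sum>j=j1..j2. w j * ln (g j q n))" .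
      have "(\<Sum>j=j1..j2. w j * (rt n * (ln (g j q n) - ln (\<xi> q (2 ^ j))))) =
         rt n * ((\<Sum>j=j1..j2. w j * ln (g j q n)) - (\<Sum>j=j1..j2. w j * ln (\<xi> q (2 ^ j))))"
        by (simp add: sum_subtractf[symmetric] sum_distrib_left algebra_simps)
      also have "\<dots> = rt n * ((\<Sum>j=j1..j2. w j * ln (top_eig S n q (EW S j n))) - H * ln 2)" unfolding e1 ln\<xi> ..
      finally have e2: "(\<Sum>j=j1..j2. w j * (rt n * (ln (g j q n) - ln (\<xi> q (2 ^ j))))) = rt n * ((\<Sum>j=j1..j2. w j * ln (top_eig S n q (EW S j n))) - H * ln 2)" .
      have "(\<Sum>j=j1..j2. w j * (ln (top_eig S n q (EW S j n)) / ln 2)) = (\<Sum>j=j1..j2. w j * ln (top_eig S n q (EW S j n))) / ln 2"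
        by (simp add: sum_divide_distrib)
      then show ?case unfolding e2 b_def q_def[symmetric] H_def by (simp add: field_simps)
    qed
    then show ?thesis by (rule Lim_transform_eventually[OF lim0])
  qed
  have Alim: "(\<lambda>n. A n i c) \<longlonglongrightarrow> weight_mat r j1 j2 w $$ (i, c)" if "i < r" "c < m * r" for i c
  proof (cases "c mod r = i")
    case True
    have "(\<lambda>n. rt n / sqrt (real (neff S (j1 + c div r) n)) * (w (j1 + c div r) / (2 * ln 2))) \<longlonglongrightarrow>
        2 powr (real (j1 + c div r) / 2) * (w (j1 + c div r) / (2 * ln 2))"
      unfolding rt_def a_def by (intro tendsto_mult tendsto_const sqrt_neff_ratio(1)[OF S lim])
    then show ?thesis using True that by (simp add: A_def cf_def weight_mat_def m_def Let_def mult_ac)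
  next
    case False
    then show ?thesis using that by (simp add: A_def weight_mat_def m_def Let_def)
  qed
  have npos: "\<forall>\<^sub>F n in sequentially. \<forall>j\<in>{j1..j2}. 0 < neff S j n"
  proof (intro eventually_ball_finite ballI)
    fix j assume "j \<in> {j1..j2}"
    have "0 < 2 powr (real j / 2)" by simp
    from order_tendstoD(1)[OF sqrt_neff_ratio(1)[OF S lim, of j] this]
    show "\<forall>\<^sub>F n in sequentially. 0 < neff S j n" by eventually_elim (auto intro!: Nat.gr0I)
  qed simp
  have U: "\<forall>\<^sub>F n in sequentially. \<forall>\<omega>\<in>space (prb S).
     Matrix.vec r (\<lambda>i. rt n * (hhat S j1 j2 w n (i + 1) \<omega> - hexp S (i + 1))) =
     Matrix.vec r (\<lambda>i. (\<Sum>c<m * r. A n i c * log_eig_fluct S j1 j2 n \<omega> $ c) + b n i)"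
    using npos
  proof eventually_elim
    case (elim n)
    show ?case
    proof (intro ballI eq_vecI; simp)
      fix \<omega> i assume i: "i < r"
      define L where "L j = ln (top_eig S n (i + 1) (Wmat S j n \<omega>))" for j
      define E where "E j = ln (top_eig S n (i + 1) (EW S j n))" for j
      have "(\<Sum>c<m * r. A n i c * log_eig_fluct S j1 j2 n \<omega> $ c) =
         (\<Sum>l<m. \<Sum>i'<r. A n i (l * r + i') * log_eig_fluct S j1 j2 n \<omega> $ (l * r + i'))" by (rule sum_blocks)
      also have "\<dots> = (\<Sum>l<m. \<Sum>i'<r. if i' = i then cf n (j1 + l) * log_eig_fluct S j1 j2 n \<omega> $ (l * r + i) else 0)"
        by (intro sum.cong refl) (auto simp: A_def)
      also have "\<dots> = (\<Sum>l<m. cf n (j1 + l) * log_eig_fluct S j1 j2 n \<omega> $ (l * r + i))" using i by simp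
      also have "\<dots> = (\<Sum>l<m. rt n * (w (j1 + l) / (2 * ln 2)) * (L (j1 + l) - E (j1 + l)))"
      proof (rule sum.cong[OF refl])
        fix l assume "l \<in> {..<m}"
        then have l: "l \<le> j2 - j1" by (simp add: m_def)
        have "log_eig_fluct S j1 j2 n \<omega> $ (l * r + i) = sqrt (real (neff S (j1 + l) n)) * (L (j1 + l) - E (j1 + l))"
          using log_eig_fluct_nth[OF l less_imp_le[OF j12], of i S n \<omega>] i by (simp add: r_def L_def E_def)
        moreover have "0 < neff S (j1 + l) n" using elim l j12 by auto
        ultimately show "cf n (j1 + l) * log_eig_fluct S j1 j2 n \<omega> $ (l * r + i) = rt n * (w (j1 + l) / (2 * ln 2)) * (L (j1 + l) - E (j1 + l))"
          by (simp add: cf_def)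
      qed
      also have "\<dots> = (\<Sum>j=j1..j2. rt n * (w j / (2 * ln 2)) * (L j - E j))"
        using j12 by (intro sum.reindex_bij_witness[of _ "\<lambda>j. j - j1" "\<lambda>l. j1 + l"]) (auto simp: m_def)
      also have "\<dots> = rt n / (2 * ln 2) * ((\<Sum>j=j1..j2. w j * L j) - (\<Sum>j=j1..j2. w j * E j))"
        by (simp add: sum_subtractf[symmetric] sum_distrib_left algebra_simps)
      finally have e1: "(\<Sum>c<m * r. A n i c * log_eig_fluct S j1 j2 n \<omega> $ c) =
         rt n / (2 * ln 2) * ((\<Sum>j=j1..j2. w j * L j) - (\<Sum>j=j1..j2. w j * E j))" .
      have e2: "(\<Sum>j=j1..j2. w j * (E j / ln 2)) = (\<Sum>j=j1..j2. w j * E j) / ln 2"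
        "(\<Sum>j=j1..j2. w j * log 2 (top_eig S n (i + 1) (Wmat S j n \<omega>))) = (\<Sum>j=j1..j2. w j * L j) / ln 2"
        by (simp_all add: sum_divide_distrib log_def L_def)
      show "rt n * (hhat S j1 j2 w n (Suc i) \<omega> - hexp S (Suc i)) = (\<Sum>c<m * r. A n i c * log_eig_fluct S j1 j2 n \<omega> $ c) + b n i"
        unfolding e1 b_def hhat_def E_def[symmetric] using e2 by (simp add: field_simps)
    qed
  qed
  have \<Sigma>: "conv_dist_normal (m * r) (prb S) (log_eig_fluct S j1 j2) \<Sigma>\<^sub>L" "\<Sigma>\<^sub>L \<in> carrier_mat (m * r) (m * r)"
    using assms(16) by (auto simp: is_log_eig_cov_def pos_semidef_def m_def r_def)
  have W: "weight_mat r j1 j2 w \<in> carrier_mat r (m * r)" by (simp add: weight_mat_def m_def)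
  show ?thesis
    using conv_dist_normal_affine[OF factor_model_D(1)[OF S] \<Sigma> W Alim blim U] by (simp add: r_def rt_def a_def)
qed

end
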